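(* Let $\varphi\in L^\infty$ be such that $K_1(\varphi)\neq\{0\}$, and let $\psi$ be a nonconstant inner function for which the subspace $E_{\varphi,\psi}:=K_1(\varphi)\cap\psi H^1$ is proximinal in $K_1(\varphi)$. Let $f\in K_1(\varphi)$ be such that the coset $f+E_{\varphi,\psi}$ has norm $1$ in $K_1(\varphi)/E_{\varphi,\psi}$. Then the following are equivalent: (i) $f+E_{\varphi,\psi}$ is an extreme point of $\mathrm{ball}\,(K_1(\varphi)/E_{\varphi,\psi})$; (ii) there is a function $h\in K_1(\varphi)$ with $\mathcal{M}(f;K_1(\varphi),E_{\varphi,\psi})=\{h\}$ and such that the inner factors of $h$ and $\overline{z\varphi h}$ are relatively prime.
   Context: $\mathbb{T}$ is the unit circle with normalized Haar measure $m$, $L^p=L^p(\mathbb{T},m)$, and $H^p=\{f\in L^p:\widehat f(k)=0\ \forall k<0\}$ (Hardy space), where $\widehat f(k)=\int_{\mathbb{T}}\bar\zeta^kf(\zeta)\,dm(\zeta)$; $z$ denotes the identity function $z(\zeta)=\zeta$ on $\mathbb{T}$. An inner function is $\psi\in H^\infty$ with $|\psi|=1$ a.e. on $\mathbb{T}$; every nonzero $H^1$ function factors as (inner)$\times$(outer), and its inner factor is the inner function in this factorization. For $\varphi\in L^\infty$, $K_1(\varphi):=\{f\in H^1:\ \overline{z\varphi f}\in H^1\}$ (the kernel in $H^1$ of the Toeplitz operator with symbol $\varphi$), a closed subspace of $H^1$ equipped with the norm $\|\cdot\|_1$. Two functions $u,v\in H^1$ have relatively prime inner factors if there is no nonconstant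 inner function $J$ with $u/J\in H^1$ and $v/J\in H^1$. For a Banach space $X$ and closed subspace $Y$: $X/Y$ carries the quotient norm $\|x+Y\|=\inf_{y\in Y}\|x+y\|$; $\mathcal{M}(x;X,Y):=\{\xi\in x+Y:\|\xi\|=\|x+Y\|_{X/Y}\}$; $Y$ is proximinal in $X$ if $\mathcal{M}(x;X,Y)\neq\emptyset$ for every $x\in X$. $\mathrm{ball}\,(Z)$ denotes the closed unit ball of a Banach space $Z$, and a point of it is extreme if it is not the midpoint of two distinct points of the ball. *)

theory Defs
  imports "HOL-Analysis.Analysis"
begin

text \<open>Normalized Haar measure on the unit circle: push-forward of the uniform
  probability measure on [0, 2 pi] under t \<mapsto> e^{it}.  Functions on the circle are
  represented by functions complex \<Rightarrow> complex (only their values on the circle matter,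
  up to null sets).\<close>
definition circle_m :: "complex measure" where
  "circle_m = distr (uniform_measure lborel {0..2*pi}) borel cis"

definition fourier_coeff :: "(complex \<Rightarrow> complex) \<Rightarrow> int \<Rightarrow> complex" where
  "fourier_coeff f k = (\<integral>\<zeta>. (cnj \<zeta>) powi k * f \<zeta> \<partial>circle_m)"

definition Linf :: "(complex \<Rightarrow> complex) set" where
  "Linf = {f. f \<in> borel_measurable circle_m \<and> (\<exists>C. AE \<zeta> in circle_m. norm (f \<zeta>) \<le> C)}"

definition H1 :: "(complex \<Rightarrow> complex) set" where
  "H1 = {f. integrable circle_m f \<and> (\<forall>k<0. fourier_coeff f k = 0)}"

definition Hinf :: "(complex \<Rightarrow> complex) set" where
  "Hinf = {f. f \<in> Linf \<and> (\<forall>k<0. fourier_coeff f k = 0)}"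

definition inner_fun :: "(complex \<Rightarrow> complex) \<Rightarrow> bool" where
  "inner_fun \<psi> \<longleftrightarrow> \<psi> \<in> Hinf \<and> (AE \<zeta> in circle_m. norm (\<psi> \<zeta>) = 1)"

definition ae_constant :: "(complex \<Rightarrow> complex) \<Rightarrow> bool" where
  "ae_constant \<psi> \<longleftrightarrow> (\<exists>c. AE \<zeta> in circle_m. \<psi> \<zeta> = c)"

definition ae_zero :: "(complex \<Rightarrow> complex) \<Rightarrow> bool" where
  "ae_zero f \<longleftrightarrow> (AE \<zeta> in circle_m. f \<zeta> = 0)"

text \<open>Kernel in H^1 of the Toeplitz operator with symbol phi.\<close>
definition K1 :: "(complex \<Rightarrow> complex) \<Rightarrow> (complex \<Rightarrow> complex) set" where
  "K1 \<phi> = {f \<in> H1. (\<lambda>\<zeta>. cnj (\<zeta> * \<phi> \<zeta> * f \<zeta>)) \<in> H1}"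

definition mult_H1 :: "(complex \<Rightarrow> complex) \<Rightarrow> (complex \<Rightarrow> complex) set" where
  "mult_H1 \<psi> = {f. \<exists>g\<in>H1. AE \<zeta> in circle_m. f \<zeta> = \<psi> \<zeta> * g \<zeta>}"

definition E_sub :: "(complex \<Rightarrow> complex) \<Rightarrow> (complex \<Rightarrow> complex) \<Rightarrow> (complex \<Rightarrow> complex) set" where
  "E_sub \<phi> \<psi> = K1 \<phi> \<inter> mult_H1 \<psi>"

definition rel_prime_inner :: "(complex \<Rightarrow> complex) \<Rightarrow> (complex \<Rightarrow> complex) \<Rightarrow> bool" where
  "rel_prime_inner u v \<longleftrightarrow>
     \<not> (\<exists>J. inner_fun J \<and> \<not> ae_constant J \<and>
            (\<lambda>\<zeta>. u \<zeta> / J \<zeta>) \<in> H1 \<and> (\<lambda>\<zeta>. v \<zeta> / J \<zeta>) \<in> H1)"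

definition norm1 :: "(complex \<Rightarrow> complex) \<Rightarrow> real" where
  "norm1 f = (\<integral>\<zeta>. norm (f \<zeta>) \<partial>circle_m)"

definition qnorm :: "(complex \<Rightarrow> complex) set \<Rightarrow> (complex \<Rightarrow> complex) \<Rightarrow> real" where
  "qnorm Y x = Inf ((\<lambda>y. norm1 (\<lambda>\<zeta>. x \<zeta> + y \<zeta>)) ` Y)"

definition Mset :: "(complex \<Rightarrow> complex) set \<Rightarrow> (complex \<Rightarrow> complex) set \<Rightarrow> (complex \<Rightarrow> complex)
                    \<Rightarrow> (complex \<Rightarrow> complex) set" where
  "Mset X Y x = {\<xi>. \<xi> \<in> X \<and> (\<exists>y\<in>Y. \<xi> = (\<lambda>\<zeta>. x \<zeta> + y \<zeta>)) \<and> norm1 \<xi> = qnorm Y x}"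

definition proximinal :: "(complex \<Rightarrow> complex) set \<Rightarrow> (complex \<Rightarrow> complex) set \<Rightarrow> bool" where
  "proximinal X Y \<longleftrightarrow> (\<forall>x\<in>X. Mset X Y x \<noteq> {})"

definition ae_singleton :: "(complex \<Rightarrow> complex) set \<Rightarrow> (complex \<Rightarrow> complex) \<Rightarrow> bool" where
  "ae_singleton S h \<longleftrightarrow> h \<in> S \<and> (\<forall>\<xi>\<in>S. AE \<zeta> in circle_m. \<xi> \<zeta> = h \<zeta>)"

definition quotient_extreme :: "(complex \<Rightarrow> complex) set \<Rightarrow> (complex \<Rightarrow> complex) set
                                \<Rightarrow> (complex \<Rightarrow> complex) \<Rightarrow> bool" where
  "quotient_extreme X Y x \<longleftrightarrow> qnorm Y x \<le> 1 \<and>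
     (\<forall>u\<in>X. \<forall>v\<in>X. qnorm Y u \<le> 1 \<longrightarrow> qnorm Y v \<le> 1 \<longrightarrow>
        (\<lambda>\<zeta>. x \<zeta> - (u \<zeta> + v \<zeta>) / 2) \<in> Y \<longrightarrow> (\<lambda>\<zeta>. u \<zeta> - v \<zeta>) \<in> Y)"

end

theory Submission
  imports Defs "HOL-Probability.Probability_Measure"
begin

text \<open>Two functions of norm at most one whose midpoint h has norm one are of the form
  h (1 + tau), h (1 - tau) with tau real and bounded. The square-integrable Hardy functions p for
  which tau p stays in the Hardy space form a closed shift-invariant space, so Beurling's argument
  yields an inner function J that divides h and the conjugate of z phi h and for which tau J is
  analytic. If the two functions have no common inner divisor, then J is constant and so is the
  real analytic function tau. Conversely, a common inner divisor J allows the perturbations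
  tau = Re (c J) - const, which move the coset unless psi divides all of them; in that case psi
  divides h and the coset vanishes.

  Inner-outer factorization is avoided: the passage from integrable to square-integrable Hardy
  functions uses multipliers obtained as minimizers in Szego's weighted extremal problem.\<close>

section \<open>Haar measure on the circle\<close>

text \<open>Reality of tau is equality in the triangle inequality, and it lets one multiplier serve
  two Hardy functions: conjugation does not see it, so tau multiplies the conjugate of z phi h as
  well as h. The obstacle is integrability. Beurling's argument lives on orthogonality, but the
  functions of interest are only integrable. A function G with (norm G)^2 (1 + eps norm p) constant
  repairs this: its square makes p bounded, keeps it in the Hardy space and tends to 1 along
  suitable eps tending to 0. It comes from a weighted extremal problem because an element orthogonal
  to its own shifts has constant modulus, the same fact that produces J. In the converse, the
  constant subtracted from Re (c J) is its mean against the density norm h, so that h (1 + s tau)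
  keeps norm 1 for small real s. The choices c = 1 and c = i together involve J and its conjugate,
  and eliminating both leaves (1 - (norm b)^2) h, where b is the mean of the conjugate of J.
  Uniqueness of the minimizer under (i) comes from the rigidity argument of the other direction,
  applied to the midpoint of two minimizers.\<close>

lemma sets_circle_m [simp, measurable_cong]: "sets circle_m = sets borel"
  by (simp add: circle_m_def)

lemma space_circle_m [simp]: "space circle_m = UNIV"
  by (simp add: circle_m_def)

lemma measurable_cis [measurable]: "cis \<in> borel_measurable borel"
  by (intro borel_measurable_continuous_onI continuous_on_cis continuous_on_id)

interpretation circle: prob_space circle_m
proof -
  have "prob_space (uniform_measure lborel {0..2*pi::real})"
    by (rule prob_space_uniform_measure) auto
  then show "prob_space circle_m"
    unfolding circle_m_def by (rule prob_space.prob_space_distr) simp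
qed

lemma AE_circle_norm: "AE \<zeta> in circle_m. norm \<zeta> = 1"
  unfolding circle_m_def by (subst AE_distr_iff) auto

lemma AE_circle_cnj: "AE \<zeta> in circle_m. \<zeta> * cnj \<zeta> = 1 \<and> cnj \<zeta> * \<zeta> = 1"
  using AE_circle_norm by eventually_elim (simp add: complex_norm_square[symmetric] mult.commute[of "cnj _"])

lemma integral_circle_power:
  assumes "n > 0"
  shows "(\<integral>\<zeta>. \<zeta> ^ n \<partial>circle_m) = 0"
proof -
  have [measurable]: "(\<lambda>t. cis t ^ n) \<in> borel_measurable borel" by measurable
  \<comment> \<open>The antiderivative has equal values at the two ends by periodicity; dividing by
    n is where positivity of n enters.\<close>
  have deriv: "((\<lambda>t. cis t ^ n / (\<i> * n)) has_vector_derivative cis t ^ n) (at t within {0..2*pi})" for t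
  proof -
    have "((\<lambda>z. exp (\<i> * n * z) / (\<i> * n)) has_field_derivative exp (\<i> * n * of_real t)) (at (of_real t))"
      using assms by (auto intro!: derivative_eq_intros)
    then have "((\<lambda>t. exp (\<i> * n * of_real t) / (\<i> * n)) has_vector_derivative exp (\<i> * n * of_real t)) (at t within {0..2*pi})"
      by (rule has_vector_derivative_real_field)
    moreover have "cis s ^ n = exp (\<i> * n * of_real s)" for s
      by (simp add: cis_conv_exp exp_of_nat_mult[symmetric] mult_ac)
    ultimately show ?thesis by simp
  qed
  have "(\<integral>t. indicator {0..2*pi} t *\<^sub>R cis t ^ n \<partial>lborel) = cis (2*pi) ^ n / (\<i> * n) - cis 0 ^ n / (\<i> * n)"
    by (rule integral_FTC_atLeastAtMost) (auto intro!: deriv continuous_intros)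
  then have zero: "(\<integral>t. indicator {0..2*pi} t *\<^sub>R cis t ^ n \<partial>lborel) = 0" by simp
  \<comment> \<open>Writing the uniform measure as a density reduces the integral to one over an
    interval, where the fundamental theorem applies.\<close>
  have um: "uniform_measure lborel {0..2*pi} = density lborel (\<lambda>t. ennreal (indicator {0..2*pi} t / (2*pi)))"
    unfolding uniform_measure_def
    by (intro density_cong) (auto simp: indicator_def divide_ennreal[symmetric] ennreal_1[symmetric] simp del: ennreal_1)
  have "(\<integral>\<zeta>. \<zeta> ^ n \<partial>circle_m) = (\<integral>t. cis t ^ n \<partial>uniform_measure lborel {0..2*pi})"
    unfolding circle_m_def by (subst integral_distr) auto
  also have "\<dots> = (\<integral>t. (indicator {0..2*pi} t / (2*pi)) *\<^sub>R cis t ^ n \<partial>lborel)"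
    unfolding um by (subst integral_density) auto
  also have "\<dots> = (\<integral>t. (1 / (2*pi)) *\<^sub>R (indicator {0..2*pi} t *\<^sub>R cis t ^ n) \<partial>lborel)"
    by simp
  also have "\<dots> = 0" unfolding integral_scaleR_right using zero by simp
  finally show ?thesis .
qed

lemma integrable_bounded_mult:
  fixes f g :: "'a \<Rightarrow> complex"
  assumes f: "integrable M f" and [measurable]: "g \<in> borel_measurable M"
    and bd: "AE x in M. norm (g x) \<le> B"
  shows "integrable M (\<lambda>x. g x * f x)"
proof -
  have [measurable]: "f \<in> borel_measurable M" using f by simp
  show ?thesis
  proof (rule Bochner_Integration.integrable_bound)
    show "integrable M (\<lambda>x. B * norm (f x))" using f by simp
    show "AE x in M. norm (g x * f x) \<le> norm (B * norm (f x))"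
      using bd
    proof eventually_elim
      case (elim x)
      have "norm (g x) * norm (f x) \<le> \<bar>B\<bar> * norm (f x)"
        using elim by (intro mult_right_mono) auto
      then show ?case by (simp add: norm_mult abs_mult)
    qed
  qed simp
qed

lemma AE_norm_power_le: "AE \<zeta> in circle_m. norm (\<zeta> ^ n) \<le> 1"
  using AE_circle_norm by eventually_elim (simp add: norm_power)

lemma AE_norm_cnj_power_le: "AE \<zeta> in circle_m. norm (cnj \<zeta> ^ n) \<le> 1"
  using AE_circle_norm by eventually_elim (simp add: norm_power)

lemma measurable_cnj [measurable]: "cnj \<in> borel_measurable borel"
  by (intro borel_measurable_continuous_onI continuous_intros)

section \<open>Uniqueness of Fourier coefficients\<close>

text \<open>All Fourier coefficients vanish. Natural powers of zeta and of its conjugate stand for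
  the two signs of the index, so that no integer powers have to be manipulated.\<close>

definition fourier_null :: "(complex \<Rightarrow> complex) \<Rightarrow> bool" where
  "fourier_null f \<longleftrightarrow> integrable circle_m f \<and>
     (\<forall>n. (\<integral>\<zeta>. \<zeta> ^ n * f \<zeta> \<partial>circle_m) = 0 \<and> (\<integral>\<zeta>. cnj \<zeta> ^ n * f \<zeta> \<partial>circle_m) = 0)"

lemma integrable_power_mult:
  "integrable circle_m f \<Longrightarrow> integrable circle_m (\<lambda>\<zeta>. \<zeta> ^ n * f \<zeta>)"
  by (rule integrable_bounded_mult[OF _ _ AE_norm_power_le]) auto

lemma integrable_cnj_power_mult:
  "integrable circle_m f \<Longrightarrow> integrable circle_m (\<lambda>\<zeta>. cnj \<zeta> ^ n * f \<zeta>)"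
  by (rule integrable_bounded_mult[OF _ _ AE_norm_cnj_power_le]) auto

lemma fourier_null_integral:
  assumes "fourier_null f"
  shows "integral\<^sup>L circle_m f = 0"
proof -
  have "(\<integral>\<zeta>. \<zeta> ^ 0 * f \<zeta> \<partial>circle_m) = 0" using assms unfolding fourier_null_def by blast
  then show ?thesis by simp
qed

lemma fourier_null_add:
  assumes "fourier_null f" "fourier_null g"
  shows "fourier_null (\<lambda>\<zeta>. f \<zeta> + g \<zeta>)"
  using assms unfolding fourier_null_def
  by (simp add: distrib_left integrable_power_mult integrable_cnj_power_mult)

lemma fourier_null_cmult:
  assumes "fourier_null f"
  shows "fourier_null (\<lambda>\<zeta>. c * f \<zeta>)"
  using assms unfolding fourier_null_def
  by (simp add: mult.left_commute[of _ c])

text \<open>Multiplication by zeta shifts the coefficient sequence: the conjugate moment of order n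
  becomes that of order n - 1, and the one of order 0 becomes the first moment in zeta.\<close>

lemma fourier_null_mult_id:
  assumes "fourier_null f"
  shows "fourier_null (\<lambda>\<zeta>. \<zeta> * f \<zeta>)"
proof -
  have f: "integrable circle_m f" using assms by (simp add: fourier_null_def)
  then have [measurable]: "f \<in> borel_measurable circle_m" by simp
  have "(\<integral>\<zeta>. \<zeta> ^ n * (\<zeta> * f \<zeta>) \<partial>circle_m) = 0" for n
  proof -
    have "(\<integral>\<zeta>. \<zeta> ^ Suc n * f \<zeta> \<partial>circle_m) = 0" using assms unfolding fourier_null_def by blast
    then show ?thesis by (simp add: mult_ac)
  qed
  moreover have "(\<integral>\<zeta>. cnj \<zeta> ^ n * (\<zeta> * f \<zeta>) \<partial>circle_m) = 0" for n
  proof (cases n)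
    case 0
    moreover have "(\<integral>\<zeta>. \<zeta> ^ 1 * f \<zeta> \<partial>circle_m) = 0" using assms unfolding fourier_null_def by blast
    ultimately show ?thesis by simp
  next
    case (Suc m)
    have "AE \<zeta> in circle_m. cnj \<zeta> ^ n * (\<zeta> * f \<zeta>) = cnj \<zeta> ^ m * f \<zeta>"
      using AE_circle_cnj
    proof eventually_elim
      case (elim \<zeta>)
      have "cnj \<zeta> ^ n * (\<zeta> * f \<zeta>) = (\<zeta> * cnj \<zeta>) * (cnj \<zeta> ^ m * f \<zeta>)" unfolding Suc by simp
      then show ?case using elim by simp
    qed
    then have "(\<integral>\<zeta>. cnj \<zeta> ^ n * (\<zeta> * f \<zeta>) \<partial>circle_m) = (\<integral>\<zeta>. cnj \<zeta> ^ m * f \<zeta> \<partial>circle_m)"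
      by (intro integral_cong_AE) auto
    then show ?thesis using assms unfolding fourier_null_def by simp
  qed
  ultimately show ?thesis using assms integrable_power_mult[OF f, of 1] unfolding fourier_null_def by auto
qed

lemma fourier_null_mult_cnj:
  assumes "fourier_null f"
  shows "fourier_null (\<lambda>\<zeta>. cnj \<zeta> * f \<zeta>)"
proof -
  have f: "integrable circle_m f" using assms by (simp add: fourier_null_def)
  then have [measurable]: "f \<in> borel_measurable circle_m" by simp
  have "(\<integral>\<zeta>. cnj \<zeta> ^ n * (cnj \<zeta> * f \<zeta>) \<partial>circle_m) = 0" for n
  proof -
    have "(\<integral>\<zeta>. cnj \<zeta> ^ Suc n * f \<zeta> \<partial>circle_m) = 0" using assms unfolding fourier_null_def by blast
    then show ?thesis by (simp add: mult_ac)
  qed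
  moreover have "(\<integral>\<zeta>. \<zeta> ^ n * (cnj \<zeta> * f \<zeta>) \<partial>circle_m) = 0" for n
  proof (cases n)
    case 0
    moreover have "(\<integral>\<zeta>. cnj \<zeta> ^ 1 * f \<zeta> \<partial>circle_m) = 0" using assms unfolding fourier_null_def by blast
    ultimately show ?thesis by simp
  next
    case (Suc m)
    have "AE \<zeta> in circle_m. \<zeta> ^ n * (cnj \<zeta> * f \<zeta>) = \<zeta> ^ m * f \<zeta>"
      using AE_circle_cnj
    proof eventually_elim
      case (elim \<zeta>)
      have "\<zeta> ^ n * (cnj \<zeta> * f \<zeta>) = (\<zeta> * cnj \<zeta>) * (\<zeta> ^ m * f \<zeta>)" unfolding Suc by simp
      then show ?case using elim by simp
    qed
    then have "(\<integral>\<zeta>. \<zeta> ^ n * (cnj \<zeta> * f \<zeta>) \<partial>circle_m) = (\<integral>\<zeta>. \<zeta> ^ m * f \<zeta> \<partial>circle_m)"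
      by (intro integral_cong_AE) auto
    then show ?thesis using assms unfolding fourier_null_def by simp
  qed
  ultimately show ?thesis using assms integrable_cnj_power_mult[OF f, of 1] unfolding fourier_null_def by auto
qed

text \<open>Real polynomial functions on the plane are generated by constants and real-linear
  functionals, and such a functional is a combination of zeta and its conjugate. Closure under the
  two shifts therefore carries over.\<close>

lemma fourier_null_mult_polynomial:
  assumes "real_polynomial_function p" "fourier_null f"
  shows "fourier_null (\<lambda>\<zeta>. of_real (p \<zeta>) * f \<zeta>)"
  using assms
proof (induction arbitrary: f rule: real_polynomial_function.induct)
  case (linear p)
  interpret p: bounded_linear p by fact
  have eq: "complex_of_real (p \<zeta>) * f \<zeta> =
      (of_real (p 1) / 2) * (\<zeta> * f \<zeta> + cnj \<zeta> * f \<zeta>) + (of_real (p \<i>) / (2*\<i>)) * (\<zeta> * f \<zeta> + (-1) * (cnj \<zeta> * f \<zeta>))" for \<zeta>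
  proof -
    have "\<zeta> = Re \<zeta> *\<^sub>R 1 + Im \<zeta> *\<^sub>R \<i>" by (simp add: complex_eq_iff)
    then have "p \<zeta> = p (Re \<zeta> *\<^sub>R 1 + Im \<zeta> *\<^sub>R \<i>)" by simp
    also have "\<dots> = Re \<zeta> * p 1 + Im \<zeta> * p \<i>" unfolding p.add p.scaleR by simp
    finally have "complex_of_real (p \<zeta>) = of_real (p 1) * ((\<zeta> + cnj \<zeta>) / 2) + of_real (p \<i>) * ((\<zeta> - cnj \<zeta>) / (2*\<i>))"
      by (simp add: complex_add_cnj complex_diff_cnj mult_ac)
    then have "complex_of_real (p \<zeta>) * f \<zeta> =
      (of_real (p 1) * ((\<zeta> + cnj \<zeta>) / 2) + of_real (p \<i>) * ((\<zeta> - cnj \<zeta>) / (2*\<i>))) * f \<zeta>" by simp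
    also have "\<dots> = (of_real (p 1) / 2) * (\<zeta> * f \<zeta> + cnj \<zeta> * f \<zeta>) + (of_real (p \<i>) / (2*\<i>)) * (\<zeta> * f \<zeta> + (-1) * (cnj \<zeta> * f \<zeta>))"
      by (simp add: algebra_simps add_divide_distrib diff_divide_distrib)
    finally show ?thesis .
  qed
  show ?case unfolding eq
    by (intro fourier_null_add fourier_null_cmult fourier_null_mult_id fourier_null_mult_cnj linear)
next
  case (const c)
  then show ?case by (intro fourier_null_cmult)
next
  case (add p q)
  then show ?case using fourier_null_add by (simp add: distrib_right)
next
  case (mult p q)
  then show ?case by (simp add: mult.assoc)
qed

text \<open>Stone-Weierstrass: polynomials approximate \<open>g\<close> uniformly on the circle,
  which carries the whole measure, and the L1 norm of \<open>f\<close> controls the error.\<close>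

lemma fourier_null_continuous:
  fixes g :: "complex \<Rightarrow> real"
  assumes "continuous_on UNIV g" "fourier_null f"
  shows "(\<integral>\<zeta>. of_real (g \<zeta>) * f \<zeta> \<partial>circle_m) = 0"
proof -
  have f: "integrable circle_m f" using assms by (simp add: fourier_null_def)
  then have [measurable]: "f \<in> borel_measurable circle_m" by simp
  have [measurable]: "g \<in> borel_measurable borel"
    using assms(1) by (rule borel_measurable_continuous_onI)
  have "norm (\<integral>\<zeta>. of_real (g \<zeta>) * f \<zeta> \<partial>circle_m) \<le> e * norm1 f" if e: "e > 0" for e
  proof -
    have "continuous_on (sphere 0 1) g" using assms(1) continuous_on_subset by blast
    then obtain p where p: "real_polynomial_function p" "\<And>x. x \<in> sphere 0 1 \<Longrightarrow> \<bar>g x - p x\<bar> < e"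
      by (rule Stone_Weierstrass_real_polynomial_function[OF compact_sphere _ e]) blast
    have pn: "fourier_null (\<lambda>\<zeta>. of_real (p \<zeta>) * f \<zeta>)"
      using fourier_null_mult_polynomial p(1) assms(2) by blast
    have ip: "integrable circle_m (\<lambda>\<zeta>. of_real (p \<zeta>) * f \<zeta>)" using pn by (simp add: fourier_null_def)
    have p0: "(\<integral>\<zeta>. of_real (p \<zeta>) * f \<zeta> \<partial>circle_m) = 0"
      using pn by (rule fourier_null_integral)
    have [measurable]: "p \<in> borel_measurable borel"
      using p(1) by (intro borel_measurable_continuous_onI continuous_at_imp_continuous_on ballI continuous_real_polymonial_function)
    have bd: "AE \<zeta> in circle_m. norm (complex_of_real (g \<zeta> - p \<zeta>)) \<le> e"
      using AE_circle_norm by eventually_elim (use p(2) in \<open>force simp del: of_real_diff\<close>)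
    have id: "integrable circle_m (\<lambda>\<zeta>. of_real (g \<zeta> - p \<zeta>) * f \<zeta>)"
      by (rule integrable_bounded_mult[OF f _ bd]) measurable
    have "(\<integral>\<zeta>. of_real (g \<zeta>) * f \<zeta> \<partial>circle_m) = (\<integral>\<zeta>. of_real (g \<zeta> - p \<zeta>) * f \<zeta> + of_real (p \<zeta>) * f \<zeta> \<partial>circle_m)"
      by (simp add: algebra_simps)
    also have "\<dots> = (\<integral>\<zeta>. of_real (g \<zeta> - p \<zeta>) * f \<zeta> \<partial>circle_m)"
      using id ip p0 by simp
    also have "norm \<dots> \<le> (\<integral>\<zeta>. norm (of_real (g \<zeta> - p \<zeta>) * f \<zeta>) \<partial>circle_m)"
      by (rule integral_norm_bound)
    also have "\<dots> \<le> (\<integral>\<zeta>. e * norm (f \<zeta>) \<partial>circle_m)"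
    proof (rule integral_mono_AE)
      show "AE \<zeta> in circle_m. norm (of_real (g \<zeta> - p \<zeta>) * f \<zeta>) \<le> e * norm (f \<zeta>)"
        using bd by eventually_elim (simp only: norm_mult mult_right_mono norm_ge_zero)
    qed (use f id in \<open>auto simp del: of_real_diff\<close>)
    also have "\<dots> = e * norm1 f" by (simp add: norm1_def)
    finally show ?thesis .
  qed
  note b = this
  have "norm1 f \<ge> 0" by (simp add: norm1_def)
  have "norm (\<integral>\<zeta>. of_real (g \<zeta>) * f \<zeta> \<partial>circle_m) \<le> 0 + d" if "d > 0" for d
  proof -
    have "norm (\<integral>\<zeta>. of_real (g \<zeta>) * f \<zeta> \<partial>circle_m) \<le> d / (norm1 f + 1) * norm1 f"
      using that \<open>norm1 f \<ge> 0\<close> by (intro b) auto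
    also have "\<dots> \<le> d" using that \<open>norm1 f \<ge> 0\<close> by (simp add: field_simps)
    finally show ?thesis by simp
  qed
  then have "norm (\<integral>\<zeta>. of_real (g \<zeta>) * f \<zeta> \<partial>circle_m) \<le> 0" using field_le_epsilon by blast
  then show ?thesis by simp
qed

text \<open>Cutting off a multiple of the distance gives continuous functions decreasing to the
  indicator; this is the passage from continuous functions to closed sets. The empty set is excluded
  because \<open>infdist\<close> to it is 0 by convention, which would produce the constant
  1.\<close>

lemma tendsto_closed_indicator:
  fixes C :: "'a::metric_space set"
  assumes "closed C" "C \<noteq> {}"
  shows "(\<lambda>n. max 0 (1 - real n * infdist x C)) \<longlonglongrightarrow> indicator C x"
proof (cases "x \<in> C")
  case True
  then show ?thesis by simp
next
  case False
  then have pos: "infdist x C > 0"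
    using assms by (metis in_closed_iff_infdist_zero infdist_nonneg less_eq_real_def)
  have "\<forall>\<^sub>F n in sequentially. max 0 (1 - real n * infdist x C) = 0"
  proof -
    obtain N where N: "1 < real N * infdist x C" using pos ex_less_of_nat_mult by blast
    have "1 \<le> real n * infdist x C" if "n \<ge> N" for n
    proof -
      have "real N * infdist x C \<le> real n * infdist x C"
        using that pos by (intro mult_right_mono) auto
      then show ?thesis using N by linarith
    qed
    then show ?thesis unfolding eventually_sequentially by (intro exI[of _ N]) auto
  qed
  then show ?thesis using False by (simp add: tendsto_eventually)
qed

text \<open>Dynkin's theorem: the closed sets generate the Borel sets and are stable under
  intersection, and the sets over which \<open>f\<close> integrates to 0 form a Dynkin system. For a
  closed set the integral is a dominated limit of integrals against continuous functions.\<close>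

lemma fourier_null_set_integral:
  assumes "fourier_null f" "A \<in> sets borel"
  shows "(\<integral>\<zeta>. indicator A \<zeta> *\<^sub>R f \<zeta> \<partial>circle_m) = 0"
proof -
  have f: "integrable circle_m f" using assms by (simp add: fourier_null_def)
  then have [measurable]: "f \<in> borel_measurable circle_m" by simp
  have f0: "integral\<^sup>L circle_m f = 0"
    using assms(1) by (rule fourier_null_integral)
  have intg: "integrable circle_m (\<lambda>\<zeta>. indicator A \<zeta> *\<^sub>R f \<zeta>)" if "A \<in> sets borel" for A
    using integrable_mult_indicator[OF _ f, of A] that by simp
  have gen: "sets borel = sigma_sets UNIV (Collect (closed :: complex set \<Rightarrow> bool))"
    unfolding borel_eq_closed by simp
  have "Int_stable (Collect (closed :: complex set \<Rightarrow> bool))"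
    "Collect (closed :: complex set \<Rightarrow> bool) \<subseteq> Pow UNIV"
    "A \<in> sigma_sets UNIV (Collect (closed :: complex set \<Rightarrow> bool))"
    using assms(2) gen by (auto simp: Int_stable_def)
  then show ?thesis
  proof (induction rule: sigma_sets_induct_disjoint)
    case (basic C)
    show ?case
    proof (cases "C = {}")
      case False
      define g where "g n \<zeta> = max 0 (1 - real n * infdist \<zeta> C)" for n \<zeta>
      have cont: "continuous_on UNIV (g n)" for n
        unfolding g_def by (intro continuous_intros)
      then have [measurable]: "g n \<in> borel_measurable borel" for n by (rule borel_measurable_continuous_onI)
      have [measurable]: "C \<in> sets borel" using basic by auto
      have "(\<lambda>n. \<integral>\<zeta>. of_real (g n \<zeta>) * f \<zeta> \<partial>circle_m) \<longlonglongrightarrow> (\<integral>\<zeta>. indicator C \<zeta> *\<^sub>R f \<zeta> \<partial>circle_m)"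
      proof (rule integral_dominated_convergence[where w = "\<lambda>\<zeta>. norm (f \<zeta>)"])
        show "AE \<zeta> in circle_m. (\<lambda>n. of_real (g n \<zeta>) * f \<zeta>) \<longlonglongrightarrow> indicator C \<zeta> *\<^sub>R f \<zeta>"
          unfolding scaleR_conv_of_real g_def using basic False
          by (intro AE_I2 tendsto_intros tendsto_closed_indicator) auto
        fix n
        have "\<bar>g n \<zeta>\<bar> \<le> 1" for \<zeta> unfolding g_def by (auto simp: infdist_nonneg)
        then show "AE \<zeta> in circle_m. norm (of_real (g n \<zeta>) * f \<zeta>) \<le> norm (f \<zeta>)"
          by (intro AE_I2) (simp add: norm_mult mult_left_le_one_le)
      qed (use f in auto)
      then show ?thesis using fourier_null_continuous[OF cont assms(1)] by (simp add: LIMSEQ_const_iff)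
    qed simp
  next
    case empty
    then show ?case by simp
  next
    case (compl A)
    then have A: "A \<in> sets borel" using gen by simp
    have "(\<integral>\<zeta>. indicator (UNIV - A) \<zeta> *\<^sub>R f \<zeta> \<partial>circle_m) = (\<integral>\<zeta>. f \<zeta> - indicator A \<zeta> *\<^sub>R f \<zeta> \<partial>circle_m)"
      by (intro Bochner_Integration.integral_cong) (auto simp: indicator_def)
    also have "\<dots> = 0" using f intg[OF A] f0 compl by simp
    finally show ?case .
  next
    case (union A)
    then have A: "A i \<in> sets borel" for i using gen by auto
    have [measurable]: "A i \<in> sets borel" for i by (rule A)
    have "(\<integral>\<zeta>\<in>(\<Union>i. A i). f \<zeta> \<partial>circle_m) = (\<Sum>i. (\<integral>\<zeta>\<in>A i. f \<zeta> \<partial>circle_m))"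
    proof (rule lebesgue_integral_countable_add)
      show "set_integrable circle_m (\<Union>i. A i) f"
        unfolding set_integrable_def by (rule intg) measurable
      show "\<And>i j. i \<noteq> j \<Longrightarrow> A i \<inter> A j = {}" using union by (simp add: disjoint_family_on_def)
    qed simp
    then show ?case using union by (simp add: set_lebesgue_integral_def)
  qed
qed

text \<open>Uniqueness theorem for Fourier coefficients: a real density with integral 0 over every
  measurable set is zero a.e., and this is applied to real and imaginary part separately.\<close>

lemma fourier_null_AE_zero:
  assumes "fourier_null f"
  shows "AE \<zeta> in circle_m. f \<zeta> = 0"
proof -
  have f: "integrable circle_m f" using assms by (simp add: fourier_null_def)
  have z: "(\<integral>\<zeta>. indicator A \<zeta> *\<^sub>R f \<zeta> \<partial>circle_m) = 0" if "A \<in> sets circle_m" for A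
    using fourier_null_set_integral[OF assms] that by simp
  have i: "integrable circle_m (\<lambda>\<zeta>. indicator A \<zeta> *\<^sub>R f \<zeta>)" if "A \<in> sets circle_m" for A
    using integrable_mult_indicator[OF _ f, of A] that by simp
  have "(\<integral>\<zeta>\<in>A. Re (f \<zeta>) \<partial>circle_m) = (\<integral>\<zeta>\<in>A. 0 \<partial>circle_m)"
       "(\<integral>\<zeta>\<in>A. Im (f \<zeta>) \<partial>circle_m) = (\<integral>\<zeta>\<in>A. 0 \<partial>circle_m)" if "A \<in> sets circle_m" for A
    using integral_Re[OF i[OF that]] integral_Im[OF i[OF that]] z[OF that]
    by (simp_all add: set_lebesgue_integral_def)
  then have "AE \<zeta> in circle_m. Re (f \<zeta>) = 0" "AE \<zeta> in circle_m. Im (f \<zeta>) = 0"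
    using f by (auto intro!: density_unique_real)
  then show ?thesis by eventually_elim (simp add: complex_eq_iff)
qed

section \<open>Square-integrable functions\<close>

definition sq_integrable :: "'a measure \<Rightarrow> ('a \<Rightarrow> complex) \<Rightarrow> bool" where
  "sq_integrable M f \<longleftrightarrow> f \<in> borel_measurable M \<and> integrable M (\<lambda>x. (norm (f x))\<^sup>2)"

text \<open>Convergence is stated for representatives. Square integrability of all terms and of the
  limit belongs to the notion, so a limit obtained later brings its integrability with it.\<close>

definition L2_tendsto :: "'a measure \<Rightarrow> (nat \<Rightarrow> 'a \<Rightarrow> complex) \<Rightarrow> ('a \<Rightarrow> complex) \<Rightarrow> bool" where
  "L2_tendsto M P G \<longleftrightarrow> (\<forall>n. sq_integrable M (P n)) \<and> sq_integrable M G \<and>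
     (\<lambda>n. \<integral>x. (norm (P n x - G x))\<^sup>2 \<partial>M) \<longlonglongrightarrow> 0"

lemma sq_integrable_measurable [measurable_dest]: "sq_integrable M f \<Longrightarrow> f \<in> borel_measurable M"
  by (simp add: sq_integrable_def)

lemma sq_integrableD: "sq_integrable M f \<Longrightarrow> integrable M (\<lambda>x. (norm (f x))\<^sup>2)"
  by (simp add: sq_integrable_def)

lemma sq_integrable_mult_bounded:
  assumes f: "sq_integrable M f" and [measurable]: "g \<in> borel_measurable M"
    and bd: "AE x in M. norm (g x) \<le> B"
  shows "sq_integrable M (\<lambda>x. g x * f x)"
proof -
  have [measurable]: "f \<in> borel_measurable M" using f by (rule sq_integrable_measurable)
  have "integrable M (\<lambda>x. (norm (g x * f x))\<^sup>2)"
  proof (rule Bochner_Integration.integrable_bound)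
    show "integrable M (\<lambda>x. B\<^sup>2 * (norm (f x))\<^sup>2)" using sq_integrableD[OF f] by simp
    show "AE x in M. norm ((norm (g x * f x))\<^sup>2) \<le> norm (B\<^sup>2 * (norm (f x))\<^sup>2)"
      using bd
    proof eventually_elim
      case (elim x)
      have "(norm (g x))\<^sup>2 \<le> B\<^sup>2" using elim by (intro power_mono) auto
      then show ?case by (simp add: norm_mult power_mult_distrib mult_right_mono)
    qed
  qed simp
  then show ?thesis by (simp add: sq_integrable_def)
qed

lemma sq_integrable_cmult: "sq_integrable M f \<Longrightarrow> sq_integrable M (\<lambda>x. c * f x)"
  by (rule sq_integrable_mult_bounded[where B = "norm c"]) auto

lemma norm_add_sq_le: "(norm (a + b :: 'a::real_normed_vector))\<^sup>2 \<le> 2 * (norm a)\<^sup>2 + 2 * (norm b)\<^sup>2"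
proof -
  have "(norm (a + b))\<^sup>2 \<le> (norm a + norm b)\<^sup>2" by (intro power_mono norm_triangle_ineq) auto
  also have "\<dots> \<le> 2 * (norm a)\<^sup>2 + 2 * (norm b)\<^sup>2"
    using sum_squares_bound[of "norm a" "norm b"] by (simp add: power2_sum)
  finally show ?thesis .
qed

lemma sq_integrable_add:
  assumes "sq_integrable M f" "sq_integrable M g"
  shows "sq_integrable M (\<lambda>x. f x + g x)"
proof -
  have [measurable]: "f \<in> borel_measurable M" "g \<in> borel_measurable M"
    using assms by (auto intro: sq_integrable_measurable)
  have "integrable M (\<lambda>x. (norm (f x + g x))\<^sup>2)"
    by (rule Bochner_Integration.integrable_bound[where f = "\<lambda>x. 2 * (norm (f x))\<^sup>2 + 2 * (norm (g x))\<^sup>2"])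
       (use assms norm_add_sq_le in \<open>auto intro!: sq_integrableD\<close>)
  then show ?thesis by (simp add: sq_integrable_def)
qed

lemma sq_integrable_diff:
  assumes "sq_integrable M f" "sq_integrable M g"
  shows "sq_integrable M (\<lambda>x. f x - g x)"
  using sq_integrable_add[OF assms(1) sq_integrable_cmult[OF assms(2), of "-1"]] by simp

lemma sq_integrable_cnj: "sq_integrable M f \<Longrightarrow> sq_integrable M (\<lambda>x. cnj (f x))"
  unfolding sq_integrable_def by (auto intro!: measurable_compose[OF _ measurable_cnj])

lemma sq_integrable_mult:
  assumes "sq_integrable M f" "sq_integrable M g"
  shows "integrable M (\<lambda>x. f x * g x)"
proof -
  have [measurable]: "f \<in> borel_measurable M" "g \<in> borel_measurable M"
    using assms by (auto intro: sq_integrable_measurable)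
  show ?thesis
  proof (rule Bochner_Integration.integrable_bound[where f = "\<lambda>x. (norm (f x))\<^sup>2 + (norm (g x))\<^sup>2"])
    show "AE x in M. norm (f x * g x) \<le> norm ((norm (f x))\<^sup>2 + (norm (g x))\<^sup>2)"
    proof (intro AE_I2)
      fix x
      have "2 * norm (f x) * norm (g x) \<le> (norm (f x))\<^sup>2 + (norm (g x))\<^sup>2" by (rule sum_squares_bound)
      moreover have "0 \<le> norm (f x) * norm (g x)" by simp
      ultimately have "norm (f x) * norm (g x) \<le> (norm (f x))\<^sup>2 + (norm (g x))\<^sup>2" by linarith
      then show "norm (f x * g x) \<le> norm ((norm (f x))\<^sup>2 + (norm (g x))\<^sup>2)" by (simp add: norm_mult)
    qed
  qed (use assms in \<open>auto intro!: sq_integrableD\<close>)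
qed

text \<open>Integrating (s norm f - norm g)^2 gives a quadratic in s that is never negative, so its
  discriminant is not positive.\<close>

lemma Cauchy_Schwarz_integral:
  assumes "sq_integrable M f" "sq_integrable M g"
  shows "norm (\<integral>x. f x * g x \<partial>M) \<le> sqrt (\<integral>x. (norm (f x))\<^sup>2 \<partial>M) * sqrt (\<integral>x. (norm (g x))\<^sup>2 \<partial>M)"
proof -
  let ?A = "\<integral>x. (norm (f x))\<^sup>2 \<partial>M" and ?B = "\<integral>x. (norm (g x))\<^sup>2 \<partial>M"
  let ?I = "\<integral>x. norm (f x) * norm (g x) \<partial>M"
  have nn: "?A \<ge> 0" "?B \<ge> 0" "?I \<ge> 0" by simp_all
  have i: "integrable M (\<lambda>x. norm (f x) * norm (g x))"
    using integrable_norm[OF sq_integrable_mult[OF assms]] by (simp add: norm_mult)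
  note ii = sq_integrableD[OF assms(1)] sq_integrableD[OF assms(2)]
  have q: "0 \<le> s\<^sup>2 * ?A - 2 * s * ?I + ?B" for s
  proof -
    have "0 \<le> (\<integral>x. (s * norm (f x) - norm (g x))\<^sup>2 \<partial>M)" by simp
    also have "\<dots> = (\<integral>x. s\<^sup>2 * (norm (f x))\<^sup>2 - 2 * s * (norm (f x) * norm (g x)) + (norm (g x))\<^sup>2 \<partial>M)"
      by (intro Bochner_Integration.integral_cong) (auto simp: power2_diff power_mult_distrib)
    also have "\<dots> = s\<^sup>2 * ?A - 2 * s * ?I + ?B" using i ii by simp
    finally show ?thesis .
  qed
  have "?I\<^sup>2 \<le> ?A * ?B"
  proof (cases "?A = 0")
    case True
    have "?I = 0"
    proof (rule ccontr)
      assume "?I \<noteq> 0"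
      then have "?I > 0" using nn by linarith
      \<comment> \<open>With leading coefficient 0 the quadratic is affine, and at this s it equals
        -1.\<close>
      then show False using q[of "(?B + 1) / (2 * ?I)"] True by (simp add: field_simps)
    qed
    then show ?thesis using True by simp
  next
    case False
    then have "?A > 0" using nn by linarith
    \<comment> \<open>The vertex of the parabola.\<close>
    then show ?thesis using q[of "?I / ?A"] by (simp add: field_simps power2_eq_square)
  qed
  then have "?I \<le> sqrt (?A * ?B)" by (rule real_le_rsqrt)
  moreover have "norm (\<integral>x. f x * g x \<partial>M) \<le> ?I"
    using integral_norm_bound[of M "\<lambda>x. f x * g x"] by (simp add: norm_mult)
  ultimately show ?thesis by (simp add: real_sqrt_mult)
qed

lemma L2_tendsto_integral_mult:
  assumes P: "L2_tendsto M P G" and Q: "L2_tendsto M Q H"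
  shows "(\<lambda>n. \<integral>x. P n x * Q n x \<partial>M) \<longlonglongrightarrow> (\<integral>x. G x * H x \<partial>M)"
proof -
  have sP: "sq_integrable M (P n)" "sq_integrable M G" "sq_integrable M (\<lambda>x. P n x - G x)"
    and sQ: "sq_integrable M (Q n)" "sq_integrable M H" "sq_integrable M (\<lambda>x. Q n x - H x)" for n
    using assms unfolding L2_tendsto_def by (auto intro: sq_integrable_diff)
  let ?p = "\<lambda>n. sqrt (\<integral>x. (norm (P n x - G x))\<^sup>2 \<partial>M)" and ?q = "\<lambda>n. sqrt (\<integral>x. (norm (Q n x - H x))\<^sup>2 \<partial>M)"
  have p0: "?p \<longlonglongrightarrow> 0" and q0: "?q \<longlonglongrightarrow> 0"
    using assms tendsto_real_sqrt[of _ 0] unfolding L2_tendsto_def by fastforce+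
  have "norm ((\<integral>x. P n x * Q n x \<partial>M) - (\<integral>x. G x * H x \<partial>M)) \<le>
     ?p n * ?q n + sqrt (\<integral>x. (norm (G x))\<^sup>2 \<partial>M) * ?q n + ?p n * sqrt (\<integral>x. (norm (H x))\<^sup>2 \<partial>M)" for n
  proof -
    note i = sq_integrable_mult[OF sP(3) sQ(3)] sq_integrable_mult[OF sP(2) sQ(3)] sq_integrable_mult[OF sP(3) sQ(2)]
    have "(\<integral>x. P n x * Q n x \<partial>M) - (\<integral>x. G x * H x \<partial>M) = (\<integral>x. P n x * Q n x - G x * H x \<partial>M)"
      using sP sQ by (intro Bochner_Integration.integral_diff[symmetric] sq_integrable_mult) auto
    \<comment> \<open>Each of the three terms contains at least one factor that tends to 0 in
      L2.\<close>
    also have "\<dots> = (\<integral>x. ((P n x - G x) * (Q n x - H x) + G x * (Q n x - H x)) + (P n x - G x) * H x \<partial>M)"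
      by (simp add: algebra_simps)
    also have "\<dots> = (\<integral>x. (P n x - G x) * (Q n x - H x) \<partial>M) + (\<integral>x. G x * (Q n x - H x) \<partial>M) + (\<integral>x. (P n x - G x) * H x \<partial>M)"
      by (subst Bochner_Integration.integral_add; (simp add: i)?)+
    finally have eq: "(\<integral>x. P n x * Q n x \<partial>M) - (\<integral>x. G x * H x \<partial>M) = \<dots>" .
    show ?thesis unfolding eq
      by (intro norm_triangle_mono Cauchy_Schwarz_integral sP sQ)
  qed
  moreover have "(\<lambda>n. ?p n * ?q n + sqrt (\<integral>x. (norm (G x))\<^sup>2 \<partial>M) * ?q n + ?p n * sqrt (\<integral>x. (norm (H x))\<^sup>2 \<partial>M)) \<longlonglongrightarrow> 0"
    using tendsto_add[OF tendsto_add[OF tendsto_mult[OF p0 q0] tendsto_mult[OF tendsto_const q0]] tendsto_mult[OF p0 tendsto_const]]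
    by (simp only: mult_zero_left mult_zero_right add_0_left)
  ultimately have "(\<lambda>n. (\<integral>x. P n x * Q n x \<partial>M) - (\<integral>x. G x * H x \<partial>M)) \<longlonglongrightarrow> 0"
    by (rule Lim_null_comparison[OF always_eventually[OF allI]])
  then show ?thesis by (simp add: LIM_zero_iff)
qed

lemma L2_tendsto_const: "sq_integrable M f \<Longrightarrow> L2_tendsto M (\<lambda>_. f) f"
  by (simp add: L2_tendsto_def)

lemma L2_tendsto_cnj: "L2_tendsto M P G \<Longrightarrow> L2_tendsto M (\<lambda>n x. cnj (P n x)) (\<lambda>x. cnj (G x))"
  unfolding L2_tendsto_def by (auto intro: sq_integrable_cnj simp flip: complex_cnj_diff)

lemma L2_tendsto_mult_bounded:
  assumes P: "L2_tendsto M P G" and [measurable]: "g \<in> borel_measurable M"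
    and bd: "AE x in M. norm (g x) \<le> B"
  shows "L2_tendsto M (\<lambda>n x. g x * P n x) (\<lambda>x. g x * G x)"
proof -
  have s: "sq_integrable M (P n)" "sq_integrable M G" for n using P by (auto simp: L2_tendsto_def)
  have lim: "(\<lambda>n. B\<^sup>2 * (\<integral>x. (norm (P n x - G x))\<^sup>2 \<partial>M)) \<longlonglongrightarrow> 0"
    using P unfolding L2_tendsto_def by (auto intro!: tendsto_eq_intros)
  have le: "(\<integral>x. (norm (g x * P n x - g x * G x))\<^sup>2 \<partial>M) \<le> B\<^sup>2 * (\<integral>x. (norm (P n x - G x))\<^sup>2 \<partial>M)" for n
  proof -
    have "(\<integral>x. (norm (g x * (P n x - G x)))\<^sup>2 \<partial>M) \<le> (\<integral>x. B\<^sup>2 * (norm (P n x - G x))\<^sup>2 \<partial>M)"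
    proof (rule integral_mono_AE)
      show "integrable M (\<lambda>x. (norm (g x * (P n x - G x)))\<^sup>2)"
        by (intro sq_integrableD sq_integrable_mult_bounded[OF _ _ bd] sq_integrable_diff s) simp
      show "integrable M (\<lambda>x. B\<^sup>2 * (norm (P n x - G x))\<^sup>2)"
        by (intro integrable_mult_right sq_integrableD sq_integrable_diff s)
      show "AE x in M. (norm (g x * (P n x - G x)))\<^sup>2 \<le> B\<^sup>2 * (norm (P n x - G x))\<^sup>2"
        using bd by eventually_elim (simp add: norm_mult power_mult_distrib mult_right_mono power_mono)
    qed
    then show ?thesis by (simp add: right_diff_distrib)
  qed
  have "(\<lambda>n. \<integral>x. (norm (g x * P n x - g x * G x))\<^sup>2 \<partial>M) \<longlonglongrightarrow> 0"
    by (rule tendsto_sandwich[OF _ _ tendsto_const lim]) (auto intro!: always_eventually le)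
  then show ?thesis using s
    by (auto simp: L2_tendsto_def intro!: sq_integrable_mult_bounded[OF _ _ bd])
qed

text \<open>The product lemma for \<open>P\<close> and its conjugate.\<close>

lemma L2_tendsto_norm:
  assumes "L2_tendsto M P G"
  shows "(\<lambda>n. \<integral>x. (norm (P n x))\<^sup>2 \<partial>M) \<longlonglongrightarrow> (\<integral>x. (norm (G x))\<^sup>2 \<partial>M)"
proof -
  have s: "sq_integrable M (P n)" "sq_integrable M G" for n using assms by (auto simp: L2_tendsto_def)
  have e: "(\<integral>x. f x * cnj (f x) \<partial>M) = of_real (\<integral>x. (norm (f x))\<^sup>2 \<partial>M)" for f
    by (simp add: complex_norm_square[symmetric] integral_complex_of_real[symmetric] del: of_real_power integral_complex_of_real)
  show ?thesis using L2_tendsto_integral_mult[OF assms L2_tendsto_cnj[OF assms]]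
    unfolding e by (simp add: tendsto_of_real_iff)
qed

text \<open>The hypothesis fixes a geometric rate, so no subsequence has to be extracted: a.e.
  convergence comes from summing weighted squared increments, and Fatou's lemma turns it into L2
  convergence.\<close>

lemma L2_complete:
  assumes s: "\<And>n. sq_integrable M (f n)"
    and cauchy: "\<And>m n. m \<le> n \<Longrightarrow> (\<integral>x. (norm (f n x - f m x))\<^sup>2 \<partial>M) \<le> (1/8) ^ m"
  shows "\<exists>G. L2_tendsto M f G"
proof -
  have [measurable]: "f n \<in> borel_measurable M" for n using s by (rule sq_integrable_measurable)
  have sd: "integrable M (\<lambda>x. (norm (f n x - f m x))\<^sup>2)" for m n
    by (intro sq_integrableD sq_integrable_diff s)
  define d where "d n x = (norm (f (Suc n) x - f n x))\<^sup>2" for n x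
  have [measurable]: "d n \<in> borel_measurable M" for n unfolding d_def by measurable
  \<comment> \<open>The weight 2 ^ n is small against the decay rate 8 ^ n, so the weighted
    integrals still sum like (1/4) ^ n; below it pays for passing from squared increments to
    increments.\<close>
  have "(\<integral>\<^sup>+x. (\<Sum>n. ennreal (2 ^ n * d n x)) \<partial>M) = (\<Sum>n. \<integral>\<^sup>+x. ennreal (2 ^ n * d n x) \<partial>M)"
    by (rule nn_integral_suminf) measurable
  also have "\<dots> \<le> (\<Sum>n. ennreal ((1/4) ^ n))"
  proof (intro suminf_le summableI)
    fix n
    have "(\<integral>\<^sup>+x. ennreal (2 ^ n * d n x) \<partial>M) = ennreal (\<integral>x. 2 ^ n * d n x \<partial>M)"
      unfolding d_def using sd by (intro nn_integral_eq_integral integrable_mult_right) auto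
    also have "(\<integral>x. 2 ^ n * d n x \<partial>M) \<le> 2 ^ n * (1/8) ^ n"
      unfolding d_def using cauchy[of n "Suc n"] by simp
    also have "2 ^ n * (1/8) ^ n = (1/4 :: real) ^ n" by (simp flip: power_mult_distrib)
    finally show "(\<integral>\<^sup>+x. ennreal (2 ^ n * d n x) \<partial>M) \<le> ennreal ((1/4) ^ n)" by (simp add: ennreal_leI)
  qed
  also have "\<dots> = ennreal (\<Sum>n. (1/4) ^ n)" by (intro suminf_ennreal2 summable_geometric) auto
  finally have "(\<integral>\<^sup>+x. (\<Sum>n. ennreal (2 ^ n * d n x)) \<partial>M) \<noteq> \<infinity>"
    by (metis ennreal_less_top infinity_ennreal_def leD)
  then have "AE x in M. (\<Sum>n. ennreal (2 ^ n * d n x)) \<noteq> \<infinity>"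
    by (intro nn_integral_PInf_AE) auto
  then have conv: "AE x in M. (\<lambda>n. f n x) \<longlonglongrightarrow> lim (\<lambda>n. f n x)"
  proof eventually_elim
    case (elim x)
    then have "summable (\<lambda>n. 2 ^ n * d n x)"
      by (intro summable_suminf_not_top) (auto simp: d_def)
    then have "summable (\<lambda>n. (1/2) ^ n + 2 ^ n * d n x)"
      by (intro summable_add summable_geometric) auto
    moreover have "norm (f (Suc n) x - f n x) \<le> (1/2) ^ n + 2 ^ n * d n x" for n
    proof -
      define t where "t = norm (f (Suc n) x - f n x)"
      have t: "0 \<le> t" "d n x = t\<^sup>2" by (auto simp: t_def d_def)
      \<comment> \<open>The arithmetic-geometric mean inequality, divided by 2 ^ n: an increment is
        at most a term of a convergent geometric series plus its weighted square.\<close>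
      have "0 \<le> (1 - 2 ^ n * t)\<^sup>2" by simp
      then have "2 * (2 ^ n * t) \<le> 1 + (2 ^ n * t)\<^sup>2" by (simp add: power2_diff)
      moreover have "0 \<le> 2 ^ n * t" using t by simp
      ultimately have "2 ^ n * t \<le> 1 + (2 ^ n * t)\<^sup>2" by linarith
      then have "t \<le> (1/2) ^ n + 2 ^ n * t\<^sup>2"
        by (simp add: field_simps power2_eq_square)
      then show ?thesis by (simp add: t t_def)
    qed
    ultimately have "summable (\<lambda>n. f (Suc n) x - f n x)"
      by (rule summable_comparison_test'[of _ 0]) 
    then have "convergent (\<lambda>n. \<Sum>k<n. f (Suc k) x - f k x)"
      by (simp add: summable_iff_convergent)
    then have "convergent (\<lambda>n. f n x - f 0 x)"
      by (simp only: sum_lessThan_telescope[of "\<lambda>k. f k x"])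
    then have "convergent (\<lambda>n. (f n x - f 0 x) + f 0 x)"
      by (intro convergent_add convergent_const)
    then show ?case by (simp add: convergent_LIMSEQ_iff)
  qed
  define G where "G x = lim (\<lambda>n. f n x)" for x
  have [measurable]: "G \<in> borel_measurable M" unfolding G_def by (rule borel_measurable_lim_metric) simp
  have nn: "(\<integral>\<^sup>+x. ennreal ((norm (f m x - G x))\<^sup>2) \<partial>M) \<le> ennreal ((1/8) ^ m)" for m
  proof -
    have "(\<integral>\<^sup>+x. ennreal ((norm (f m x - G x))\<^sup>2) \<partial>M) =
        (\<integral>\<^sup>+x. liminf (\<lambda>n. ennreal ((norm (f m x - f n x))\<^sup>2)) \<partial>M)"
    proof (rule nn_integral_cong_AE)
      show "AE x in M. ennreal ((norm (f m x - G x))\<^sup>2) = liminf (\<lambda>n. ennreal ((norm (f m x - f n x))\<^sup>2))"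
        using conv
      proof eventually_elim
        case (elim x)
        then have "(\<lambda>n. ennreal ((norm (f m x - f n x))\<^sup>2)) \<longlonglongrightarrow> ennreal ((norm (f m x - G x))\<^sup>2)"
          unfolding G_def by (intro tendsto_intros tendsto_ennrealI)
        then show ?case by (intro lim_imp_Liminf[symmetric]) auto
      qed
    qed
    also have "\<dots> \<le> liminf (\<lambda>n. \<integral>\<^sup>+x. ennreal ((norm (f m x - f n x))\<^sup>2) \<partial>M)"
      by (rule nn_integral_liminf) measurable
    also have "\<dots> \<le> limsup (\<lambda>n. \<integral>\<^sup>+x. ennreal ((norm (f m x - f n x))\<^sup>2) \<partial>M)"
      by (intro Liminf_le_Limsup) simp
    also have "\<dots> \<le> ennreal ((1/8) ^ m)"
    proof (rule Limsup_bounded, rule eventually_sequentiallyI[of m])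
      fix n assume "m \<le> n"
      have "(\<integral>\<^sup>+x. ennreal ((norm (f m x - f n x))\<^sup>2) \<partial>M) = ennreal (\<integral>x. (norm (f m x - f n x))\<^sup>2 \<partial>M)"
        using sd by (intro nn_integral_eq_integral) auto
      then show "(\<integral>\<^sup>+x. ennreal ((norm (f m x - f n x))\<^sup>2) \<partial>M) \<le> ennreal ((1/8) ^ m)"
        using cauchy[OF \<open>m \<le> n\<close>] by (simp add: norm_minus_commute ennreal_leI)
    qed
    finally show ?thesis .
  qed
  have i: "integrable M (\<lambda>x. (norm (f m x - G x))\<^sup>2)" for m
    by (intro integrableI_bounded) (use nn[of m] in \<open>auto simp: le_less_trans\<close>)
  have le: "(\<integral>x. (norm (f m x - G x))\<^sup>2 \<partial>M) \<le> (1/8) ^ m" for m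
    using nn[of m] nn_integral_eq_integral[OF i[of m]] by simp
  have lim: "(\<lambda>n. \<integral>x. (norm (f n x - G x))\<^sup>2 \<partial>M) \<longlonglongrightarrow> 0"
    by (rule tendsto_sandwich[OF _ _ tendsto_const, of _ _ _ "\<lambda>m. (1/8) ^ m"])
       (auto intro!: always_eventually le LIMSEQ_realpow_zero)
  have "sq_integrable M (\<lambda>x. f 0 x - G x)"
    using i[of 0] by (simp add: sq_integrable_def)
  from sq_integrable_diff[OF s[of 0] this] have "sq_integrable M G" by simp
  then show ?thesis using s lim by (auto simp: L2_tendsto_def)
qed

section \<open>Elements of least norm in convex sets\<close>

lemma norm_add_mult_sq: "(norm (a + c * w))\<^sup>2 = (norm a)\<^sup>2 + 2 * Re (c * (w * cnj a)) + (norm c)\<^sup>2 * (norm (w::complex))\<^sup>2"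
  unfolding cmod_power2 by (simp add: power2_eq_square algebra_simps)

lemma parallelogram_norm:
  fixes a b :: complex
  shows "(norm (a - b))\<^sup>2 = 2 * (norm a)\<^sup>2 + 2 * (norm b)\<^sup>2 - 4 * (norm ((a + b) / 2))\<^sup>2"
  unfolding cmod_power2 by (simp add: power2_eq_square algebra_simps add_divide_distrib)

text \<open>By the parallelogram law a minimizing sequence of a midpoint-convex set is Cauchy. Its
  limit \<open>G\<close> lies only in the closure of \<open>C\<close>, so the approximating sequence
  is handed over together with \<open>G\<close>. The last conclusion is the vanishing first
  variation in directions that never leave \<open>C\<close>.\<close>

lemma L2_minimizer:
  fixes M :: "'a measure" and C :: "('a \<Rightarrow> complex) set"
  assumes ne: "C \<noteq> {}" and s: "\<And>P. P \<in> C \<Longrightarrow> sq_integrable M P"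
    and conv: "\<And>P Q. P \<in> C \<Longrightarrow> Q \<in> C \<Longrightarrow> (\<lambda>x. (P x + Q x) / 2) \<in> C"
  obtains P G where "\<And>n. P n \<in> C" "L2_tendsto M P G"
    "\<And>Q. Q \<in> C \<Longrightarrow> (\<integral>x. (norm (G x))\<^sup>2 \<partial>M) \<le> (\<integral>x. (norm (Q x))\<^sup>2 \<partial>M)"
    "\<And>v. sq_integrable M v \<Longrightarrow> (\<And>Q c. Q \<in> C \<Longrightarrow> (\<lambda>x. Q x + c * v x) \<in> C) \<Longrightarrow>
       (\<integral>x. v x * cnj (G x) \<partial>M) = 0"
proof -
  define N where "N P = (\<integral>x. (norm (P x))\<^sup>2 \<partial>M)" for P :: "'a \<Rightarrow> complex"
  define d where "d = Inf (N ` C)"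
  have bdd: "bdd_below (N ` C)" by (rule bdd_belowI[of _ 0]) (auto simp: N_def)
  have d_le: "d \<le> N P" if "P \<in> C" for P unfolding d_def using bdd that by (auto intro: cInf_lower)
  \<comment> \<open>With this tolerance the parallelogram law bounds the squared distance by half of
    (1/8) ^ n plus half of (1/8) ^ m, which is at most the rate (1/8) ^ m that
    \<open>L2_complete\<close> demands.\<close>
  have "\<exists>P\<in>C. N P < d + (1/8) ^ n / 4" for n :: nat
    using cInf_lessD[of "N ` C" "d + (1/8) ^ n / 4"] ne unfolding d_def by auto
  then obtain P where P: "\<And>n. P n \<in> C" "\<And>n. N (P n) < d + (1/8) ^ n / 4" by metis
  have "(\<integral>x. (norm (P n x - P m x))\<^sup>2 \<partial>M) \<le> (1/8) ^ m" if "m \<le> n" for m n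
  proof -
    note ii = sq_integrableD[OF s[OF P(1)]] sq_integrableD[OF s[OF conv[OF P(1) P(1)]]]
    have "(\<integral>x. (norm (P n x - P m x))\<^sup>2 \<partial>M) = 2 * N (P n) + 2 * N (P m) - 4 * N (\<lambda>x. (P n x + P m x) / 2)"
      unfolding parallelogram_norm N_def using ii by simp
    moreover have "(1/8 :: real) ^ n \<le> (1/8) ^ m" using that by (intro power_decreasing) auto
    ultimately show ?thesis using P(2)[of n] P(2)[of m] d_le[OF conv[OF P(1)[of n] P(1)[of m]]] by linarith
  qed
  then obtain G where G: "L2_tendsto M P G" using L2_complete[of M P] s P(1) by blast
  have sG: "sq_integrable M G" using G by (simp add: L2_tendsto_def)
  have "(\<lambda>n. N (P n)) \<longlonglongrightarrow> d"
  proof (rule tendsto_sandwich[of "\<lambda>n. d" _ _ "\<lambda>n. d + (1/8) ^ n / 4"])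
    have "(\<lambda>n. d + (1/8) ^ n / 4) \<longlonglongrightarrow> d + 0 / 4" by (intro tendsto_intros LIMSEQ_realpow_zero) auto
    then show "(\<lambda>n. d + (1/8) ^ n / 4) \<longlonglongrightarrow> d" by simp
  qed (use P d_le in \<open>auto intro!: always_eventually less_imp_le\<close>)
  then have NG: "N G = d" using L2_tendsto_norm[OF G] LIMSEQ_unique unfolding N_def by blast
  have orth: "(\<integral>x. v x * cnj (G x) \<partial>M) = 0"
    if v: "sq_integrable M v" and dir: "\<And>Q c. Q \<in> C \<Longrightarrow> (\<lambda>x. Q x + c * v x) \<in> C" for v
  proof (rule ccontr)
    define I where "I = (\<integral>x. v x * cnj (G x) \<partial>M)"
    assume "(\<integral>x. v x * cnj (G x) \<partial>M) \<noteq> 0"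
    then have I: "(norm I)\<^sup>2 > 0" by (simp add: I_def)
    \<comment> \<open>\<open>G\<close> need not belong to \<open>C\<close>; the lower bound
      \<open>d\<close> is inherited from the approximants \<open>P n\<close> moved by the same
      multiple of \<open>v\<close>.\<close>
    have ge: "d \<le> N (\<lambda>x. G x + c * v x)" for c
    proof -
      have "L2_tendsto M (\<lambda>n x. P n x + c * v x) (\<lambda>x. G x + c * v x)"
        using G v by (auto simp: L2_tendsto_def intro!: sq_integrable_add sq_integrable_cmult)
      from L2_tendsto_norm[OF this] show ?thesis
        unfolding N_def by (rule LIMSEQ_le_const) (use d_le[OF dir[OF P(1)]] in \<open>auto simp: N_def\<close>)
    qed
    have ex: "N (\<lambda>x. G x + c * v x) = N G + 2 * Re (c * I) + (norm c)\<^sup>2 * N v" for c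
    proof -
      have i: "integrable M (\<lambda>x. c * (v x * cnj (G x)))"
        by (intro integrable_mult_right sq_integrable_mult v sq_integrable_cnj sG)
      have "N (\<lambda>x. G x + c * v x) = (\<integral>x. ((norm (G x))\<^sup>2 + 2 * Re (c * (v x * cnj (G x)))) + (norm c)\<^sup>2 * (norm (v x))\<^sup>2 \<partial>M)"
        unfolding N_def norm_add_mult_sq ..
      also have "\<dots> = N G + 2 * (\<integral>x. Re (c * (v x * cnj (G x))) \<partial>M) + (norm c)\<^sup>2 * N v"
        unfolding N_def using sq_integrableD[OF sG] sq_integrableD[OF v] integrable_Re[OF i]
        by (simp del: times_complex.sel)
      also have "(\<integral>x. Re (c * (v x * cnj (G x))) \<partial>M) = Re (c * I)"
        using integral_Re[OF i] unfolding I_def by simp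
      finally show ?thesis .
    qed
    have V: "N v \<ge> 0" by (simp add: N_def)
    \<comment> \<open>The perturbation c = - t cnj I changes the squared norm by (norm I)^2 t (t N v
      - 2). The summand 1 keeps t finite when N v = 0 and gives t N v <= 1.\<close>
    define t where "t = 1 / (N v + 1)"
    have t: "t > 0" "t * N v \<le> 1" using V by (auto simp: t_def field_simps)
    have "0 \<le> 2 * Re (- of_real t * cnj I * I) + (norm (- of_real t * cnj I))\<^sup>2 * N v"
      using ge[of "- of_real t * cnj I"] unfolding ex NG by simp
    also have "\<dots> = (norm I)\<^sup>2 * t * (t * N v - 2)"
    proof -
      have "cnj I * I = of_real ((norm I)\<^sup>2)" by (simp only: complex_norm_square mult.commute)
      then have "Re (- of_real t * cnj I * I) = - t * (norm I)\<^sup>2"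
        by (simp only: mult.assoc) (simp flip: of_real_mult of_real_minus)
      moreover have "(norm (- of_real t * cnj I))\<^sup>2 = t\<^sup>2 * (norm I)\<^sup>2"
        using t by (simp add: norm_mult power_mult_distrib)
      ultimately show ?thesis by (simp add: algebra_simps power2_eq_square)
    qed
    also have "\<dots> < 0" using t I by (intro mult_pos_neg mult_pos_pos) auto
    finally show False by simp
  qed
  show ?thesis by (rule that[OF P(1) G _ orth]) (use d_le NG in \<open>auto simp: N_def\<close>)
qed

section \<open>The Hardy space\<close>

lemma measure_circle_UNIV [simp]: "measure circle_m UNIV = 1"
  using circle.prob_space by simp

section \<open>Hardy functions through moments, closure properties\<close>

lemma fourier_coeff_minus_of_nat:
  assumes [measurable]: "f \<in> borel_measurable circle_m"
  shows "fourier_coeff f (- int n) = (\<integral>\<zeta>. \<zeta> ^ n * f \<zeta> \<partial>circle_m)"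
  unfolding fourier_coeff_def
proof (rule integral_cong_AE)
  show "AE \<zeta> in circle_m. cnj \<zeta> powi (- int n) * f \<zeta> = \<zeta> ^ n * f \<zeta>"
    using AE_circle_cnj
  proof eventually_elim
    case (elim \<zeta>)
    then have "inverse (cnj \<zeta>) = \<zeta>" by (metis inverse_unique)
    then show ?case by (simp add: power_int_minus flip: power_inverse)
  qed
qed (simp_all add: power_int_minus)

text \<open>On the circle the conjugate is the inverse, so the coefficient of index -n is the moment
  against zeta ^ n. Natural exponents are used from here on.\<close>

lemma H1_iff: "f \<in> H1 \<longleftrightarrow> integrable circle_m f \<and> (\<forall>n>0. (\<integral>\<zeta>. \<zeta> ^ n * f \<zeta> \<partial>circle_m) = 0)"
proof -
  have "(\<forall>k<0. fourier_coeff f k = 0) \<longleftrightarrow> (\<forall>n>0. (\<integral>\<zeta>. \<zeta> ^ n * f \<zeta> \<partial>circle_m) = 0)"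
    if "integrable circle_m f"
  proof -
    have e: "fourier_coeff f (- int n) = (\<integral>\<zeta>. \<zeta> ^ n * f \<zeta> \<partial>circle_m)" for n
      using that by (intro fourier_coeff_minus_of_nat) auto
    have "(\<forall>k<0. fourier_coeff f k = 0) \<longleftrightarrow> (\<forall>n>0. fourier_coeff f (- int n) = 0)"
    proof (intro iffI allI impI)
      fix k :: int assume "\<forall>n>0. fourier_coeff f (- int n) = 0" "k < 0"
      moreover have "k = - int (nat (- k))" "nat (- k) > 0" using \<open>k < 0\<close> by simp_all
      ultimately show "fourier_coeff f k = 0" by metis
    qed simp
    then show ?thesis by (simp add: e)
  qed
  then show ?thesis unfolding H1_def by blast
qed

lemma H1_integrable: "f \<in> H1 \<Longrightarrow> integrable circle_m f"
  by (simp add: H1_def)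

lemma H1_measurable [measurable_dest]: "f \<in> H1 \<Longrightarrow> f \<in> borel_measurable circle_m"
  by (intro borel_measurable_integrable H1_integrable)

text \<open>Measurability of \<open>g\<close> has to be assumed: the Borel measure is not completed,
  so a.e. equality does not transfer it.\<close>

lemma H1_cong_AE:
  assumes f: "f \<in> H1" and [measurable]: "g \<in> borel_measurable circle_m" and eq: "AE \<zeta> in circle_m. f \<zeta> = g \<zeta>"
  shows "g \<in> H1"
proof -
  have [measurable]: "f \<in> borel_measurable circle_m" using f by (rule H1_measurable)
  have "integrable circle_m g" using H1_integrable[OF f] eq by (subst integrable_cong_AE[symmetric]) auto
  moreover have "(\<integral>\<zeta>. \<zeta> ^ n * g \<zeta> \<partial>circle_m) = (\<integral>\<zeta>. \<zeta> ^ n * f \<zeta> \<partial>circle_m)" for n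
    using eq by (intro integral_cong_AE) (auto elim!: eventually_mono)
  ultimately show ?thesis using f by (simp add: H1_iff)
qed

lemma H1_add: "f \<in> H1 \<Longrightarrow> g \<in> H1 \<Longrightarrow> (\<lambda>\<zeta>. f \<zeta> + g \<zeta>) \<in> H1"
  by (simp add: H1_iff distrib_left integrable_power_mult)

lemma H1_cmult: "f \<in> H1 \<Longrightarrow> (\<lambda>\<zeta>. c * f \<zeta>) \<in> H1"
  by (simp add: H1_iff mult.left_commute[of _ c])

lemma H1_diff: "f \<in> H1 \<Longrightarrow> g \<in> H1 \<Longrightarrow> (\<lambda>\<zeta>. f \<zeta> - g \<zeta>) \<in> H1"
  using H1_add[OF _ H1_cmult[of g "-1"]] by simp

lemma H1_power_mult:
  assumes "f \<in> H1"
  shows "(\<lambda>\<zeta>. \<zeta> ^ k * f \<zeta>) \<in> H1"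
proof -
  have "\<forall>n>0. (\<integral>\<zeta>. \<zeta> ^ (n + k) * f \<zeta> \<partial>circle_m) = 0" using assms by (auto simp: H1_iff)
  then show ?thesis using assms by (simp add: H1_iff power_add mult.assoc integrable_power_mult)
qed

lemma H1_poly_mult:
  assumes "f \<in> H1"
  shows "(\<lambda>\<zeta>. poly q \<zeta> * f \<zeta>) \<in> H1"
proof (induction q)
  case 0
  then show ?case by (simp add: H1_iff)
next
  case (pCons a q)
  have "(\<lambda>\<zeta>. a * f \<zeta> + \<zeta> ^ 1 * (poly q \<zeta> * f \<zeta>)) \<in> H1"
    by (intro H1_add H1_cmult H1_power_mult assms pCons)
  then show ?case by (simp add: algebra_simps)
qed

lemma H1_const: "(\<lambda>_. c) \<in> H1"
  by (simp add: H1_iff integral_circle_power)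

lemma H1_poly: "poly q \<in> H1"
  using H1_poly_mult[OF H1_const[of 1], of q] by simp

lemma H1_integral_power: "f \<in> H1 \<Longrightarrow> n > 0 \<Longrightarrow> (\<integral>\<zeta>. \<zeta> ^ n * f \<zeta> \<partial>circle_m) = 0"
  by (simp add: H1_iff)

lemma integral_poly: "(\<integral>\<zeta>. poly q \<zeta> \<partial>circle_m) = coeff q 0"
proof (cases q)
  case (pCons a p)
  have z: "(\<integral>\<zeta>. \<zeta> ^ 1 * poly p \<zeta> \<partial>circle_m) = 0" by (rule H1_integral_power[OF H1_poly]) simp
  have i: "integrable circle_m (\<lambda>\<zeta>. \<zeta> ^ 1 * poly p \<zeta>)"
    by (intro integrable_power_mult H1_integrable H1_poly)
  have "(\<integral>\<zeta>. poly q \<zeta> \<partial>circle_m) = (\<integral>\<zeta>. a + \<zeta> ^ 1 * poly p \<zeta> \<partial>circle_m)"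
    unfolding pCons by simp
  also have "\<dots> = a" using i z by (subst Bochner_Integration.integral_add) simp_all
  finally show ?thesis by (simp add: pCons)
qed

lemma poly_bounded_circle: "\<exists>B. AE \<zeta> in circle_m. norm (poly q \<zeta>) \<le> B"
proof -
  have "compact (poly q ` sphere 0 1)" by (intro compact_continuous_image continuous_intros compact_sphere)
  then obtain B where B: "\<forall>x\<in>poly q ` sphere 0 1. norm x \<le> B"
    using compact_imp_bounded bounded_iff by metis
  have "AE \<zeta> in circle_m. norm (poly q \<zeta>) \<le> B"
    using AE_circle_norm by eventually_elim (use B in auto)
  then show ?thesis ..
qed

lemma sq_integrable_bounded:
  assumes "f \<in> borel_measurable circle_m" "AE \<zeta> in circle_m. norm (f \<zeta>) \<le> B"
  shows "sq_integrable circle_m f"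
  using sq_integrable_mult_bounded[of circle_m "\<lambda>_. 1", OF _ assms] by (simp add: sq_integrable_def)

lemma sq_integrable_integrable: "sq_integrable circle_m f \<Longrightarrow> integrable circle_m f"
  using sq_integrable_mult[of circle_m f "\<lambda>_. 1"] by (simp add: sq_integrable_def)

lemma measurable_poly [measurable]: "poly (q :: complex poly) \<in> borel_measurable borel"
  by (intro borel_measurable_continuous_onI continuous_intros)

lemma sq_integrable_poly: "sq_integrable circle_m (poly q)"
proof -
  obtain B where "AE \<zeta> in circle_m. norm (poly q \<zeta>) \<le> B" using poly_bounded_circle by blast
  then show ?thesis by (intro sq_integrable_bounded) auto
qed

lemma L2_tendsto_integral:
  assumes "L2_tendsto circle_m P G"
  shows "(\<lambda>n. \<integral>\<zeta>. P n \<zeta> \<partial>circle_m) \<longlonglongrightarrow> (\<integral>\<zeta>. G \<zeta> \<partial>circle_m)"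
  using L2_tendsto_integral_mult[OF assms L2_tendsto_const[of _ "\<lambda>_. 1"]] by (simp add: sq_integrable_def)

lemma H1_L2_closed:
  assumes P: "\<And>n. P n \<in> H1" and lim: "L2_tendsto circle_m P G"
  shows "G \<in> H1"
  unfolding H1_iff
proof (intro conjI allI impI)
  show "integrable circle_m G" using lim by (auto simp: L2_tendsto_def intro: sq_integrable_integrable)
  fix n :: nat assume "n > 0"
  have "L2_tendsto circle_m (\<lambda>m \<zeta>. \<zeta> ^ n * P m \<zeta>) (\<lambda>\<zeta>. \<zeta> ^ n * G \<zeta>)"
    by (rule L2_tendsto_mult_bounded[OF lim _ AE_norm_power_le]) simp
  from L2_tendsto_integral[OF this] show "(\<integral>\<zeta>. \<zeta> ^ n * G \<zeta> \<partial>circle_m) = 0"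
    using P \<open>n > 0\<close> by (simp add: H1_iff LIMSEQ_const_iff)
qed

text \<open>For a real function the coefficients of index n and -n are conjugate, so vanishing of
  one half of them leaves only the mean.\<close>

lemma real_H1_AE_const:
  fixes g :: "complex \<Rightarrow> real"
  assumes g: "(\<lambda>\<zeta>. of_real (g \<zeta>)) \<in> H1"
  shows "AE \<zeta> in circle_m. g \<zeta> = (\<integral>\<zeta>. g \<zeta> \<partial>circle_m)"
proof -
  let ?c = "\<integral>\<zeta>. g \<zeta> \<partial>circle_m"
  have h: "(\<lambda>\<zeta>. of_real (g \<zeta>) - of_real ?c) \<in> H1" by (intro H1_diff g H1_const)
  have h': "(\<lambda>\<zeta>. of_real (g \<zeta> - ?c)) \<in> H1" using h by simp
  have gi: "integrable circle_m g" using H1_integrable[OF g] complex_of_real_integrable_eq by blast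
  have z0: "(\<integral>\<zeta>. of_real (g \<zeta> - ?c) \<partial>circle_m) = (0::complex)"
    unfolding integral_complex_of_real using gi by simp
  have "(\<integral>\<zeta>. \<zeta> ^ n * of_real (g \<zeta> - ?c) \<partial>circle_m) = 0" for n
    using h' z0 by (cases "n = 0") (simp_all add: H1_iff)
  moreover have "(\<integral>\<zeta>. cnj \<zeta> ^ n * of_real (g \<zeta> - ?c) \<partial>circle_m) = cnj (\<integral>\<zeta>. \<zeta> ^ n * of_real (g \<zeta> - ?c) \<partial>circle_m)" for n
    unfolding Bochner_Integration.integral_cnj[symmetric] by (simp del: Bochner_Integration.integral_cnj)
  ultimately have "fourier_null (\<lambda>\<zeta>. of_real (g \<zeta> - ?c))"
    using H1_integrable[OF h'] by (simp add: fourier_null_def)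
  from fourier_null_AE_zero[OF this] show ?thesis by eventually_elim (metis of_real_eq_0_iff right_minus_eq)
qed

text \<open>The minimizer is orthogonal to its own shifts, so the nonzero Fourier coefficients of the
  square of its modulus vanish.\<close>
lemma shift_minimizer:
  assumes ne: "C \<noteq> {}" and s: "\<And>P. P \<in> C \<Longrightarrow> sq_integrable circle_m P"
    and conv: "\<And>P Q. P \<in> C \<Longrightarrow> Q \<in> C \<Longrightarrow> (\<lambda>x. (P x + Q x) / 2) \<in> C"
    and shift: "\<And>P Q n c. P \<in> C \<Longrightarrow> Q \<in> C \<Longrightarrow> n > 0 \<Longrightarrow> (\<lambda>\<zeta>. P \<zeta> + c * (\<zeta> ^ n * Q \<zeta>)) \<in> C"
  obtains P G c where "\<And>n. P n \<in> C" "L2_tendsto circle_m P G"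
    "AE \<zeta> in circle_m. (norm (G \<zeta>))\<^sup>2 = c"
    "\<And>Q. Q \<in> C \<Longrightarrow> c \<le> (\<integral>\<zeta>. (norm (Q \<zeta>))\<^sup>2 \<partial>circle_m)"
    "\<And>v. sq_integrable circle_m v \<Longrightarrow> (\<And>Q c. Q \<in> C \<Longrightarrow> (\<lambda>x. Q x + c * v x) \<in> C) \<Longrightarrow>
       (\<integral>x. v x * cnj (G x) \<partial>circle_m) = 0"
proof (rule L2_minimizer[OF ne s conv])
  fix P G assume P: "\<And>n. P n \<in> C" and lim: "L2_tendsto circle_m P G"
    and min: "\<And>Q. Q \<in> C \<Longrightarrow> (\<integral>x. (norm (G x))\<^sup>2 \<partial>circle_m) \<le> (\<integral>x. (norm (Q x))\<^sup>2 \<partial>circle_m)"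
    and orth: "\<And>v. sq_integrable circle_m v \<Longrightarrow> (\<And>Q c. Q \<in> C \<Longrightarrow> (\<lambda>x. Q x + c * v x) \<in> C) \<Longrightarrow>
       (\<integral>x. v x * cnj (G x) \<partial>circle_m) = 0"
  have sG: "sq_integrable circle_m G" using lim by (simp add: L2_tendsto_def)
  have "(\<lambda>\<zeta>. of_real ((norm (G \<zeta>))\<^sup>2)) \<in> H1"
    unfolding H1_iff
  proof (intro conjI allI impI)
    show "integrable circle_m (\<lambda>\<zeta>. complex_of_real ((norm (G \<zeta>))\<^sup>2))"
      using sq_integrableD[OF sG] by (simp only: complex_of_real_integrable_eq)
    fix n :: nat assume n: "n > 0"
    \<comment> \<open>Orthogonality is available for shifts of members of \<open>C\<close>; for the
      shift of \<open>G\<close> itself it follows by letting m tend to infinity.\<close>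
    have z: "(\<integral>\<zeta>. (\<zeta> ^ n * P m \<zeta>) * cnj (G \<zeta>) \<partial>circle_m) = 0" for m
    proof (rule orth)
      show "sq_integrable circle_m (\<lambda>\<zeta>. \<zeta> ^ n * P m \<zeta>)"
        by (rule sq_integrable_mult_bounded[OF s[OF P] _ AE_norm_power_le]) simp
    qed (rule shift[OF _ P n])
    have "L2_tendsto circle_m (\<lambda>m \<zeta>. \<zeta> ^ n * P m \<zeta>) (\<lambda>\<zeta>. \<zeta> ^ n * G \<zeta>)"
      by (rule L2_tendsto_mult_bounded[OF lim _ AE_norm_power_le]) simp
    from L2_tendsto_integral_mult[OF this L2_tendsto_const[OF sq_integrable_cnj[OF sG]]]
    have "(\<integral>\<zeta>. (\<zeta> ^ n * G \<zeta>) * cnj (G \<zeta>) \<partial>circle_m) = 0"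
      by (simp add: z LIMSEQ_const_iff)
    then show "(\<integral>\<zeta>. \<zeta> ^ n * of_real ((norm (G \<zeta>))\<^sup>2) \<partial>circle_m) = 0"
      by (simp only: complex_norm_square mult.assoc)
  qed
  from real_H1_AE_const[OF this] show thesis by (rule that[OF P lim _ min orth])
qed

text \<open>Minimizing the norm of polynomials with constant term 1 in the weighted space (Szego's
  problem) yields a multiplier that plays the role of an outer function with prescribed modulus.\<close>
lemma szego_multiplier:
  fixes \<epsilon> :: real
  assumes p: "p \<in> H1" and e: "\<epsilon> > 0"
  obtains G c where "G \<in> borel_measurable circle_m" "c \<le> 1 + \<epsilon> * norm1 p"
    "AE \<zeta> in circle_m. (norm (G \<zeta>))\<^sup>2 * (1 + \<epsilon> * norm (p \<zeta>)) = c"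
    "(\<integral>\<zeta>. (norm (G \<zeta> - 1))\<^sup>2 \<partial>circle_m) \<le> \<epsilon> * norm1 p"
    "\<And>f K. f \<in> H1 \<Longrightarrow> AE \<zeta> in circle_m. norm (f \<zeta>) \<le> K * norm (p \<zeta>) \<Longrightarrow> (\<lambda>\<zeta>. (G \<zeta>)\<^sup>2 * f \<zeta>) \<in> H1"
proof -
  note [measurable] = H1_measurable[OF p]
  have pi: "integrable circle_m (\<lambda>\<zeta>. norm (p \<zeta>))" using H1_integrable[OF p] by simp
  define W where "W \<zeta> = 1 + \<epsilon> * norm (p \<zeta>)" for \<zeta>
  have [measurable]: "W \<in> borel_measurable circle_m" unfolding W_def by measurable
  have W1: "W \<zeta> \<ge> 1" for \<zeta> using e by (simp add: W_def)
  have Wi: "integrable circle_m W" unfolding W_def using pi by simp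
  have W_int: "(\<integral>\<zeta>. W \<zeta> \<partial>circle_m) = 1 + \<epsilon> * norm1 p"
    unfolding W_def norm1_def using pi by simp
  \<comment> \<open>Multiplication by the root of the weight carries the weighted L2 space into the
    unweighted one, where the minimization applies.\<close>
  define w where "w \<zeta> = complex_of_real (sqrt (W \<zeta>))" for \<zeta>
  have [measurable]: "w \<in> borel_measurable circle_m" unfolding w_def by measurable
  have w_norm: "norm (w \<zeta>) = sqrt (W \<zeta>)" and w_norm2: "(norm (w \<zeta>))\<^sup>2 = W \<zeta>"
    and w_sq: "(w \<zeta>)\<^sup>2 = of_real (W \<zeta>)" and w_ne: "w \<zeta> \<noteq> 0" for \<zeta>
  proof -
    have nn: "0 \<le> W \<zeta>" "W \<zeta> \<noteq> 0" using W1[of \<zeta>] by linarith+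
    show "norm (w \<zeta>) = sqrt (W \<zeta>)" "(norm (w \<zeta>))\<^sup>2 = W \<zeta>" "(w \<zeta>)\<^sup>2 = of_real (W \<zeta>)" "w \<zeta> \<noteq> 0"
      using nn by (simp_all add: w_def flip: of_real_power)
  qed
  have sw: "sq_integrable circle_m w" unfolding sq_integrable_def w_norm2 using Wi by simp
  define C where "C = {P. \<exists>q. coeff q 0 = 1 \<and> P = (\<lambda>\<zeta>. poly q \<zeta> * w \<zeta>)}"
  have w_C: "w \<in> C" unfolding C_def by (auto intro!: exI[of _ 1])
  have sC: "sq_integrable circle_m P" if "P \<in> C" for P
  proof -
    obtain q where P: "P = (\<lambda>\<zeta>. poly q \<zeta> * w \<zeta>)" using \<open>P \<in> C\<close> by (auto simp: C_def)
    obtain B where "AE \<zeta> in circle_m. norm (poly q \<zeta>) \<le> B" using poly_bounded_circle by blast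
    then show ?thesis unfolding P by (rule sq_integrable_mult_bounded[OF sw, rotated]) simp
  qed
  have convC: "(\<lambda>\<zeta>. (P \<zeta> + Q \<zeta>) / 2) \<in> C" if PQ: "P \<in> C" "Q \<in> C" for P Q
  proof -
    obtain a b where "coeff a 0 = 1" "P = (\<lambda>\<zeta>. poly a \<zeta> * w \<zeta>)" "coeff b 0 = 1" "Q = (\<lambda>\<zeta>. poly b \<zeta> * w \<zeta>)"
      using PQ by (auto simp: C_def)
    then show ?thesis unfolding C_def
      by (auto intro!: exI[of _ "smult (1/2) (a + b)"] simp: algebra_simps add_divide_distrib)
  qed
  have shiftC: "(\<lambda>\<zeta>. P \<zeta> + c * (\<zeta> ^ n * Q \<zeta>)) \<in> C" if PQ: "P \<in> C" "Q \<in> C" "n > 0" for P Q n c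
  proof -
    obtain a b where "coeff a 0 = 1" "P = (\<lambda>\<zeta>. poly a \<zeta> * w \<zeta>)" "Q = (\<lambda>\<zeta>. poly b \<zeta> * w \<zeta>)"
      using PQ by (auto simp: C_def)
    \<comment> \<open>As n is positive, the added multiple of the monomial leaves the constant term
      at 1.\<close>
    then show ?thesis using \<open>n > 0\<close> unfolding C_def
      by (auto intro!: exI[of _ "a + monom c n * b"] simp: algebra_simps poly_monom coeff_mult)
  qed
  have "C \<noteq> {}" using w_C by blast
  then show thesis
  proof (rule shift_minimizer[OF _ sC convC shiftC])
    fix P G' c
    assume P: "\<And>n. P n \<in> C" and lim: "L2_tendsto circle_m P G'"
      and G'c: "AE \<zeta> in circle_m. (norm (G' \<zeta>))\<^sup>2 = c"
      and min: "\<And>Q. Q \<in> C \<Longrightarrow> c \<le> (\<integral>\<zeta>. (norm (Q \<zeta>))\<^sup>2 \<partial>circle_m)"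
    have c_le: "c \<le> 1 + \<epsilon> * norm1 p" using min[OF w_C] W_int by (simp add: w_norm2)
    have sG': "sq_integrable circle_m G'" using lim by (simp add: L2_tendsto_def)
    note [measurable] = sq_integrable_measurable[OF sG']
    have "\<forall>n. \<exists>q. coeff q 0 = 1 \<and> P n = (\<lambda>\<zeta>. poly q \<zeta> * w \<zeta>)" using P by (simp add: C_def)
    then obtain q where q: "\<And>n. coeff (q n) 0 = 1" "\<And>n. P n = (\<lambda>\<zeta>. poly (q n) \<zeta> * w \<zeta>)" by metis
    \<comment> \<open>\<open>G'\<close> has constant modulus; removing the factor \<open>w\<close>
      gives the prescribed modulus (norm G)^2 = c / W.\<close>
    define G where "G \<zeta> = G' \<zeta> / w \<zeta>" for \<zeta>
    have [measurable]: "G \<in> borel_measurable circle_m" unfolding G_def by measurable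
    have G_sq: "(G \<zeta>)\<^sup>2 = (G' \<zeta>)\<^sup>2 / of_real (W \<zeta>)" for \<zeta> by (simp add: G_def power_divide w_sq)
    have Gc: "AE \<zeta> in circle_m. (norm (G \<zeta>))\<^sup>2 * W \<zeta> = c"
      using G'c
    proof eventually_elim
      case (elim \<zeta>)
      have "(norm (G \<zeta>))\<^sup>2 * W \<zeta> = (norm (G \<zeta> * w \<zeta>))\<^sup>2" by (simp add: norm_mult power_mult_distrib w_norm2)
      then show ?case using elim w_ne[of \<zeta>] by (simp add: G_def)
    qed
    have G_le: "AE \<zeta> in circle_m. (norm (G \<zeta>))\<^sup>2 \<le> c"
      using Gc
    proof eventually_elim
      case (elim \<zeta>)
      have "(norm (G \<zeta>))\<^sup>2 * 1 \<le> (norm (G \<zeta>))\<^sup>2 * W \<zeta>" by (intro mult_left_mono W1) simp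
      then show ?case using elim by simp
    qed
    \<comment> \<open>As the weight is at least 1, division by \<open>w\<close> is bounded, and the
      polynomials themselves converge in L2.\<close>
    have "L2_tendsto circle_m (\<lambda>n \<zeta>. (1 / w \<zeta>) * P n \<zeta>) (\<lambda>\<zeta>. (1 / w \<zeta>) * G' \<zeta>)"
    proof (rule L2_tendsto_mult_bounded[OF lim])
      show "AE \<zeta> in circle_m. norm (1 / w \<zeta>) \<le> 1"
      proof (rule AE_I2)
        fix \<zeta>
        have "1 \<le> sqrt (W \<zeta>)" using W1[of \<zeta>] by simp
        then show "norm (1 / w \<zeta>) \<le> 1" by (simp add: norm_divide w_norm)
      qed
    qed simp
    then have limG: "L2_tendsto circle_m (\<lambda>n. poly (q n)) G"
      using w_ne by (simp add: q(2) G_def[abs_def])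
    \<comment> \<open>The constant term 1 survives in the limit. Hence the squared L2 distance of
      \<open>G\<close> from 1 is the squared norm of \<open>G\<close> minus 1, thus at most c - 1:
      an extremal value close to 1 forces \<open>G\<close> to be close to 1.\<close>
    have G_int: "(\<integral>\<zeta>. G \<zeta> \<partial>circle_m) = 1"
      using L2_tendsto_integral[OF limG] by (simp add: integral_poly q(1) LIMSEQ_const_iff)
    have sG: "sq_integrable circle_m G" using limG by (simp add: L2_tendsto_def)
    have iG: "integrable circle_m G" using sG by (rule sq_integrable_integrable)
    have "(\<integral>\<zeta>. (norm (G \<zeta> - 1))\<^sup>2 \<partial>circle_m) = (\<integral>\<zeta>. (norm (G \<zeta>))\<^sup>2 - 2 * Re (G \<zeta>) + 1 \<partial>circle_m)"
      unfolding cmod_power2 by (intro Bochner_Integration.integral_cong) (auto simp: power2_diff)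
    also have "\<dots> = (\<integral>\<zeta>. (norm (G \<zeta>))\<^sup>2 \<partial>circle_m) - 2 * Re (\<integral>\<zeta>. G \<zeta> \<partial>circle_m) + 1"
      using sq_integrableD[OF sG] iG by simp
    also have "\<dots> = (\<integral>\<zeta>. (norm (G \<zeta>))\<^sup>2 \<partial>circle_m) - 1" by (simp add: G_int)
    also have "(\<integral>\<zeta>. (norm (G \<zeta>))\<^sup>2 \<partial>circle_m) \<le> (\<integral>\<zeta>. c \<partial>circle_m)"
      using G_le sq_integrableD[OF sG] by (intro integral_mono_AE) auto
    finally have G_near: "(\<integral>\<zeta>. (norm (G \<zeta> - 1))\<^sup>2 \<partial>circle_m) \<le> \<epsilon> * norm1 p" using c_le by simp
    have G_mult: "(\<lambda>\<zeta>. (G \<zeta>)\<^sup>2 * f \<zeta>) \<in> H1"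
      if f: "f \<in> H1" and fK: "AE \<zeta> in circle_m. norm (f \<zeta>) \<le> K * norm (p \<zeta>)" for f K
      unfolding H1_iff
    proof (intro conjI allI impI)
      note [measurable] = H1_measurable[OF f]
      show "integrable circle_m (\<lambda>\<zeta>. (G \<zeta>)\<^sup>2 * f \<zeta>)"
        by (rule integrable_bounded_mult[OF H1_integrable[OF f], where B = c])
           (use G_le in \<open>auto simp: norm_power\<close>)
      fix n :: nat assume n: "n > 0"
      \<comment> \<open>The polynomials converge only in L2 and \<open>f\<close> is only integrable.
        Dividing \<open>f\<close> by the weight makes it bounded, since norm f is dominated by norm
        p, and the two factors \<open>w\<close> contained in the square of \<open>P m\<close>
        restore the weight.\<close>
      define g where "g \<zeta> = \<zeta> ^ n * (f \<zeta> / of_real (W \<zeta>))" for \<zeta>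
      have [measurable]: "g \<in> borel_measurable circle_m" unfolding g_def by measurable
      have bd: "AE \<zeta> in circle_m. norm (g \<zeta>) \<le> \<bar>K\<bar> / \<epsilon>"
        using fK AE_circle_norm
      proof eventually_elim
        case (elim \<zeta>)
        have W0: "W \<zeta> > 0" using W1[of \<zeta>] by linarith
        have "\<epsilon> * norm (f \<zeta>) \<le> \<epsilon> * (\<bar>K\<bar> * norm (p \<zeta>))"
          using elim e by (intro mult_left_mono order_trans[OF elim(1)] mult_right_mono) auto
        also have "\<dots> = \<bar>K\<bar> * (\<epsilon> * norm (p \<zeta>))" by simp
        also have "\<dots> \<le> \<bar>K\<bar> * W \<zeta>" by (intro mult_left_mono) (auto simp: W_def)
        finally have "norm (f \<zeta>) / W \<zeta> \<le> \<bar>K\<bar> / \<epsilon>" using e W0 by (simp add: field_simps)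
        then show ?case using elim W0 by (simp add: g_def norm_mult norm_divide norm_power)
      qed
      have "(\<integral>\<zeta>. (g \<zeta> * P m \<zeta>) * P m \<zeta> \<partial>circle_m) = 0" for m
      proof -
        have "(g \<zeta> * P m \<zeta>) * P m \<zeta> = \<zeta> ^ n * (poly (q m) \<zeta> * (poly (q m) \<zeta> * f \<zeta>))" for \<zeta>
        proof -
          have "(g \<zeta> * P m \<zeta>) * P m \<zeta> = \<zeta> ^ n * (poly (q m) \<zeta> * (poly (q m) \<zeta> * f \<zeta>)) * ((w \<zeta>)\<^sup>2 / of_real (W \<zeta>))"
            by (simp add: g_def q(2) power2_eq_square)
          also have "(w \<zeta>)\<^sup>2 / of_real (W \<zeta>) = 1" using w_ne[of \<zeta>] by (simp flip: w_sq)
          finally show ?thesis by simp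
        qed
        then show ?thesis using H1_integral_power[OF H1_poly_mult[OF H1_poly_mult[OF f]] n] by simp
      qed
      moreover have "(\<lambda>m. \<integral>\<zeta>. (g \<zeta> * P m \<zeta>) * P m \<zeta> \<partial>circle_m) \<longlonglongrightarrow> (\<integral>\<zeta>. (g \<zeta> * G' \<zeta>) * G' \<zeta> \<partial>circle_m)"
        by (rule L2_tendsto_integral_mult[OF L2_tendsto_mult_bounded[OF lim _ bd] lim]) simp
      ultimately have "(\<integral>\<zeta>. (g \<zeta> * G' \<zeta>) * G' \<zeta> \<partial>circle_m) = 0" by (simp add: LIMSEQ_const_iff)
      moreover have "(g \<zeta> * G' \<zeta>) * G' \<zeta> = \<zeta> ^ n * ((G \<zeta>)\<^sup>2 * f \<zeta>)" for \<zeta>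
        unfolding g_def G_sq by (simp add: power2_eq_square)
      ultimately show "(\<integral>\<zeta>. \<zeta> ^ n * ((G \<zeta>)\<^sup>2 * f \<zeta>) \<partial>circle_m) = 0" by simp
    qed
    show thesis
      by (rule that[OF _ c_le _ G_near G_mult]) (use Gc in \<open>simp_all add: W_def\<close>)
  qed
qed

text \<open>The extremal multipliers for eps = 1 / (j + 1) act as division by an outer function
  would: \<open>p\<close> becomes bounded and stays analytic. The last clause is for a second
  function dominated by \<open>p\<close>, later the product of \<open>p\<close> with a bounded real
  function, which must remain analytic under the same multiplier.\<close>

lemma H1_smoothing:
  assumes p: "p \<in> H1"
  obtains G C where "\<And>j. G j \<in> borel_measurable circle_m"
    "\<And>j. AE \<zeta> in circle_m. (norm (G j \<zeta>))\<^sup>2 \<le> C"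
    "\<And>j. \<exists>B. AE \<zeta> in circle_m. norm ((G j \<zeta>)\<^sup>2 * p \<zeta>) \<le> B"
    "AE \<zeta> in circle_m. (\<lambda>j. G j \<zeta>) \<longlonglongrightarrow> 1"
    "\<And>j f K. f \<in> H1 \<Longrightarrow> AE \<zeta> in circle_m. norm (f \<zeta>) \<le> K * norm (p \<zeta>) \<Longrightarrow> (\<lambda>\<zeta>. (G j \<zeta>)\<^sup>2 * f \<zeta>) \<in> H1"
proof -
  have np: "norm1 p \<ge> 0" by (simp add: norm1_def)
  define e where "e j = 1 / real (Suc j)" for j
  have e: "e j > 0" "e j \<le> 1" for j by (auto simp: e_def)
  have "\<forall>j. \<exists>G c. G \<in> borel_measurable circle_m \<and> c \<le> 1 + e j * norm1 p \<and>
    (AE \<zeta> in circle_m. (norm (G \<zeta>))\<^sup>2 * (1 + e j * norm (p \<zeta>)) = c) \<and>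
    (\<integral>\<zeta>. (norm (G \<zeta> - 1))\<^sup>2 \<partial>circle_m) \<le> e j * norm1 p \<and>
    (\<forall>f K. f \<in> H1 \<longrightarrow> (AE \<zeta> in circle_m. norm (f \<zeta>) \<le> K * norm (p \<zeta>)) \<longrightarrow> (\<lambda>\<zeta>. (G \<zeta>)\<^sup>2 * f \<zeta>) \<in> H1)"
  proof
    fix j
    show "\<exists>G c. G \<in> borel_measurable circle_m \<and> c \<le> 1 + e j * norm1 p \<and>
      (AE \<zeta> in circle_m. (norm (G \<zeta>))\<^sup>2 * (1 + e j * norm (p \<zeta>)) = c) \<and>
      (\<integral>\<zeta>. (norm (G \<zeta> - 1))\<^sup>2 \<partial>circle_m) \<le> e j * norm1 p \<and>
      (\<forall>f K. f \<in> H1 \<longrightarrow> (AE \<zeta> in circle_m. norm (f \<zeta>) \<le> K * norm (p \<zeta>)) \<longrightarrow> (\<lambda>\<zeta>. (G \<zeta>)\<^sup>2 * f \<zeta>) \<in> H1)"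
      by (rule szego_multiplier[OF p e(1)[of j]]) (intro exI conjI allI impI; assumption?; blast)
  qed
  then obtain G c where G [measurable]: "\<And>j. G j \<in> borel_measurable circle_m"
    and c: "\<And>j. c j \<le> 1 + e j * norm1 p"
    and Gc: "\<And>j. AE \<zeta> in circle_m. (norm (G j \<zeta>))\<^sup>2 * (1 + e j * norm (p \<zeta>)) = c j"
    and near: "\<And>j. (\<integral>\<zeta>. (norm (G j \<zeta> - 1))\<^sup>2 \<partial>circle_m) \<le> e j * norm1 p"
    and mult: "\<And>j f K. f \<in> H1 \<Longrightarrow> AE \<zeta> in circle_m. norm (f \<zeta>) \<le> K * norm (p \<zeta>) \<Longrightarrow> (\<lambda>\<zeta>. (G j \<zeta>)\<^sup>2 * f \<zeta>) \<in> H1"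
    unfolding choice_iff by blast
  \<comment> \<open>As eps is at most 1, the bound on \<open>G j\<close> is uniform in j, as
    dominated convergence will require.\<close>
  have cC: "c j \<le> 1 + norm1 p" for j
    using c[of j] mult_right_mono[OF e(2)[of j] np] by simp
  have bd: "AE \<zeta> in circle_m. (norm (G j \<zeta>))\<^sup>2 \<le> 1 + norm1 p" for j
    using Gc[of j]
  proof eventually_elim
    case (elim \<zeta>)
    have "(norm (G j \<zeta>))\<^sup>2 * 1 \<le> (norm (G j \<zeta>))\<^sup>2 * (1 + e j * norm (p \<zeta>))"
      using e(1)[of j] by (intro mult_left_mono) auto
    then show ?case using elim cC[of j] by simp
  qed
  have bd2: "\<exists>B. AE \<zeta> in circle_m. norm ((G j \<zeta>)\<^sup>2 * p \<zeta>) \<le> B" for j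
  proof
    show "AE \<zeta> in circle_m. norm ((G j \<zeta>)\<^sup>2 * p \<zeta>) \<le> c j / e j"
      using Gc[of j]
    proof eventually_elim
      case (elim \<zeta>)
      have "(norm (G j \<zeta>))\<^sup>2 * (e j * norm (p \<zeta>)) \<le> (norm (G j \<zeta>))\<^sup>2 * (1 + e j * norm (p \<zeta>))"
        by (intro mult_left_mono) auto
      then have "(norm (G j \<zeta>))\<^sup>2 * (e j * norm (p \<zeta>)) \<le> c j" using elim by simp
      then show ?case using e(1)[of j] by (simp add: norm_mult norm_power field_simps)
    qed
  qed
  have sG: "sq_integrable circle_m (\<lambda>\<zeta>. G j \<zeta> - 1)" for j
  proof (intro sq_integrable_diff)
    show "sq_integrable circle_m (G j)"
    proof (rule sq_integrable_bounded)
      show "AE \<zeta> in circle_m. norm (G j \<zeta>) \<le> sqrt (1 + norm1 p)"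
        using bd by eventually_elim (rule real_le_rsqrt)
    qed simp
    show "sq_integrable circle_m (\<lambda>_. 1)" by (simp add: sq_integrable_def)
  qed
  have "(\<lambda>j. \<integral>\<zeta>. norm ((norm (G j \<zeta> - 1))\<^sup>2) \<partial>circle_m) \<longlonglongrightarrow> 0"
  proof (rule tendsto_sandwich[of "\<lambda>_. 0" _ _ "\<lambda>j. e j * norm1 p"])
    have "e \<longlonglongrightarrow> 0" unfolding e_def by (rule lim_inverse_n'[THEN LIMSEQ_Suc])
    from tendsto_mult[OF this tendsto_const] show "(\<lambda>j. e j * norm1 p) \<longlonglongrightarrow> 0" by simp
  qed (use near in auto)
  \<comment> \<open>Convergence in L2 gives a.e. convergence only along a subsequence.\<close>
  from tendsto_L1_AE_subseq[OF sq_integrableD[OF sG] this]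
  obtain r where r: "AE \<zeta> in circle_m. (\<lambda>j. (norm (G (r j) \<zeta> - 1))\<^sup>2) \<longlonglongrightarrow> 0" by blast
  have lim: "AE \<zeta> in circle_m. (\<lambda>j. G (r j) \<zeta>) \<longlonglongrightarrow> 1"
    using r
  proof eventually_elim
    case (elim \<zeta>)
    from tendsto_real_sqrt[OF elim] have "(\<lambda>j. norm (G (r j) \<zeta> - 1)) \<longlonglongrightarrow> 0" by simp
    then show ?case by (rule LIM_zero_cancel[OF tendsto_norm_zero_cancel])
  qed
  show ?thesis by (rule that[of "\<lambda>j. G (r j)", OF G bd bd2 lim mult])
qed

text \<open>The residual of best approximation by polynomials is orthogonal to every zeta ^ n, n = 0
  included, and is itself a Hardy function, so all its Fourier coefficients vanish.\<close>

lemma H2_poly_dense: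
  assumes g: "g \<in> H1" and sg: "sq_integrable circle_m g"
  obtains q where "L2_tendsto circle_m (\<lambda>n. poly (q n)) g"
proof -
  define C where "C = {P. \<exists>q. P = (\<lambda>\<zeta>. g \<zeta> - poly q \<zeta>)}"
  have ne: "C \<noteq> {}" by (auto simp: C_def)
  have s: "sq_integrable circle_m P" if "P \<in> C" for P
    using that by (auto simp: C_def intro!: sq_integrable_diff sg sq_integrable_poly)
  have conv: "(\<lambda>\<zeta>. (P \<zeta> + Q \<zeta>) / 2) \<in> C" if PQ: "P \<in> C" "Q \<in> C" for P Q
  proof -
    obtain a b where "P = (\<lambda>\<zeta>. g \<zeta> - poly a \<zeta>)" "Q = (\<lambda>\<zeta>. g \<zeta> - poly b \<zeta>)"
      using PQ by (auto simp: C_def)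
    then have "(\<lambda>\<zeta>. (P \<zeta> + Q \<zeta>) / 2) = (\<lambda>\<zeta>. g \<zeta> - poly (smult (1/2) (a + b)) \<zeta>)"
      by (simp add: field_simps)
    then show ?thesis unfolding C_def by blast
  qed
  show thesis
  proof (rule L2_minimizer[OF ne s conv])
    fix P G
    assume P: "\<And>n. P n \<in> C" and lim: "L2_tendsto circle_m P G"
      and orth: "\<And>v. sq_integrable circle_m v \<Longrightarrow> (\<And>Q c. Q \<in> C \<Longrightarrow> (\<lambda>x. Q x + c * v x) \<in> C) \<Longrightarrow>
       (\<integral>x. v x * cnj (G x) \<partial>circle_m) = 0"
    have "P n \<in> H1" for n using P[of n] g H1_diff H1_poly by (auto simp: C_def)
    then have G: "G \<in> H1" using lim by (rule H1_L2_closed)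
    have o: "(\<integral>\<zeta>. \<zeta> ^ n * cnj (G \<zeta>) \<partial>circle_m) = 0" for n
    proof (rule orth)
      show "sq_integrable circle_m (\<lambda>\<zeta>. \<zeta> ^ n)"
        by (rule sq_integrable_bounded[OF _ AE_norm_power_le]) simp
      fix Q c assume "Q \<in> C"
      then obtain a where "Q = (\<lambda>\<zeta>. g \<zeta> - poly a \<zeta>)" by (auto simp: C_def)
      then have "(\<lambda>\<zeta>. Q \<zeta> + c * \<zeta> ^ n) = (\<lambda>\<zeta>. g \<zeta> - poly (a - monom c n) \<zeta>)"
        by (simp add: poly_monom algebra_simps)
      then show "(\<lambda>\<zeta>. Q \<zeta> + c * \<zeta> ^ n) \<in> C" unfolding C_def by blast
    qed
    have o': "(\<integral>\<zeta>. cnj \<zeta> ^ n * G \<zeta> \<partial>circle_m) = 0" for n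
    proof -
      have "(\<integral>\<zeta>. cnj \<zeta> ^ n * G \<zeta> \<partial>circle_m) = cnj (\<integral>\<zeta>. \<zeta> ^ n * cnj (G \<zeta>) \<partial>circle_m)"
        unfolding Bochner_Integration.integral_cnj[symmetric] by (simp del: Bochner_Integration.integral_cnj)
      then show ?thesis by (simp add: o)
    qed
    have "(\<integral>\<zeta>. \<zeta> ^ n * G \<zeta> \<partial>circle_m) = 0" for n
      using o'[of 0] H1_integral_power[OF G, of n] by (cases "n = 0") simp_all
    then have "fourier_null G" using o' H1_integrable[OF G] by (simp add: fourier_null_def)
    then have G0: "AE \<zeta> in circle_m. G \<zeta> = 0" by (rule fourier_null_AE_zero)
    have "\<forall>n. \<exists>q. P n = (\<lambda>\<zeta>. g \<zeta> - poly q \<zeta>)" using P by (simp add: C_def)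
    then obtain q where q: "\<And>n. P n = (\<lambda>\<zeta>. g \<zeta> - poly (q n) \<zeta>)" by metis
    note [measurable] = H1_measurable[OF g] H1_measurable[OF G]
    have "(\<integral>\<zeta>. (norm (poly (q n) \<zeta> - g \<zeta>))\<^sup>2 \<partial>circle_m) = (\<integral>\<zeta>. (norm (P n \<zeta> - G \<zeta>))\<^sup>2 \<partial>circle_m)" for n
      using G0 unfolding q by (intro integral_cong_AE) (auto elim!: eventually_mono simp: norm_minus_commute)
    then have "L2_tendsto circle_m (\<lambda>n. poly (q n)) g"
      using lim sg sq_integrable_poly by (simp add: L2_tendsto_def)
    then show thesis by (rule that)
  qed
qed

section \<open>Products with bounded analytic functions\<close>

lemma Hinf_iff: "g \<in> Hinf \<longleftrightarrow> g \<in> Linf \<and> g \<in> H1"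
proof -
  have "integrable circle_m g" if g: "g \<in> Linf"
  proof -
    obtain B where "AE \<zeta> in circle_m. norm (g \<zeta>) \<le> B" using g by (auto simp: Linf_def)
    then have "sq_integrable circle_m g" using g by (intro sq_integrable_bounded) (auto simp: Linf_def)
    then show ?thesis by (rule sq_integrable_integrable)
  qed
  then show ?thesis unfolding Hinf_def H1_def by blast
qed

lemma smoothing_limit:
  assumes h: "integrable circle_m h" and [measurable]: "\<And>j. G j \<in> borel_measurable circle_m"
    and bd: "\<And>j. AE \<zeta> in circle_m. (norm (G j \<zeta> :: complex))\<^sup>2 \<le> C"
    and lim: "AE \<zeta> in circle_m. (\<lambda>j. G j \<zeta>) \<longlonglongrightarrow> 1"
  shows "(\<lambda>j. \<integral>\<zeta>. (G j \<zeta>)\<^sup>2 * h \<zeta> \<partial>circle_m) \<longlonglongrightarrow> (\<integral>\<zeta>. h \<zeta> \<partial>circle_m)"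
proof (rule integral_dominated_convergence[where w = "\<lambda>\<zeta>. C * norm (h \<zeta>)"])
  note [measurable] = borel_measurable_integrable[OF h]
  show "h \<in> borel_measurable circle_m" "(\<lambda>\<zeta>. (G j \<zeta>)\<^sup>2 * h \<zeta>) \<in> borel_measurable circle_m" for j by measurable
  show "integrable circle_m (\<lambda>\<zeta>. C * norm (h \<zeta>))" using h by simp
  show "AE \<zeta> in circle_m. (\<lambda>j. (G j \<zeta>)\<^sup>2 * h \<zeta>) \<longlonglongrightarrow> h \<zeta>"
    using lim
  proof eventually_elim
    case (elim \<zeta>)
    from tendsto_mult[OF tendsto_power[OF elim, of 2] tendsto_const[of "h \<zeta>"]] show ?case by simp
  qed
  show "AE \<zeta> in circle_m. norm ((G j \<zeta>)\<^sup>2 * h \<zeta>) \<le> C * norm (h \<zeta>)" for j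
    using bd[of j] by eventually_elim (simp add: norm_mult norm_power mult_right_mono)
qed

text \<open>Polynomials approximate \<open>g\<close> only in L2, which gives no control against a
  merely integrable \<open>f\<close>. So \<open>f\<close> is first made bounded by the smoothing
  multipliers, which are then removed by dominated convergence.\<close>

lemma H1_mult_Hinf:
  assumes f: "f \<in> H1" and g: "g \<in> Hinf"
  shows "(\<lambda>\<zeta>. g \<zeta> * f \<zeta>) \<in> H1"
  unfolding H1_iff
proof (intro conjI allI impI)
  have gH: "g \<in> H1" using g by (simp add: Hinf_iff)
  note [measurable] = H1_measurable[OF gH] H1_measurable[OF f]
  obtain B where B: "AE \<zeta> in circle_m. norm (g \<zeta>) \<le> B" using g by (auto simp: Hinf_iff Linf_def)
  show i: "integrable circle_m (\<lambda>\<zeta>. g \<zeta> * f \<zeta>)"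
    by (rule integrable_bounded_mult[OF H1_integrable[OF f] _ B]) simp
  fix n :: nat assume n: "n > 0"
  have sg: "sq_integrable circle_m g" by (rule sq_integrable_bounded[OF _ B]) simp
  obtain q where q: "L2_tendsto circle_m (\<lambda>m. poly (q m)) g" by (rule H2_poly_dense[OF gH sg])
  show "(\<integral>\<zeta>. \<zeta> ^ n * (g \<zeta> * f \<zeta>) \<partial>circle_m) = 0"
  proof (rule H1_smoothing[OF f])
    fix G C
    assume G [measurable]: "\<And>j. G j \<in> borel_measurable circle_m"
      and bd: "\<And>j. AE \<zeta> in circle_m. (norm (G j \<zeta> :: complex))\<^sup>2 \<le> C"
      and bd2: "\<And>j. \<exists>B. AE \<zeta> in circle_m. norm ((G j \<zeta>)\<^sup>2 * f \<zeta>) \<le> B"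
      and lim: "AE \<zeta> in circle_m. (\<lambda>j. G j \<zeta>) \<longlonglongrightarrow> 1"
      and mult: "\<And>j h K. h \<in> H1 \<Longrightarrow> AE \<zeta> in circle_m. norm (h \<zeta>) \<le> K * norm (f \<zeta>) \<Longrightarrow> (\<lambda>\<zeta>. (G j \<zeta>)\<^sup>2 * h \<zeta>) \<in> H1"
    have z: "(\<integral>\<zeta>. (G j \<zeta>)\<^sup>2 * (\<zeta> ^ n * (g \<zeta> * f \<zeta>)) \<partial>circle_m) = 0" for j
    proof -
      have Gf: "(\<lambda>\<zeta>. (G j \<zeta>)\<^sup>2 * f \<zeta>) \<in> H1" by (rule mult[OF f, of 1]) simp
      obtain B' where "AE \<zeta> in circle_m. norm ((G j \<zeta>)\<^sup>2 * f \<zeta>) \<le> B'" using bd2 by blast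
      then have sGf: "sq_integrable circle_m (\<lambda>\<zeta>. (G j \<zeta>)\<^sup>2 * f \<zeta>)" by (intro sq_integrable_bounded) auto
      have s: "sq_integrable circle_m (\<lambda>\<zeta>. \<zeta> ^ n * ((G j \<zeta>)\<^sup>2 * f \<zeta>))"
        by (rule sq_integrable_mult_bounded[OF sGf _ AE_norm_power_le]) simp
      have "(\<integral>\<zeta>. poly (q m) \<zeta> * (\<zeta> ^ n * ((G j \<zeta>)\<^sup>2 * f \<zeta>)) \<partial>circle_m) = 0" for m
        using H1_integral_power[OF H1_poly_mult[OF Gf] n, of "q m"] by (simp add: mult.left_commute)
      moreover have "(\<lambda>m. \<integral>\<zeta>. poly (q m) \<zeta> * (\<zeta> ^ n * ((G j \<zeta>)\<^sup>2 * f \<zeta>)) \<partial>circle_m) \<longlonglongrightarrow>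
          (\<integral>\<zeta>. g \<zeta> * (\<zeta> ^ n * ((G j \<zeta>)\<^sup>2 * f \<zeta>)) \<partial>circle_m)"
        by (rule L2_tendsto_integral_mult[OF q L2_tendsto_const[OF s]])
      ultimately show ?thesis by (simp add: LIMSEQ_const_iff mult_ac)
    qed
    have "(\<lambda>j. \<integral>\<zeta>. (G j \<zeta>)\<^sup>2 * (\<zeta> ^ n * (g \<zeta> * f \<zeta>)) \<partial>circle_m) \<longlonglongrightarrow> (\<integral>\<zeta>. \<zeta> ^ n * (g \<zeta> * f \<zeta>) \<partial>circle_m)"
      by (rule smoothing_limit[OF integrable_power_mult[OF i] G bd lim])
    then show ?thesis by (simp add: z LIMSEQ_const_iff)
  qed
qed

section \<open>Order of vanishing at the origin and zero divisors\<close>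

lemma integral_cnj_power_power_mult:
  assumes [measurable]: "f \<in> borel_measurable circle_m"
  shows "(\<integral>\<zeta>. cnj \<zeta> ^ m * (\<zeta> ^ n * f \<zeta>) \<partial>circle_m) =
    (if n \<le> m then \<integral>\<zeta>. cnj \<zeta> ^ (m - n) * f \<zeta> \<partial>circle_m else \<integral>\<zeta>. \<zeta> ^ (n - m) * f \<zeta> \<partial>circle_m)"
proof (cases "n \<le> m")
  case True
  have "AE \<zeta> in circle_m. cnj \<zeta> ^ m * (\<zeta> ^ n * f \<zeta>) = cnj \<zeta> ^ (m - n) * f \<zeta>"
    using AE_circle_cnj
  proof eventually_elim
    case (elim \<zeta>)
    have "cnj \<zeta> ^ m = cnj \<zeta> ^ (m - n) * cnj \<zeta> ^ n" using True by (simp flip: power_add)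
    then have "cnj \<zeta> ^ m * (\<zeta> ^ n * f \<zeta>) = (cnj \<zeta> * \<zeta>) ^ n * (cnj \<zeta> ^ (m - n) * f \<zeta>)"
      by (simp add: power_mult_distrib mult_ac)
    then show ?case using elim by simp
  qed
  then have "(\<integral>\<zeta>. cnj \<zeta> ^ m * (\<zeta> ^ n * f \<zeta>) \<partial>circle_m) = (\<integral>\<zeta>. cnj \<zeta> ^ (m - n) * f \<zeta> \<partial>circle_m)"
    by (intro integral_cong_AE) auto
  then show ?thesis using True by simp
next
  case False
  have "AE \<zeta> in circle_m. cnj \<zeta> ^ m * (\<zeta> ^ n * f \<zeta>) = \<zeta> ^ (n - m) * f \<zeta>"
    using AE_circle_cnj
  proof eventually_elim
    case (elim \<zeta>)
    have "\<zeta> ^ n = \<zeta> ^ (n - m) * \<zeta> ^ m" using False by (simp flip: power_add)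
    then have "cnj \<zeta> ^ m * (\<zeta> ^ n * f \<zeta>) = (cnj \<zeta> * \<zeta>) ^ m * (\<zeta> ^ (n - m) * f \<zeta>)"
      by (simp add: power_mult_distrib mult_ac)
    then show ?case using elim by simp
  qed
  then have "(\<integral>\<zeta>. cnj \<zeta> ^ m * (\<zeta> ^ n * f \<zeta>) \<partial>circle_m) = (\<integral>\<zeta>. \<zeta> ^ (n - m) * f \<zeta> \<partial>circle_m)"
    by (intro integral_cong_AE) auto
  then show ?thesis using False by simp
qed

text \<open>Vanishing of the first \<open>m\<close> coefficients is a zero of order at least
  \<open>m\<close> at the origin, which may be divided out.\<close>

lemma H1_cnj_power_mult:
  assumes f: "f \<in> H1" and z: "\<And>i. i < m \<Longrightarrow> (\<integral>\<zeta>. cnj \<zeta> ^ i * f \<zeta> \<partial>circle_m) = 0"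
  shows "(\<lambda>\<zeta>. cnj \<zeta> ^ m * f \<zeta>) \<in> H1"
  unfolding H1_iff
proof (intro conjI allI impI)
  show "integrable circle_m (\<lambda>\<zeta>. cnj \<zeta> ^ m * f \<zeta>)" by (intro integrable_cnj_power_mult H1_integrable f)
  fix n :: nat assume n: "n > 0"
  have "(\<integral>\<zeta>. cnj \<zeta> ^ m * (\<zeta> ^ n * f \<zeta>) \<partial>circle_m) = 0"
    unfolding integral_cnj_power_power_mult[OF H1_measurable[OF f]]
    using n z[of "m - n"] H1_integral_power[OF f, of "n - m"] by auto
  then show "(\<integral>\<zeta>. \<zeta> ^ n * (cnj \<zeta> ^ m * f \<zeta>) \<partial>circle_m) = 0" by (simp add: mult.left_commute)
qed

text \<open>The mean is the value at the origin of the analytic extension, hence multiplicative. In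
  terms of coefficients: \<open>f\<close> minus its mean is zeta times a Hardy function, so its
  product with \<open>g\<close> has mean 0.\<close>

lemma integral_mult_Hinf:
  assumes f: "f \<in> H1" and g: "g \<in> Hinf"
  shows "(\<integral>\<zeta>. g \<zeta> * f \<zeta> \<partial>circle_m) = (\<integral>\<zeta>. g \<zeta> \<partial>circle_m) * (\<integral>\<zeta>. f \<zeta> \<partial>circle_m)"
proof -
  let ?I = "\<integral>\<zeta>. f \<zeta> \<partial>circle_m"
  have gH: "g \<in> H1" using g by (simp add: Hinf_iff)
  note [measurable] = H1_measurable[OF gH] H1_measurable[OF f]
  note i = H1_integrable[OF H1_mult_Hinf[OF f g]] H1_integrable[OF gH] H1_integrable[OF f]
  have "(\<lambda>\<zeta>. cnj \<zeta> ^ 1 * (f \<zeta> - ?I)) \<in> H1"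
    by (rule H1_cnj_power_mult) (use i in \<open>auto intro!: H1_diff f H1_const\<close>)
  from H1_integral_power[OF H1_mult_Hinf[OF this g], of 1]
  have "(\<integral>\<zeta>. \<zeta> * (g \<zeta> * (cnj \<zeta> * (f \<zeta> - ?I))) \<partial>circle_m) = 0" by simp
  also have "(\<integral>\<zeta>. \<zeta> * (g \<zeta> * (cnj \<zeta> * (f \<zeta> - ?I))) \<partial>circle_m) = (\<integral>\<zeta>. g \<zeta> * f \<zeta> - ?I * g \<zeta> \<partial>circle_m)"
  proof (rule integral_cong_AE)
    show "AE \<zeta> in circle_m. \<zeta> * (g \<zeta> * (cnj \<zeta> * (f \<zeta> - ?I))) = g \<zeta> * f \<zeta> - ?I * g \<zeta>"
      using AE_circle_cnj
    proof eventually_elim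
      case (elim \<zeta>)
      have "\<zeta> * (g \<zeta> * (cnj \<zeta> * (f \<zeta> - ?I))) = (\<zeta> * cnj \<zeta>) * (g \<zeta> * f \<zeta> - ?I * g \<zeta>)" by (simp add: algebra_simps)
      then show ?case using elim by simp
    qed
  qed measurable
  also have "\<dots> = (\<integral>\<zeta>. g \<zeta> * f \<zeta> \<partial>circle_m) - ?I * (\<integral>\<zeta>. g \<zeta> \<partial>circle_m)" using i by simp
  finally show ?thesis by (simp add: mult.commute)
qed

lemma H1_nonzero_coeff:
  assumes f: "f \<in> H1" and "\<not> (AE \<zeta> in circle_m. f \<zeta> = 0)"
  shows "\<exists>k. (\<integral>\<zeta>. cnj \<zeta> ^ k * f \<zeta> \<partial>circle_m) \<noteq> 0"
proof (rule ccontr)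
  assume "\<not> ?thesis"
  then have z: "(\<integral>\<zeta>. cnj \<zeta> ^ k * f \<zeta> \<partial>circle_m) = 0" for k by blast
  have "(\<integral>\<zeta>. \<zeta> ^ k * f \<zeta> \<partial>circle_m) = 0" for k
    using z[of 0] H1_integral_power[OF f, of k] by (cases "k = 0") simp_all
  then have "fourier_null f" using z H1_integrable[OF f] by (simp add: fourier_null_def)
  then show False using assms(2) fourier_null_AE_zero by blast
qed

text \<open>The exponent is the order of the zero at the origin, the least index with a nonzero
  coefficient.\<close>

lemma H1_leading_coeff:
  assumes f: "f \<in> H1" and "\<not> (AE \<zeta> in circle_m. f \<zeta> = 0)"
  obtains k where "(\<integral>\<zeta>. cnj \<zeta> ^ k * f \<zeta> \<partial>circle_m) \<noteq> 0" "(\<lambda>\<zeta>. cnj \<zeta> ^ k * f \<zeta>) \<in> H1"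
proof -
  define k where "k = (LEAST k. (\<integral>\<zeta>. cnj \<zeta> ^ k * f \<zeta> \<partial>circle_m) \<noteq> 0)"
  have "(\<integral>\<zeta>. cnj \<zeta> ^ k * f \<zeta> \<partial>circle_m) \<noteq> 0"
    unfolding k_def using H1_nonzero_coeff[OF assms] by (rule LeastI_ex)
  moreover have "(\<lambda>\<zeta>. cnj \<zeta> ^ k * f \<zeta>) \<in> H1"
    by (rule H1_cnj_power_mult[OF f]) (use not_less_Least in \<open>auto simp: k_def\<close>)
  ultimately show ?thesis by (rule that)
qed

text \<open>If neither factor vanished a.e., dividing each by its power of zeta would make both
  means nonzero, and with them the mean of the product.\<close>

lemma Hinf_mult_H1_eq_0:
  assumes f: "f \<in> H1" and g: "g \<in> Hinf" and fg: "AE \<zeta> in circle_m. g \<zeta> * f \<zeta> = 0"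
    and nz: "\<not> (AE \<zeta> in circle_m. f \<zeta> = 0)"
  shows "AE \<zeta> in circle_m. g \<zeta> = 0"
proof (rule ccontr)
  assume gnz: "\<not> (AE \<zeta> in circle_m. g \<zeta> = 0)"
  have gH: "g \<in> H1" using g by (simp add: Hinf_iff)
  note [measurable] = H1_measurable[OF gH] H1_measurable[OF f]
  obtain k where k: "(\<integral>\<zeta>. cnj \<zeta> ^ k * f \<zeta> \<partial>circle_m) \<noteq> 0" "(\<lambda>\<zeta>. cnj \<zeta> ^ k * f \<zeta>) \<in> H1"
    by (rule H1_leading_coeff[OF f nz])
  obtain l where l: "(\<integral>\<zeta>. cnj \<zeta> ^ l * g \<zeta> \<partial>circle_m) \<noteq> 0" "(\<lambda>\<zeta>. cnj \<zeta> ^ l * g \<zeta>) \<in> H1"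
    by (rule H1_leading_coeff[OF gH gnz])
  obtain B where B: "AE \<zeta> in circle_m. norm (g \<zeta>) \<le> B" using g by (auto simp: Hinf_iff Linf_def)
  have "AE \<zeta> in circle_m. norm (cnj \<zeta> ^ l * g \<zeta>) \<le> B"
    using B AE_circle_norm by eventually_elim (simp add: norm_mult norm_power)
  then have "(\<lambda>\<zeta>. cnj \<zeta> ^ l * g \<zeta>) \<in> Hinf"
    using l(2) by (auto simp: Hinf_iff Linf_def)
  from integral_mult_Hinf[OF k(2) this]
  have "(\<integral>\<zeta>. cnj \<zeta> ^ l * g \<zeta> * (cnj \<zeta> ^ k * f \<zeta>) \<partial>circle_m) \<noteq> 0" using k(1) l(1) by simp
  moreover have "(\<integral>\<zeta>. cnj \<zeta> ^ l * g \<zeta> * (cnj \<zeta> ^ k * f \<zeta>) \<partial>circle_m) = (\<integral>\<zeta>. 0 \<partial>circle_m)"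
  proof (rule integral_cong_AE)
    show "AE \<zeta> in circle_m. cnj \<zeta> ^ l * g \<zeta> * (cnj \<zeta> ^ k * f \<zeta>) = 0"
      using fg by eventually_elim auto
  qed simp_all
  ultimately show False by simp
qed

section \<open>Inner divisors\<close>

text \<open>Beurling's theorem for the shift-invariant space of those square-integrable Hardy functions
  that the multiplier keeps analytic.\<close>
lemma multiplier_inner_divisor:
  fixes \<tau> :: "complex \<Rightarrow> real"
  assumes [measurable]: "\<tau> \<in> borel_measurable circle_m"
    and bd\<tau>: "AE \<zeta> in circle_m. \<bar>\<tau> \<zeta>\<bar> \<le> B"
    and h: "h \<in> H1" "(\<lambda>\<zeta>. of_real (\<tau> \<zeta>) * h \<zeta>) \<in> H1" and hnz: "\<not> (AE \<zeta> in circle_m. h \<zeta> = 0)"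
  obtains J where "inner_fun J" "(\<lambda>\<zeta>. of_real (\<tau> \<zeta>) * J \<zeta>) \<in> H1"
    "\<And>p. p \<in> H1 \<Longrightarrow> (\<lambda>\<zeta>. of_real (\<tau> \<zeta>) * p \<zeta>) \<in> H1 \<Longrightarrow> (\<lambda>\<zeta>. p \<zeta> / J \<zeta>) \<in> H1"
proof -
  \<comment> \<open>Square integrability is imposed to have orthogonality at hand. A general
    \<open>p\<close> enters through \<open>approx\<close>, whose multipliers keep both p and tau p
    analytic because norm (tau p) is dominated by norm p.\<close>
  define S where "S = {p \<in> H1. sq_integrable circle_m p \<and> (\<lambda>\<zeta>. of_real (\<tau> \<zeta>) * p \<zeta>) \<in> H1}"
  have S_H1: "p \<in> H1" and S_sq: "sq_integrable circle_m p" and S_\<tau>: "(\<lambda>\<zeta>. of_real (\<tau> \<zeta>) * p \<zeta>) \<in> H1" if "p \<in> S" for p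
    using that by (auto simp: S_def)
  have bdc: "AE \<zeta> in circle_m. norm (complex_of_real (\<tau> \<zeta>)) \<le> B" using bd\<tau> by simp
  have S_add: "(\<lambda>\<zeta>. p \<zeta> + q \<zeta>) \<in> S" if "p \<in> S" "q \<in> S" for p q
    using H1_add[OF S_H1 S_H1] H1_add[OF S_\<tau> S_\<tau>] sq_integrable_add[OF S_sq S_sq] that
    by (simp add: S_def distrib_left)
  have S_cmult: "(\<lambda>\<zeta>. c * p \<zeta>) \<in> S" if "p \<in> S" for p c
    using H1_cmult[OF S_H1, of p c] H1_cmult[OF S_\<tau>, of p c] sq_integrable_cmult[OF S_sq, of p c] that
    by (simp add: S_def mult.left_commute[of _ c])
  have S_power: "(\<lambda>\<zeta>. \<zeta> ^ n * p \<zeta>) \<in> S" if "p \<in> S" for p n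
  proof -
    have "sq_integrable circle_m (\<lambda>\<zeta>. \<zeta> ^ n * p \<zeta>)"
      by (rule sq_integrable_mult_bounded[OF S_sq[OF that] _ AE_norm_power_le]) simp
    moreover have "(\<lambda>\<zeta>. of_real (\<tau> \<zeta>) * (\<zeta> ^ n * p \<zeta>)) \<in> H1"
      using H1_power_mult[OF S_\<tau>[OF that], of n] by (simp add: mult.left_commute)
    ultimately show ?thesis using H1_power_mult[OF S_H1[OF that]] by (simp add: S_def)
  qed
  have approx: "\<exists>G C. (\<forall>j. G j \<in> borel_measurable circle_m) \<and> (\<forall>j. AE \<zeta> in circle_m. (norm (G j \<zeta>))\<^sup>2 \<le> C) \<and>
      (AE \<zeta> in circle_m. (\<lambda>j. G j \<zeta>) \<longlonglongrightarrow> 1) \<and> (\<forall>j. (\<lambda>\<zeta>. (G j \<zeta>)\<^sup>2 * p \<zeta>) \<in> S)"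
    if p: "p \<in> H1" "(\<lambda>\<zeta>. of_real (\<tau> \<zeta>) * p \<zeta>) \<in> H1" for p
  proof (rule H1_smoothing[OF p(1)])
    fix G :: "nat \<Rightarrow> complex \<Rightarrow> complex" and C
    assume G [measurable]: "\<And>j. G j \<in> borel_measurable circle_m"
      and bd: "\<And>j. AE \<zeta> in circle_m. (norm (G j \<zeta>))\<^sup>2 \<le> C"
      and bd2: "\<And>j. \<exists>B. AE \<zeta> in circle_m. norm ((G j \<zeta>)\<^sup>2 * p \<zeta>) \<le> B"
      and lim: "AE \<zeta> in circle_m. (\<lambda>j. G j \<zeta>) \<longlonglongrightarrow> 1"
      and mult: "\<And>j h K. h \<in> H1 \<Longrightarrow> AE \<zeta> in circle_m. norm (h \<zeta>) \<le> K * norm (p \<zeta>) \<Longrightarrow> (\<lambda>\<zeta>. (G j \<zeta>)\<^sup>2 * h \<zeta>) \<in> H1"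
    note [measurable] = H1_measurable[OF p(1)]
    have "(\<lambda>\<zeta>. (G j \<zeta>)\<^sup>2 * p \<zeta>) \<in> S" for j
    proof -
      have 1: "(\<lambda>\<zeta>. (G j \<zeta>)\<^sup>2 * p \<zeta>) \<in> H1" by (rule mult[OF p(1), of 1]) simp
      obtain B' where B': "AE \<zeta> in circle_m. norm ((G j \<zeta>)\<^sup>2 * p \<zeta>) \<le> B'" using bd2 by blast
      have 2: "sq_integrable circle_m (\<lambda>\<zeta>. (G j \<zeta>)\<^sup>2 * p \<zeta>)" by (rule sq_integrable_bounded[OF _ B']) simp
      have "AE \<zeta> in circle_m. norm (of_real (\<tau> \<zeta>) * p \<zeta>) \<le> B * norm (p \<zeta>)"
        using bd\<tau> by eventually_elim (simp add: norm_mult mult_right_mono)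
      from mult[OF p(2) this, of j]
      have 3: "(\<lambda>\<zeta>. of_real (\<tau> \<zeta>) * ((G j \<zeta>)\<^sup>2 * p \<zeta>)) \<in> H1" by (simp add: mult.left_commute)
      from 1 2 3 show ?thesis by (simp add: S_def)
    qed
    with G bd lim show ?thesis by blast
  qed
  \<comment> \<open>\<open>S\<close> contains more than null functions: smoothed versions of
    \<open>h\<close> belong to it, and if all of them vanished, so would their limit
    \<open>h\<close>.\<close>
  have "\<exists>k. \<exists>p\<in>S. (\<integral>\<zeta>. cnj \<zeta> ^ k * p \<zeta> \<partial>circle_m) \<noteq> 0"
  proof (rule ccontr)
    assume "\<not> ?thesis"
    then have zero: "AE \<zeta> in circle_m. p \<zeta> = 0" if "p \<in> S" for p
      using H1_nonzero_coeff[OF S_H1[OF that]] that by blast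
    obtain G C where lim: "AE \<zeta> in circle_m. (\<lambda>j. G j \<zeta>) \<longlonglongrightarrow> (1::complex)"
      and GS: "\<And>j::nat. (\<lambda>\<zeta>. (G j \<zeta>)\<^sup>2 * h \<zeta>) \<in> S" using approx[OF h] by blast
    have "AE \<zeta> in circle_m. \<forall>j. (G j \<zeta>)\<^sup>2 * h \<zeta> = 0"
      unfolding AE_all_countable using zero[OF GS] by blast
    then have "AE \<zeta> in circle_m. h \<zeta> = 0"
      using lim
    proof eventually_elim
      case (elim \<zeta>)
      have "(\<lambda>j. (G j \<zeta>)\<^sup>2 * h \<zeta>) \<longlonglongrightarrow> 1\<^sup>2 * h \<zeta>" by (intro tendsto_intros elim)
      then show ?case using elim(1) by (simp add: LIMSEQ_const_iff)
    qed
    then show False using hnz by blast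
  qed
  note ex = this
  \<comment> \<open>The least order of vanishing at the origin within \<open>S\<close>. The N-th
    coefficient does not see shifted members of \<open>S\<close>, because for them it is a
    coefficient of smaller index, which is 0.\<close>
  define N where "N = (LEAST k. \<exists>p\<in>S. (\<integral>\<zeta>. cnj \<zeta> ^ k * p \<zeta> \<partial>circle_m) \<noteq> 0)"
  have "\<exists>p\<in>S. (\<integral>\<zeta>. cnj \<zeta> ^ N * p \<zeta> \<partial>circle_m) \<noteq> 0" unfolding N_def using ex by (rule LeastI_ex)
  then obtain p0 where p0: "p0 \<in> S" "(\<integral>\<zeta>. cnj \<zeta> ^ N * p0 \<zeta> \<partial>circle_m) \<noteq> 0" by blast
  have N_min: "(\<integral>\<zeta>. cnj \<zeta> ^ k * p \<zeta> \<partial>circle_m) = 0" if "k < N" "p \<in> S" for k p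
    using not_less_Least[of k] that unfolding N_def by blast
  have shift0: "(\<integral>\<zeta>. cnj \<zeta> ^ N * (\<zeta> ^ n * p \<zeta>) \<partial>circle_m) = 0" if "p \<in> S" "n > 0" for p n
    unfolding integral_cnj_power_power_mult[OF H1_measurable[OF S_H1[OF that(1)]]]
    using N_min[of "N - n" p] H1_integral_power[OF S_H1[OF that(1)], of "n - N"] that by auto
  have ci: "integrable circle_m (\<lambda>\<zeta>. cnj \<zeta> ^ N * p \<zeta>)" if "p \<in> S" for p
    by (intro integrable_cnj_power_mult H1_integrable S_H1 that)
  \<comment> \<open>Fixing the N-th coefficient keeps 0 out of the minimization and is not disturbed
    by adding shifts of members of \<open>S\<close>.\<close>
  define D where "D = {p \<in> S. (\<integral>\<zeta>. cnj \<zeta> ^ N * p \<zeta> \<partial>circle_m) = 1}"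
  have D_S: "p \<in> S" and D1: "(\<integral>\<zeta>. cnj \<zeta> ^ N * p \<zeta> \<partial>circle_m) = 1" if "p \<in> D" for p
    using that by (auto simp: D_def)
  define b where "b = inverse (\<integral>\<zeta>. cnj \<zeta> ^ N * p0 \<zeta> \<partial>circle_m)"
  have "(\<integral>\<zeta>. cnj \<zeta> ^ N * (b * p0 \<zeta>) \<partial>circle_m) = b * (\<integral>\<zeta>. cnj \<zeta> ^ N * p0 \<zeta> \<partial>circle_m)"
    by (simp add: mult.left_commute[of _ b])
  then have "(\<lambda>\<zeta>. b * p0 \<zeta>) \<in> D"
    unfolding D_def using S_cmult[OF p0(1)] p0(2) by (simp add: b_def)
  then have ne: "D \<noteq> {}" by blast
  have sD: "sq_integrable circle_m P" if "P \<in> D" for P using S_sq[OF D_S[OF that]] .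
  have convD: "(\<lambda>\<zeta>. (P \<zeta> + Q \<zeta>) / 2) \<in> D" if PQ: "P \<in> D" "Q \<in> D" for P Q
  proof -
    have 1: "(\<lambda>\<zeta>. (1/2) * (P \<zeta> + Q \<zeta>)) \<in> S" by (intro S_cmult S_add D_S PQ)
    have "(\<integral>\<zeta>. cnj \<zeta> ^ N * ((1/2) * (P \<zeta> + Q \<zeta>)) \<partial>circle_m) =
        (\<integral>\<zeta>. (1/2) * (cnj \<zeta> ^ N * P \<zeta> + cnj \<zeta> ^ N * Q \<zeta>) \<partial>circle_m)"
      by (intro Bochner_Integration.integral_cong refl) (simp add: field_simps)
    also have "\<dots> = (1/2) * (1 + 1)"
      unfolding integral_mult_right_zero
      using ci[OF D_S[OF PQ(1)]] ci[OF D_S[OF PQ(2)]] D1[OF PQ(1)] D1[OF PQ(2)] by simp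
    finally show ?thesis using 1 by (simp add: D_def)
  qed
  \<comment> \<open>\<open>Q\<close> ranges over all of \<open>S\<close>, beyond what the
    minimization asks for: \<open>divJ\<close> needs orthogonality to shifts of functions that are
    not normalized.\<close>
  have dirD: "(\<lambda>\<zeta>. P \<zeta> + c * (\<zeta> ^ n * Q \<zeta>)) \<in> D" if PQ: "P \<in> D" "Q \<in> S" "n > 0" for P Q n c
  proof -
    have 1: "(\<lambda>\<zeta>. P \<zeta> + c * (\<zeta> ^ n * Q \<zeta>)) \<in> S" by (intro S_cmult S_add S_power D_S PQ)
    have "(\<integral>\<zeta>. cnj \<zeta> ^ N * (P \<zeta> + c * (\<zeta> ^ n * Q \<zeta>)) \<partial>circle_m) =
        (\<integral>\<zeta>. cnj \<zeta> ^ N * P \<zeta> + c * (cnj \<zeta> ^ N * (\<zeta> ^ n * Q \<zeta>)) \<partial>circle_m)"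
      by (simp add: algebra_simps)
    also have "\<dots> = (\<integral>\<zeta>. cnj \<zeta> ^ N * P \<zeta> \<partial>circle_m) + c * (\<integral>\<zeta>. cnj \<zeta> ^ N * (\<zeta> ^ n * Q \<zeta>) \<partial>circle_m)"
      using ci[OF D_S[OF PQ(1)]] ci[OF S_power[OF PQ(2)], of n]
      by (subst Bochner_Integration.integral_add) auto
    also have "\<dots> = 1" using D1[OF PQ(1)] shift0[OF PQ(2,3)] by simp
    finally show ?thesis using 1 by (simp add: D_def)
  qed
  show thesis
  proof (rule shift_minimizer[OF ne sD convD dirD[OF _ D_S]])
    fix P G c
    assume P: "\<And>n. P n \<in> D" and lim: "L2_tendsto circle_m P G"
      and Gc: "AE \<zeta> in circle_m. (norm (G \<zeta>))\<^sup>2 = c"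
      and orth: "\<And>v. sq_integrable circle_m v \<Longrightarrow> (\<And>Q c. Q \<in> D \<Longrightarrow> (\<lambda>x. Q x + c * v x) \<in> D) \<Longrightarrow>
       (\<integral>x. v x * cnj (G x) \<partial>circle_m) = 0"
    have G: "G \<in> H1" using S_H1[OF D_S[OF P]] lim by (rule H1_L2_closed)
    have sG: "sq_integrable circle_m G" using lim by (simp add: L2_tendsto_def)
    note [measurable] = H1_measurable[OF G]
    have "L2_tendsto circle_m (\<lambda>m \<zeta>. of_real (\<tau> \<zeta>) * P m \<zeta>) (\<lambda>\<zeta>. of_real (\<tau> \<zeta>) * G \<zeta>)"
      by (rule L2_tendsto_mult_bounded[OF lim _ bdc]) simp
    with S_\<tau>[OF D_S[OF P]] have \<tau>G: "(\<lambda>\<zeta>. of_real (\<tau> \<zeta>) * G \<zeta>) \<in> H1" by (rule H1_L2_closed)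
    have "L2_tendsto circle_m (\<lambda>m \<zeta>. cnj \<zeta> ^ N * P m \<zeta>) (\<lambda>\<zeta>. cnj \<zeta> ^ N * G \<zeta>)"
      by (rule L2_tendsto_mult_bounded[OF lim _ AE_norm_cnj_power_le]) simp
    from L2_tendsto_integral[OF this] have GN: "(\<integral>\<zeta>. cnj \<zeta> ^ N * G \<zeta> \<partial>circle_m) = 1"
      using D1[OF P] by (simp add: LIMSEQ_const_iff)
    have c: "c > 0"
    proof (rule ccontr)
      assume "\<not> c > 0"
      have "AE \<zeta> in circle_m. cnj \<zeta> ^ N * G \<zeta> = 0"
        using Gc
      proof eventually_elim
        case (elim \<zeta>)
        then have "(norm (G \<zeta>))\<^sup>2 \<le> 0" using \<open>\<not> c > 0\<close> by simp
        then show ?case by simp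
      qed
      then have "(\<integral>\<zeta>. cnj \<zeta> ^ N * G \<zeta> \<partial>circle_m) = (\<integral>\<zeta>. 0 \<partial>circle_m)" by (intro integral_cong_AE) auto
      then show False using GN by simp
    qed
    define a where "a = complex_of_real (1 / sqrt c)"
    define J where "J \<zeta> = a * G \<zeta>" for \<zeta>
    have a: "a \<noteq> 0" using c by (simp add: a_def)
    have J_norm: "AE \<zeta> in circle_m. norm (J \<zeta>) = 1"
      using Gc
    proof eventually_elim
      case (elim \<zeta>)
      have "norm (G \<zeta>) = sqrt c" using elim by (intro real_sqrt_unique[symmetric]) auto
      then show ?case using c by (simp add: J_def a_def norm_mult norm_divide)
    qed
    have J: "J \<in> H1" unfolding J_def by (intro H1_cmult G)
    note [measurable] = H1_measurable[OF J]
    have "AE \<zeta> in circle_m. norm (J \<zeta>) \<le> 1" using J_norm by eventually_elim simp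
    then have J_inner: "inner_fun J" using J J_norm by (auto simp: inner_fun_def Hinf_iff Linf_def)
    have \<tau>J: "(\<lambda>\<zeta>. of_real (\<tau> \<zeta>) * J \<zeta>) \<in> H1"
      using H1_cmult[OF \<tau>G, of a] by (simp add: J_def mult.left_commute[of _ a])
    have divJ: "(\<lambda>\<zeta>. p \<zeta> / J \<zeta>) \<in> H1" if p: "p \<in> H1" "(\<lambda>\<zeta>. of_real (\<tau> \<zeta>) * p \<zeta>) \<in> H1" for p
    proof -
      note [measurable] = H1_measurable[OF p(1)]
      obtain g C where g [measurable]: "\<And>j. g j \<in> borel_measurable circle_m"
        and bd: "\<And>j. AE \<zeta> in circle_m. (norm (g j \<zeta> :: complex))\<^sup>2 \<le> C"
        and lg: "AE \<zeta> in circle_m. (\<lambda>j. g j \<zeta>) \<longlonglongrightarrow> 1" and gS: "\<And>j. (\<lambda>\<zeta>. (g j \<zeta>)\<^sup>2 * p \<zeta>) \<in> S"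
        using approx[OF p] by blast
      have bJ: "AE \<zeta> in circle_m. norm (cnj (J \<zeta>)) \<le> 1" using J_norm by eventually_elim simp
      have ip: "integrable circle_m (\<lambda>\<zeta>. cnj (J \<zeta>) * p \<zeta>)"
        by (rule integrable_bounded_mult[OF H1_integrable[OF p(1)] _ bJ]) measurable
      \<comment> \<open>On the circle 1 / J is the conjugate of J, so the n-th moment of p / J is
        the inner product of zeta ^ n p with J. For smoothed p it vanishes by minimality, and the
        smoothing is removed in the limit.\<close>
      have "(\<lambda>\<zeta>. cnj (J \<zeta>) * p \<zeta>) \<in> H1"
        unfolding H1_iff
      proof (intro conjI allI impI ip)
        fix n :: nat assume n: "n > 0"
        have "(\<integral>\<zeta>. (g j \<zeta>)\<^sup>2 * (\<zeta> ^ n * (cnj (J \<zeta>) * p \<zeta>)) \<partial>circle_m) = 0" for j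
        proof -
          have "(\<integral>\<zeta>. (\<zeta> ^ n * ((g j \<zeta>)\<^sup>2 * p \<zeta>)) * cnj (G \<zeta>) \<partial>circle_m) = 0"
            by (rule orth[OF S_sq[OF S_power[OF gS]] dirD[OF _ gS n]])
          then have "cnj a * (\<integral>\<zeta>. (\<zeta> ^ n * ((g j \<zeta>)\<^sup>2 * p \<zeta>)) * cnj (G \<zeta>) \<partial>circle_m) = 0" by simp
          then have "(\<integral>\<zeta>. cnj a * ((\<zeta> ^ n * ((g j \<zeta>)\<^sup>2 * p \<zeta>)) * cnj (G \<zeta>)) \<partial>circle_m) = 0"
            unfolding integral_mult_right_zero .
          then show ?thesis by (simp add: J_def mult_ac)
        qed
        moreover have "(\<lambda>j. \<integral>\<zeta>. (g j \<zeta>)\<^sup>2 * (\<zeta> ^ n * (cnj (J \<zeta>) * p \<zeta>)) \<partial>circle_m) \<longlonglongrightarrow>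
            (\<integral>\<zeta>. \<zeta> ^ n * (cnj (J \<zeta>) * p \<zeta>) \<partial>circle_m)"
          by (rule smoothing_limit[OF integrable_power_mult[OF ip] g bd lg])
        ultimately show "(\<integral>\<zeta>. \<zeta> ^ n * (cnj (J \<zeta>) * p \<zeta>) \<partial>circle_m) = 0" by (simp add: LIMSEQ_const_iff)
      qed
      then show ?thesis
      proof (rule H1_cong_AE)
        show "AE \<zeta> in circle_m. cnj (J \<zeta>) * p \<zeta> = p \<zeta> / J \<zeta>"
          using J_norm
        proof eventually_elim
          case (elim \<zeta>)
          then have "J \<zeta> * cnj (J \<zeta>) = 1" by (simp add: complex_norm_square[symmetric])
          then have "1 / J \<zeta> = cnj (J \<zeta>)" by (simp add: inverse_unique inverse_eq_divide[symmetric])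
          then show ?case by (simp add: divide_inverse mult.commute inverse_eq_divide[symmetric])
        qed
      qed measurable
    qed
    show thesis by (rule that[OF J_inner \<tau>J divJ])
  qed
qed

section \<open>Extreme points\<close>

text \<open>Equality in the triangle inequality makes a and b nonnegative multiples of a + b. The
  factor is written as a real part so that it is a total, measurable real function of a and b; if a
  + b = 0 then a and b vanish and division by 0 gives 0.\<close>

lemma norm_add_eq_collinear:
  fixes a b :: complex
  assumes "norm (a + b) = norm a + norm b"
  shows "a - b = of_real (Re ((a - b) / (a + b))) * (a + b)" "\<bar>Re ((a - b) / (a + b))\<bar> \<le> 1"
proof -
  have "a - b = of_real (Re ((a - b) / (a + b))) * (a + b) \<and> \<bar>Re ((a - b) / (a + b))\<bar> \<le> 1"
  proof (cases "a + b = 0")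
    case True
    then have "norm a + norm b = 0" using assms by simp
    then have "a = 0" "b = 0" using norm_ge_zero[of a] norm_ge_zero[of b] by (simp_all add: add_nonneg_eq_0_iff)
    then show ?thesis by simp
  next
    case False
    have col: "norm a *\<^sub>R b = norm b *\<^sub>R a" using assms norm_triangle_eq by blast
    define s where "s = norm a + norm b"
    have s: "s > 0" using False assms by (metis s_def zero_less_norm_iff)
    \<comment> \<open>After expansion the two sides differ by twice the collinearity relation
      \<open>col\<close>.\<close>
    have "of_real s * (a - b) = of_real (norm a - norm b) * (a + b)"
      using col by (simp add: s_def scaleR_conv_of_real algebra_simps)
    then have e: "(a - b) / (a + b) = of_real ((norm a - norm b) / s)"
      using False s by (simp add: field_simps)
    have "\<bar>(norm a - norm b) / s\<bar> \<le> 1" using s by (simp add: s_def abs_le_iff field_simps)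
    moreover have "a - b = ((a - b) / (a + b)) * (a + b)" using False by simp
    ultimately show ?thesis unfolding e by simp
  qed
  then show "a - b = of_real (Re ((a - b) / (a + b))) * (a + b)" "\<bar>Re ((a - b) / (a + b))\<bar> \<le> 1" by blast+
qed

section \<open>The norm, the Toeplitz kernel and the subspace\<close>

lemma norm1_cong_AE:
  assumes [measurable]: "f \<in> borel_measurable circle_m" "g \<in> borel_measurable circle_m"
    and "AE \<zeta> in circle_m. f \<zeta> = g \<zeta>"
  shows "norm1 f = norm1 g"
  unfolding norm1_def using assms(3) by (intro integral_cong_AE) (auto elim: eventually_mono)

lemma norm1_cmult: "norm1 (\<lambda>\<zeta>. c * f \<zeta>) = norm c * norm1 f"
  by (simp add: norm1_def norm_mult)

lemma norm1_add_le:
  assumes "integrable circle_m f" "integrable circle_m g"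
  shows "norm1 (\<lambda>\<zeta>. f \<zeta> + g \<zeta>) \<le> norm1 f + norm1 g"
proof -
  have "norm1 (\<lambda>\<zeta>. f \<zeta> + g \<zeta>) \<le> (\<integral>\<zeta>. norm (f \<zeta>) + norm (g \<zeta>) \<partial>circle_m)"
    unfolding norm1_def using assms by (intro integral_mono) (auto intro: norm_triangle_ineq)
  also have "\<dots> = norm1 f + norm1 g" unfolding norm1_def using assms by simp
  finally show ?thesis .
qed

lemma norm1_pos_not_AE_zero:
  assumes "f \<in> borel_measurable circle_m" "norm1 f \<noteq> 0"
  shows "\<not> (AE \<zeta> in circle_m. f \<zeta> = 0)"
  using norm1_cong_AE[of f "\<lambda>_. 0"] assms by (auto simp: norm1_def)

lemma K1_H1: "f \<in> K1 \<phi> \<Longrightarrow> f \<in> H1"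
  by (simp add: K1_def)

lemma K1_H1_cnj: "f \<in> K1 \<phi> \<Longrightarrow> (\<lambda>\<zeta>. cnj (\<zeta> * \<phi> \<zeta> * f \<zeta>)) \<in> H1"
  by (simp add: K1_def)

lemma K1_add: "f \<in> K1 \<phi> \<Longrightarrow> g \<in> K1 \<phi> \<Longrightarrow> (\<lambda>\<zeta>. f \<zeta> + g \<zeta>) \<in> K1 \<phi>"
  using H1_add[OF K1_H1_cnj K1_H1_cnj] by (auto simp: K1_def distrib_left intro: H1_add)

lemma K1_cmult:
  assumes "f \<in> K1 \<phi>"
  shows "(\<lambda>\<zeta>. c * f \<zeta>) \<in> K1 \<phi>"
proof -
  have "(\<lambda>\<zeta>. cnj c * cnj (\<zeta> * \<phi> \<zeta> * f \<zeta>)) \<in> H1" by (intro H1_cmult K1_H1_cnj assms)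
  then have "(\<lambda>\<zeta>. cnj (\<zeta> * \<phi> \<zeta> * (c * f \<zeta>))) \<in> H1" by (simp add: mult_ac)
  then show ?thesis using assms by (simp add: K1_def H1_cmult)
qed

lemma K1_diff: "f \<in> K1 \<phi> \<Longrightarrow> g \<in> K1 \<phi> \<Longrightarrow> (\<lambda>\<zeta>. f \<zeta> - g \<zeta>) \<in> K1 \<phi>"
  using K1_add[OF _ K1_cmult[of g \<phi> "-1"]] by simp

lemma mult_H1_add:
  assumes "f \<in> mult_H1 \<psi>" "g \<in> mult_H1 \<psi>"
  shows "(\<lambda>\<zeta>. f \<zeta> + g \<zeta>) \<in> mult_H1 \<psi>"
proof -
  obtain a b where ab: "a \<in> H1" "b \<in> H1" "AE \<zeta> in circle_m. f \<zeta> = \<psi> \<zeta> * a \<zeta>" "AE \<zeta> in circle_m. g \<zeta> = \<psi> \<zeta> * b \<zeta>"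
    using assms by (auto simp: mult_H1_def)
  have "AE \<zeta> in circle_m. f \<zeta> + g \<zeta> = \<psi> \<zeta> * (a \<zeta> + b \<zeta>)"
    using ab(3,4) by eventually_elim (simp add: distrib_left)
  then show ?thesis using H1_add[OF ab(1,2)] by (auto simp: mult_H1_def intro!: bexI[of _ "\<lambda>\<zeta>. a \<zeta> + b \<zeta>"])
qed

lemma mult_H1_mult_Hinf:
  assumes "f \<in> mult_H1 \<psi>" "g \<in> Hinf"
  shows "(\<lambda>\<zeta>. g \<zeta> * f \<zeta>) \<in> mult_H1 \<psi>"
proof -
  obtain a where a: "a \<in> H1" "AE \<zeta> in circle_m. f \<zeta> = \<psi> \<zeta> * a \<zeta>"
    using assms by (auto simp: mult_H1_def)
  have "AE \<zeta> in circle_m. g \<zeta> * f \<zeta> = \<psi> \<zeta> * (g \<zeta> * a \<zeta>)"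
    using a(2) by eventually_elim (simp add: mult_ac)
  then show ?thesis using H1_mult_Hinf[OF a(1) assms(2)] by (auto simp: mult_H1_def intro!: bexI[of _ "\<lambda>\<zeta>. g \<zeta> * a \<zeta>"])
qed

lemma mult_H1_cong_AE:
  assumes "f \<in> mult_H1 \<psi>" "AE \<zeta> in circle_m. f \<zeta> = g \<zeta>"
  shows "g \<in> mult_H1 \<psi>"
proof -
  obtain a where a: "a \<in> H1" "AE \<zeta> in circle_m. f \<zeta> = \<psi> \<zeta> * a \<zeta>"
    using assms by (auto simp: mult_H1_def)
  have "AE \<zeta> in circle_m. g \<zeta> = \<psi> \<zeta> * a \<zeta>" using a(2) assms(2) by eventually_elim simp
  then show ?thesis using a(1) by (auto simp: mult_H1_def)
qed

lemma const_Hinf: "(\<lambda>_. c) \<in> Hinf"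
proof -
  have "(\<lambda>_. c) \<in> Linf" by (auto simp: Linf_def intro!: exI[of _ "norm c"])
  then show ?thesis by (simp add: Hinf_iff H1_const)
qed

lemma mult_H1_cmult: "f \<in> mult_H1 \<psi> \<Longrightarrow> (\<lambda>\<zeta>. c * f \<zeta>) \<in> mult_H1 \<psi>"
  using mult_H1_mult_Hinf[OF _ const_Hinf] by blast

lemma E_sub_add: "f \<in> E_sub \<phi> \<psi> \<Longrightarrow> g \<in> E_sub \<phi> \<psi> \<Longrightarrow> (\<lambda>\<zeta>. f \<zeta> + g \<zeta>) \<in> E_sub \<phi> \<psi>"
  by (simp add: E_sub_def K1_add mult_H1_add)

lemma E_sub_cmult: "f \<in> E_sub \<phi> \<psi> \<Longrightarrow> (\<lambda>\<zeta>. c * f \<zeta>) \<in> E_sub \<phi> \<psi>"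
  by (simp add: E_sub_def K1_cmult mult_H1_cmult)

lemma E_sub_diff: "f \<in> E_sub \<phi> \<psi> \<Longrightarrow> g \<in> E_sub \<phi> \<psi> \<Longrightarrow> (\<lambda>\<zeta>. f \<zeta> - g \<zeta>) \<in> E_sub \<phi> \<psi>"
  using E_sub_add[OF _ E_sub_cmult[of g \<phi> \<psi> "-1"]] by simp

text \<open>Functions are not identified modulo null sets, so equality a.e. of two representatives
  has to be turned into membership of their difference in the subspace.\<close>

lemma E_sub_AE_zero:
  assumes "f \<in> K1 \<phi>" "AE \<zeta> in circle_m. f \<zeta> = 0"
  shows "f \<in> E_sub \<phi> \<psi>"
  using assms H1_const[of 0] by (auto simp: E_sub_def mult_H1_def intro!: bexI[of _ "\<lambda>_. 0"])

lemma E_sub_zero: "(\<lambda>_. 0) \<in> E_sub \<phi> \<psi>"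
  by (rule E_sub_AE_zero) (simp_all add: K1_def H1_const)

lemma qnorm_le:
  assumes "y \<in> Y"
  shows "qnorm Y x \<le> norm1 (\<lambda>\<zeta>. x \<zeta> + y \<zeta>)"
  unfolding qnorm_def
proof (rule cInf_lower)
  show "bdd_below ((\<lambda>y. norm1 (\<lambda>\<zeta>. x \<zeta> + y \<zeta>)) ` Y)"
    by (rule bdd_belowI[of _ 0]) (auto simp: norm1_def)
qed (use assms in blast)

text \<open>This rigidity serves twice: for extremality of the coset and for uniqueness of the
  minimizer. It speaks of representatives of norm at most 1, so the quotient norm does not
  occur.\<close>

lemma rel_prime_imp_extreme:
  assumes h: "h \<in> K1 \<phi>" and rp: "rel_prime_inner h (\<lambda>\<zeta>. cnj (\<zeta> * \<phi> \<zeta> * h \<zeta>))"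
    and n1: "norm1 h = 1" and u: "u \<in> K1 \<phi>" "norm1 u \<le> 1" and v: "v \<in> K1 \<phi>" "norm1 v \<le> 1"
    and eq: "AE \<zeta> in circle_m. u \<zeta> + v \<zeta> = 2 * h \<zeta>"
  shows "AE \<zeta> in circle_m. u \<zeta> = v \<zeta>"
proof -
  note [measurable] = H1_measurable[OF K1_H1[OF h]] H1_measurable[OF K1_H1[OF u(1)]] H1_measurable[OF K1_H1[OF v(1)]]
  define h1 u1 v1 where "h1 \<zeta> = cnj (\<zeta> * \<phi> \<zeta> * h \<zeta>)" and "u1 \<zeta> = cnj (\<zeta> * \<phi> \<zeta> * u \<zeta>)" and "v1 \<zeta> = cnj (\<zeta> * \<phi> \<zeta> * v \<zeta>)" for \<zeta>
  have h1: "h1 \<in> H1" and u1: "u1 \<in> H1" and v1: "v1 \<in> H1"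
    using K1_H1_cnj[OF h] K1_H1_cnj[OF u(1)] K1_H1_cnj[OF v(1)]
    by (simp_all add: h1_def[abs_def] u1_def[abs_def] v1_def[abs_def])
  note [measurable] = H1_measurable[OF h1]
  note ii = H1_integrable[OF K1_H1[OF h]] H1_integrable[OF K1_H1[OF u(1)]] H1_integrable[OF K1_H1[OF v(1)]]
  have "norm1 (\<lambda>\<zeta>. u \<zeta> + v \<zeta>) = norm1 (\<lambda>\<zeta>. 2 * h \<zeta>)" using eq by (intro norm1_cong_AE) auto
  then have n2: "norm1 (\<lambda>\<zeta>. u \<zeta> + v \<zeta>) = 2" by (simp add: norm1_cmult n1)
  \<comment> \<open>The defect in the triangle inequality is nonnegative and its integral is at most
    1 + 1 - 2, so it vanishes a.e.\<close>
  define r where "r \<zeta> = norm (u \<zeta>) + norm (v \<zeta>) - norm (u \<zeta> + v \<zeta>)" for \<zeta>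
  have r0: "r \<zeta> \<ge> 0" for \<zeta> using norm_triangle_ineq[of "u \<zeta>" "v \<zeta>"] by (simp add: r_def)
  have ri: "integrable circle_m r" unfolding r_def using ii by simp
  have "(\<integral>\<zeta>. r \<zeta> \<partial>circle_m) = norm1 u + norm1 v - norm1 (\<lambda>\<zeta>. u \<zeta> + v \<zeta>)"
    unfolding r_def norm1_def using ii by simp
  also have "\<dots> \<le> 0" using u v n2 by simp
  finally have "(\<integral>\<zeta>. r \<zeta> \<partial>circle_m) = 0" using r0 integral_nonneg_AE[of r circle_m] by (simp add: order_antisym)
  then have "AE \<zeta> in circle_m. r \<zeta> = 0" using integral_nonneg_eq_0_iff_AE[OF ri] r0 by auto
  then have col: "AE \<zeta> in circle_m. norm (u \<zeta> + v \<zeta>) = norm (u \<zeta>) + norm (v \<zeta>)"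
    by eventually_elim (simp add: r_def)
  define \<tau> where "\<tau> \<zeta> = Re ((u \<zeta> - v \<zeta>) / (u \<zeta> + v \<zeta>))" for \<zeta>
  have [measurable]: "\<tau> \<in> borel_measurable circle_m" unfolding \<tau>_def by measurable
  have bd: "AE \<zeta> in circle_m. \<bar>\<tau> \<zeta>\<bar> \<le> 1"
    using col by eventually_elim (unfold \<tau>_def, rule norm_add_eq_collinear(2))
  have dif: "AE \<zeta> in circle_m. u \<zeta> - v \<zeta> = of_real (\<tau> \<zeta>) * (2 * h \<zeta>)"
    using col eq
  proof eventually_elim
    case (elim \<zeta>)
    show ?case using norm_add_eq_collinear(1)[OF elim(1)] unfolding \<tau>_def elim(2) .
  qed
  have "(\<lambda>\<zeta>. (1/2) * (u \<zeta> - v \<zeta>)) \<in> H1" by (intro H1_cmult H1_diff K1_H1[OF u(1)] K1_H1[OF v(1)])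
  then have \<tau>h: "(\<lambda>\<zeta>. of_real (\<tau> \<zeta>) * h \<zeta>) \<in> H1"
    by (rule H1_cong_AE) (use dif in \<open>auto elim!: eventually_mono\<close>)
  \<comment> \<open>Conjugation leaves the real factor unchanged, so the same multiplier keeps
    \<open>h1\<close> analytic.\<close>
  have "(\<lambda>\<zeta>. (1/2) * (u1 \<zeta> - v1 \<zeta>)) \<in> H1" by (intro H1_cmult H1_diff u1 v1)
  then have \<tau>h1: "(\<lambda>\<zeta>. of_real (\<tau> \<zeta>) * h1 \<zeta>) \<in> H1"
  proof (rule H1_cong_AE)
    show "AE \<zeta> in circle_m. (1/2) * (u1 \<zeta> - v1 \<zeta>) = of_real (\<tau> \<zeta>) * h1 \<zeta>"
      using dif
    proof eventually_elim
      case (elim \<zeta>)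
      have "u1 \<zeta> - v1 \<zeta> = cnj (\<zeta> * \<phi> \<zeta> * (u \<zeta> - v \<zeta>))" by (simp add: u1_def v1_def algebra_simps)
      then show ?case unfolding elim by (simp add: h1_def)
    qed
  qed measurable
  have nz: "\<not> (AE \<zeta> in circle_m. h \<zeta> = 0)" using n1 by (intro norm1_pos_not_AE_zero) auto
  show ?thesis
  proof (rule multiplier_inner_divisor[OF _ bd K1_H1[OF h] \<tau>h nz])
    fix J assume J: "inner_fun J" and \<tau>J: "(\<lambda>\<zeta>. of_real (\<tau> \<zeta>) * J \<zeta>) \<in> H1"
      and dvd: "\<And>p. p \<in> H1 \<Longrightarrow> (\<lambda>\<zeta>. of_real (\<tau> \<zeta>) * p \<zeta>) \<in> H1 \<Longrightarrow> (\<lambda>\<zeta>. p \<zeta> / J \<zeta>) \<in> H1"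
    have "(\<lambda>\<zeta>. h \<zeta> / J \<zeta>) \<in> H1" by (rule dvd[OF K1_H1[OF h] \<tau>h])
    moreover have "(\<lambda>\<zeta>. cnj (\<zeta> * \<phi> \<zeta> * h \<zeta>) / J \<zeta>) \<in> H1"
      using dvd[OF h1 \<tau>h1] by (simp add: h1_def)
    ultimately have "ae_constant J" using rp J unfolding rel_prime_inner_def by blast
    then obtain c where c: "AE \<zeta> in circle_m. J \<zeta> = c" by (auto simp: ae_constant_def)
    have "AE \<zeta> in circle_m. norm (J \<zeta>) = 1" using J by (simp add: inner_fun_def)
    then have "AE \<zeta> in circle_m. c \<noteq> 0" using c by eventually_elim auto
    then have c0: "c \<noteq> 0" by (simp add: circle.AE_const)
    have "(\<lambda>\<zeta>. of_real (\<tau> \<zeta>)) \<in> H1"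
      by (rule H1_cong_AE[OF H1_cmult[OF \<tau>J, of "1 / c"]]) (use c c0 in \<open>auto elim!: eventually_mono\<close>)
    from real_H1_AE_const[OF this] obtain t where t: "AE \<zeta> in circle_m. \<tau> \<zeta> = t" by blast
    have uv: "AE \<zeta> in circle_m. u \<zeta> = of_real (1 + t) * h \<zeta> \<and> v \<zeta> = of_real (1 - t) * h \<zeta>"
      using dif eq t
    proof eventually_elim
      case (elim \<zeta>)
      have "2 * u \<zeta> = (u \<zeta> - v \<zeta>) + (u \<zeta> + v \<zeta>)" "2 * v \<zeta> = (u \<zeta> + v \<zeta>) - (u \<zeta> - v \<zeta>)" by simp_all
      then have "2 * u \<zeta> = 2 * (of_real (1 + t) * h \<zeta>)" "2 * v \<zeta> = 2 * (of_real (1 - t) * h \<zeta>)"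
        unfolding elim by (simp_all add: algebra_simps)
      then show ?case by simp
    qed
    \<comment> \<open>Since \<open>h\<close> has norm 1, the norms of u = (1 + t) h and v = (1 - t)
      h are both at most 1 only for t = 0.\<close>
    have "norm1 u = norm1 (\<lambda>\<zeta>. of_real (1 + t) * h \<zeta>)" using uv by (intro norm1_cong_AE) (auto elim: eventually_mono)
    then have "\<bar>1 + t\<bar> \<le> 1" using u(2) n1 unfolding norm1_cmult norm_of_real by simp
    moreover have "norm1 v = norm1 (\<lambda>\<zeta>. of_real (1 - t) * h \<zeta>)" using uv by (intro norm1_cong_AE) (auto elim: eventually_mono)
    then have "\<bar>1 - t\<bar> \<le> 1" using v(2) n1 unfolding norm1_cmult norm_of_real by simp
    ultimately have "t = 0" by linarith
    from uv show ?thesis by eventually_elim (simp add: \<open>t = 0\<close>)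
  qed measurable
qed

section \<open>Common inner divisors and perturbations of the coset\<close>

lemma inner_fun_Hinf: "inner_fun J \<Longrightarrow> J \<in> Hinf"
  and inner_fun_norm: "inner_fun J \<Longrightarrow> AE \<zeta> in circle_m. norm (J \<zeta>) = 1"
  by (simp_all add: inner_fun_def)

text \<open>On the circle Re (c J) is half of c J + cnj c / J, so the product is p / J multiplied by
  a polynomial in J. Divisibility of p by J is what absorbs the negative power.\<close>

lemma H1_mult_Re_inner:
  assumes J: "inner_fun J" and [measurable]: "p \<in> borel_measurable circle_m"
    and pJ: "(\<lambda>\<zeta>. p \<zeta> / J \<zeta>) \<in> H1"
  shows "(\<lambda>\<zeta>. of_real (Re (c * J \<zeta>) - d) * p \<zeta>) \<in> H1"
proof -
  note Ji = inner_fun_Hinf[OF J]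
  have [measurable]: "J \<in> borel_measurable circle_m" using Ji by (simp add: Hinf_iff H1_measurable)
  have "(\<lambda>\<zeta>. (c/2) * (J \<zeta> * (J \<zeta> * (p \<zeta> / J \<zeta>))) + (cnj c/2) * (p \<zeta> / J \<zeta>) - of_real d * (J \<zeta> * (p \<zeta> / J \<zeta>))) \<in> H1"
    by (intro H1_add H1_diff H1_cmult H1_mult_Hinf[OF _ Ji] pJ)
  then show ?thesis
  proof (rule H1_cong_AE)
    show "AE \<zeta> in circle_m. (c/2) * (J \<zeta> * (J \<zeta> * (p \<zeta> / J \<zeta>))) + (cnj c/2) * (p \<zeta> / J \<zeta>) - of_real d * (J \<zeta> * (p \<zeta> / J \<zeta>)) =
       of_real (Re (c * J \<zeta>) - d) * p \<zeta>"
      using inner_fun_norm[OF J]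
    proof eventually_elim
      case (elim \<zeta>)
      then have 1: "J \<zeta> * cnj (J \<zeta>) = 1" by (simp add: complex_norm_square[symmetric])
      then have nz: "J \<zeta> \<noteq> 0" by auto
      have 2: "p \<zeta> / J \<zeta> = cnj (J \<zeta>) * p \<zeta>"
        using nz 1 by (simp add: field_simps)
      have 3: "complex_of_real (Re (c * J \<zeta>)) = (c * J \<zeta> + cnj c * cnj (J \<zeta>)) / 2"
        using complex_add_cnj[of "c * J \<zeta>"] by simp
      have 4: "J \<zeta> * (p \<zeta> / J \<zeta>) = p \<zeta>" using nz by simp
      show ?case unfolding 4 of_real_diff 3 unfolding 2 by (simp add: field_simps)
    qed
  qed measurable
qed

text \<open>Let tau be Re (c J) minus its mean under the density norm h. Then h (1 + tau / 2) and h
  (1 - tau / 2) both have norm 1: the factors are nonnegative and tau has weighted mean 0. The coset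
  of \<open>f\<close> is their midpoint, so extremality forces their difference tau h into the
  subspace.\<close>

lemma extreme_perturbation_mult_H1:
  assumes h: "h \<in> K1 \<phi>" and n1: "norm1 h = 1" and hf: "(\<lambda>\<zeta>. f \<zeta> - h \<zeta>) \<in> E_sub \<phi> \<psi>"
    and ext: "quotient_extreme (K1 \<phi>) (E_sub \<phi> \<psi>) f"
    and J: "inner_fun J" and hJ: "(\<lambda>\<zeta>. h \<zeta> / J \<zeta>) \<in> H1"
    and h1J: "(\<lambda>\<zeta>. cnj (\<zeta> * \<phi> \<zeta> * h \<zeta>) / J \<zeta>) \<in> H1" and c: "norm c = 1"
  shows "(\<lambda>\<zeta>. of_real (Re (c * J \<zeta>) - (\<integral>\<zeta>. norm (h \<zeta>) * Re (c * J \<zeta>) \<partial>circle_m)) * h \<zeta>) \<in> mult_H1 \<psi>"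
proof -
  let ?d = "\<integral>\<zeta>. norm (h \<zeta>) * Re (c * J \<zeta>) \<partial>circle_m"
  have [measurable]: "J \<in> borel_measurable circle_m"
    using inner_fun_Hinf[OF J] by (simp add: Hinf_iff H1_measurable)
  note [measurable] = H1_measurable[OF K1_H1[OF h]] H1_measurable[OF K1_H1_cnj[OF h]]
  define \<tau> where "\<tau> \<zeta> = Re (c * J \<zeta>) - ?d" for \<zeta>
  have [measurable]: "\<tau> \<in> borel_measurable circle_m" unfolding \<tau>_def by measurable
  have hi: "integrable circle_m (\<lambda>\<zeta>. norm (h \<zeta>))" using H1_integrable[OF K1_H1[OF h]] by simp
  have h_int: "(\<integral>\<zeta>. norm (h \<zeta>) \<partial>circle_m) = 1" using n1 by (simp add: norm1_def)
  have ReJ: "AE \<zeta> in circle_m. \<bar>Re (c * J \<zeta>)\<bar> \<le> 1"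
    using inner_fun_norm[OF J]
  proof eventually_elim
    case (elim \<zeta>)
    then show ?case using abs_Re_le_cmod[of "c * J \<zeta>"] c by (simp add: norm_mult)
  qed
  have Ri: "integrable circle_m (\<lambda>\<zeta>. norm (h \<zeta>) * Re (c * J \<zeta>))"
  proof (rule Bochner_Integration.integrable_bound[OF hi])
    show "AE \<zeta> in circle_m. norm (norm (h \<zeta>) * Re (c * J \<zeta>)) \<le> norm (norm (h \<zeta>))"
      using ReJ by eventually_elim (simp add: abs_mult mult_left_le del: times_complex.sel)
  qed measurable
  have d1: "\<bar>?d\<bar> \<le> 1"
  proof -
    have "\<bar>?d\<bar> \<le> (\<integral>\<zeta>. \<bar>norm (h \<zeta>) * Re (c * J \<zeta>)\<bar> \<partial>circle_m)" by (rule integral_abs_bound)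
    also have "\<dots> \<le> (\<integral>\<zeta>. norm (h \<zeta>) \<partial>circle_m)"
    proof (rule integral_mono_AE)
      show "AE \<zeta> in circle_m. \<bar>norm (h \<zeta>) * Re (c * J \<zeta>)\<bar> \<le> norm (h \<zeta>)"
        using ReJ by eventually_elim (simp add: abs_mult mult_left_le del: times_complex.sel)
    qed (use Ri hi in \<open>auto simp del: times_complex.sel\<close>)
    finally show ?thesis using h_int by simp
  qed
  \<comment> \<open>Both Re (c J) and its mean lie in [-1, 1]. The bound 2 is the origin of the
    restriction of s to at most 1/2 in absolute value, which keeps 1 + s tau nonnegative.\<close>
  have bd: "AE \<zeta> in circle_m. \<bar>\<tau> \<zeta>\<bar> \<le> 2"
    using ReJ unfolding \<tau>_def by eventually_elim (use d1 in linarith)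
  have \<tau>i: "integrable circle_m (\<lambda>\<zeta>. norm (h \<zeta>) * \<tau> \<zeta>)" and \<tau>0: "(\<integral>\<zeta>. norm (h \<zeta>) * \<tau> \<zeta> \<partial>circle_m) = 0"
    unfolding \<tau>_def right_diff_distrib using Ri hi h_int by (simp_all del: times_complex.sel)
  define g where "g \<zeta> = of_real (\<tau> \<zeta>) * h \<zeta>" for \<zeta>
  have gK: "g \<in> K1 \<phi>"
  proof -
    have "g \<in> H1" unfolding g_def \<tau>_def by (rule H1_mult_Re_inner[OF J _ hJ]) measurable
    moreover have "(\<lambda>\<zeta>. of_real (\<tau> \<zeta>) * cnj (\<zeta> * \<phi> \<zeta> * h \<zeta>)) \<in> H1"
      unfolding \<tau>_def by (rule H1_mult_Re_inner[OF J _ h1J]) measurable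
    then have "(\<lambda>\<zeta>. cnj (\<zeta> * \<phi> \<zeta> * g \<zeta>)) \<in> H1" by (simp add: g_def mult_ac)
    ultimately show ?thesis by (simp add: K1_def)
  qed
  have le1: "qnorm (E_sub \<phi> \<psi>) (\<lambda>\<zeta>. h \<zeta> + of_real s * g \<zeta>) \<le> 1" if s: "\<bar>s\<bar> \<le> 1/2" for s
  proof -
    have "qnorm (E_sub \<phi> \<psi>) (\<lambda>\<zeta>. h \<zeta> + of_real s * g \<zeta>) \<le> norm1 (\<lambda>\<zeta>. h \<zeta> + of_real s * g \<zeta>)"
      using qnorm_le[OF E_sub_zero, of \<phi> \<psi> "\<lambda>\<zeta>. h \<zeta> + of_real s * g \<zeta>"] by simp
    also have "\<dots> = (\<integral>\<zeta>. norm (h \<zeta>) + s * (norm (h \<zeta>) * \<tau> \<zeta>) \<partial>circle_m)"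
      unfolding norm1_def
    proof (rule integral_cong_AE)
      show "AE \<zeta> in circle_m. norm (h \<zeta> + of_real s * g \<zeta>) = norm (h \<zeta>) + s * (norm (h \<zeta>) * \<tau> \<zeta>)"
        using bd
      proof eventually_elim
        case (elim \<zeta>)
        have "\<bar>s * \<tau> \<zeta>\<bar> \<le> (1/2) * 2" unfolding abs_mult using s elim by (intro mult_mono) auto
        then have "1 + s * \<tau> \<zeta> \<ge> 0" by linarith
        moreover have "h \<zeta> + of_real s * g \<zeta> = of_real (1 + s * \<tau> \<zeta>) * h \<zeta>" by (simp add: g_def algebra_simps)
        ultimately have "norm (h \<zeta> + of_real s * g \<zeta>) = (1 + s * \<tau> \<zeta>) * norm (h \<zeta>)"
          by (simp only: norm_mult norm_of_real abs_of_nonneg)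
        then show ?case by (simp add: algebra_simps)
      qed
    qed (unfold g_def, measurable)
    also have "\<dots> = 1" using hi \<tau>i h_int \<tau>0 by simp
    finally show ?thesis .
  qed
  define u v where "u \<zeta> = h \<zeta> + of_real (1/2) * g \<zeta>" and "v \<zeta> = h \<zeta> + of_real (-1/2) * g \<zeta>" for \<zeta>
  have "u \<in> K1 \<phi>" "v \<in> K1 \<phi>" unfolding u_def v_def by (intro K1_add K1_cmult h gK)+
  moreover have "qnorm (E_sub \<phi> \<psi>) u \<le> 1" "qnorm (E_sub \<phi> \<psi>) v \<le> 1"
    unfolding u_def v_def by (rule le1, simp)+
  moreover have "(\<lambda>\<zeta>. f \<zeta> - (u \<zeta> + v \<zeta>) / 2) \<in> E_sub \<phi> \<psi>"
    using hf by (simp add: u_def v_def)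
  ultimately have "(\<lambda>\<zeta>. u \<zeta> - v \<zeta>) \<in> E_sub \<phi> \<psi>" using ext unfolding quotient_extreme_def by blast
  then have "g \<in> mult_H1 \<psi>" by (simp add: u_def v_def E_sub_def)
  then show ?thesis by (simp add: g_def[abs_def] \<tau>_def del: times_complex.sel)
qed

text \<open>The perturbations for c = 1 and c = i combine to (cnj J - b) h and (J - cnj b) h, both
  divisible by psi. As J cnj J = 1, J times the first plus b times the second is (1 - b cnj b) h,
  which no longer involves J; the scalar is nonzero because J is not constant.\<close>

lemma extreme_common_divisor_imp_E_sub:
  assumes h: "h \<in> K1 \<phi>" and n1: "norm1 h = 1" and hf: "(\<lambda>\<zeta>. f \<zeta> - h \<zeta>) \<in> E_sub \<phi> \<psi>"
    and ext: "quotient_extreme (K1 \<phi>) (E_sub \<phi> \<psi>) f"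
    and J: "inner_fun J" "\<not> ae_constant J" and hJ: "(\<lambda>\<zeta>. h \<zeta> / J \<zeta>) \<in> H1"
    and h1J: "(\<lambda>\<zeta>. cnj (\<zeta> * \<phi> \<zeta> * h \<zeta>) / J \<zeta>) \<in> H1"
  shows "h \<in> E_sub \<phi> \<psi>"
proof -
  note JH = inner_fun_Hinf[OF J(1)]
  have [measurable]: "J \<in> borel_measurable circle_m" using JH by (simp add: Hinf_iff H1_measurable)
  note [measurable] = H1_measurable[OF K1_H1[OF h]]
  define d e where "d = (\<integral>\<zeta>. norm (h \<zeta>) * Re (1 * J \<zeta>) \<partial>circle_m)"
    and "e = (\<integral>\<zeta>. norm (h \<zeta>) * Re (\<i> * J \<zeta>) \<partial>circle_m)"
  \<comment> \<open>The mean of the conjugate of \<open>J\<close> under the density norm h, since Re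
    (i J) = - Im J.\<close>
  define b where "b = Complex d e"
  have d: "(\<lambda>\<zeta>. of_real (Re (1 * J \<zeta>) - d) * h \<zeta>) \<in> mult_H1 \<psi>"
    unfolding d_def by (rule extreme_perturbation_mult_H1[OF h n1 hf ext J(1) hJ h1J]) simp
  have e: "(\<lambda>\<zeta>. of_real (Re (\<i> * J \<zeta>) - e) * h \<zeta>) \<in> mult_H1 \<psi>"
    unfolding e_def by (rule extreme_perturbation_mult_H1[OF h n1 hf ext J(1) hJ h1J]) simp
  have "(\<lambda>\<zeta>. of_real (Re (1 * J \<zeta>) - d) * h \<zeta> + \<i> * (of_real (Re (\<i> * J \<zeta>) - e) * h \<zeta>)) \<in> mult_H1 \<psi>"
    by (intro mult_H1_add mult_H1_cmult d e)
  moreover have "of_real (Re (1 * J \<zeta>) - d) * h \<zeta> + \<i> * (of_real (Re (\<i> * J \<zeta>) - e) * h \<zeta>) = (cnj (J \<zeta>) - b) * h \<zeta>" for \<zeta>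
  proof -
    have "of_real (Re (1 * J \<zeta>) - d) + \<i> * of_real (Re (\<i> * J \<zeta>) - e) = cnj (J \<zeta>) - b"
      by (simp add: complex_eq_iff b_def)
    then show ?thesis by (metis distrib_right mult.assoc)
  qed
  ultimately have A1: "(\<lambda>\<zeta>. (cnj (J \<zeta>) - b) * h \<zeta>) \<in> mult_H1 \<psi>" by simp
  have "(\<lambda>\<zeta>. of_real (Re (1 * J \<zeta>) - d) * h \<zeta> + (-\<i>) * (of_real (Re (\<i> * J \<zeta>) - e) * h \<zeta>)) \<in> mult_H1 \<psi>"
    by (intro mult_H1_add mult_H1_cmult d e)
  moreover have "of_real (Re (1 * J \<zeta>) - d) * h \<zeta> + (-\<i>) * (of_real (Re (\<i> * J \<zeta>) - e) * h \<zeta>) = (J \<zeta> - cnj b) * h \<zeta>" for \<zeta>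
  proof -
    have "of_real (Re (1 * J \<zeta>) - d) + (-\<i>) * of_real (Re (\<i> * J \<zeta>) - e) = J \<zeta> - cnj b"
      by (simp add: complex_eq_iff b_def)
    then show ?thesis by (metis distrib_right mult.assoc)
  qed
  ultimately have A2: "(\<lambda>\<zeta>. (J \<zeta> - cnj b) * h \<zeta>) \<in> mult_H1 \<psi>" by simp
  have JJ: "AE \<zeta> in circle_m. J \<zeta> * cnj (J \<zeta>) = 1"
    using inner_fun_norm[OF J(1)] by eventually_elim (simp add: complex_norm_square[symmetric])
  have "(\<lambda>\<zeta>. J \<zeta> * ((cnj (J \<zeta>) - b) * h \<zeta>) + b * ((J \<zeta> - cnj b) * h \<zeta>)) \<in> mult_H1 \<psi>"
    by (intro mult_H1_add mult_H1_cmult mult_H1_mult_Hinf[OF _ JH] A1 A2)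
  then have A3: "(\<lambda>\<zeta>. (1 - b * cnj b) * h \<zeta>) \<in> mult_H1 \<psi>"
  proof (rule mult_H1_cong_AE)
    show "AE \<zeta> in circle_m. J \<zeta> * ((cnj (J \<zeta>) - b) * h \<zeta>) + b * ((J \<zeta> - cnj b) * h \<zeta>) = (1 - b * cnj b) * h \<zeta>"
      using JJ
    proof eventually_elim
      case (elim \<zeta>)
      have "J \<zeta> * ((cnj (J \<zeta>) - b) * h \<zeta>) + b * ((J \<zeta> - cnj b) * h \<zeta>) = (J \<zeta> * cnj (J \<zeta>) - b * cnj b) * h \<zeta>"
        by (simp add: algebra_simps)
      then show ?case unfolding elim .
    qed
  qed
  \<comment> \<open>Strict convexity of the disc: a mean of unimodular values that has modulus 1
    forces J = cnj b wherever h is nonzero. The absence of zero divisors extends this to almost the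
    whole circle, and J would be constant.\<close>
  have "b * cnj b \<noteq> 1"
  proof
    assume bb: "b * cnj b = 1"
    have hi: "integrable circle_m h" using H1_integrable[OF K1_H1[OF h]] .
    have bJ: "AE \<zeta> in circle_m. norm (cnj (J \<zeta>)) \<le> 1" using inner_fun_norm[OF J(1)] by eventually_elim simp
    have i: "integrable circle_m (\<lambda>\<zeta>. cnj (J \<zeta>) * of_real (norm (h \<zeta>)))"
      by (rule integrable_bounded_mult[OF _ _ bJ]) (use hi in auto)
    have I: "(\<integral>\<zeta>. cnj (J \<zeta>) * of_real (norm (h \<zeta>)) \<partial>circle_m) = b"
      using integral_Re[OF i] integral_Im[OF i] by (simp add: complex_eq_iff b_def d_def e_def mult.commute)
    \<comment> \<open>Pointwise this is norm h times 1 - Re (cnj b cnj J), hence nonnegative a.e.,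
      and its integral is 1 - b cnj b = 0.\<close>
    define r where "r \<zeta> = norm (h \<zeta>) - Re (cnj b * (cnj (J \<zeta>) * of_real (norm (h \<zeta>))))" for \<zeta>
    have i2: "integrable circle_m (\<lambda>\<zeta>. cnj b * (cnj (J \<zeta>) * of_real (norm (h \<zeta>))))" using i by simp
    have ri: "integrable circle_m r"
      unfolding r_def using hi integrable_Re[OF i2] by (simp del: times_complex.sel)
    have "(\<integral>\<zeta>. r \<zeta> \<partial>circle_m) = norm1 h - Re (cnj b * b)"
      unfolding r_def norm1_def using hi integrable_Re[OF i2] integral_Re[OF i2] I
      by (simp del: times_complex.sel)
    then have r0: "(\<integral>\<zeta>. r \<zeta> \<partial>circle_m) = 0" using n1 bb by (simp add: mult.commute)
    have nb: "norm b = 1"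
    proof -
      have "complex_of_real ((norm b)\<^sup>2) = 1" using bb by (simp only: complex_norm_square)
      then have "(norm b)\<^sup>2 = 1" using of_real_eq_1_iff by blast
      then show ?thesis using norm_ge_zero[of b] by (simp add: power2_eq_1_iff)
    qed
    have re: "r \<zeta> = norm (h \<zeta>) * (1 - Re (cnj b * cnj (J \<zeta>)))" for \<zeta>
    proof -
      have "cnj b * (cnj (J \<zeta>) * of_real (norm (h \<zeta>))) = of_real (norm (h \<zeta>)) * (cnj b * cnj (J \<zeta>))" by simp
      moreover have "Re (of_real x * z) = x * Re z" for x z by simp
      ultimately show ?thesis unfolding r_def by (simp only: right_diff_distrib mult_1_right)
    qed
    have rnn: "AE \<zeta> in circle_m. 0 \<le> r \<zeta>"
      using inner_fun_norm[OF J(1)]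
    proof eventually_elim
      case (elim \<zeta>)
      have "Re (cnj b * cnj (J \<zeta>)) \<le> norm (cnj b * cnj (J \<zeta>))" by (rule complex_Re_le_cmod)
      then have "Re (cnj b * cnj (J \<zeta>)) \<le> 1" using elim nb by (simp add: norm_mult)
      then show ?case unfolding re by simp
    qed
    have "AE \<zeta> in circle_m. r \<zeta> = 0" using integral_nonneg_eq_0_iff_AE[OF ri rnn] r0 by blast
    then have "AE \<zeta> in circle_m. (J \<zeta> - cnj b) * h \<zeta> = 0"
      using inner_fun_norm[OF J(1)]
    proof eventually_elim
      case (elim \<zeta>)
      show ?case
      proof (cases "h \<zeta> = 0")
        case False
        then have R: "Re (cnj b * cnj (J \<zeta>)) = 1" using elim(1) unfolding re by simp
        have "norm (cnj b * cnj (J \<zeta>)) = 1" using elim nb by (simp add: norm_mult)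
        then have "(Re (cnj b * cnj (J \<zeta>)))\<^sup>2 + (Im (cnj b * cnj (J \<zeta>)))\<^sup>2 = 1"
          using cmod_power2[of "cnj b * cnj (J \<zeta>)"] by simp
        then have "Im (cnj b * cnj (J \<zeta>)) = 0" unfolding R by simp
        then have "cnj b * cnj (J \<zeta>) = 1" using R by (simp only: complex_eq_iff one_complex.sel)
        then have "b * J \<zeta> = 1" by (metis complex_cnj_cnj complex_cnj_mult complex_cnj_one)
        then have "(b * cnj b) * J \<zeta> = cnj b" by (simp add: mult_ac)
        then show ?thesis using bb by simp
      qed simp
    qed
    moreover have "(\<lambda>\<zeta>. J \<zeta> - cnj b) \<in> Hinf"
    proof -
      have "AE \<zeta> in circle_m. norm (J \<zeta> - cnj b) \<le> 2"
        using inner_fun_norm[OF J(1)]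
      proof eventually_elim
        case (elim \<zeta>)
        then show ?case using norm_triangle_ineq4[of "J \<zeta>" "cnj b"] nb by simp
      qed
      moreover have "(\<lambda>\<zeta>. J \<zeta> - cnj b) \<in> H1" using JH by (intro H1_diff H1_const) (simp add: Hinf_iff)
      ultimately show ?thesis by (auto simp: Hinf_iff Linf_def)
    qed
    moreover have "\<not> (AE \<zeta> in circle_m. h \<zeta> = 0)" using n1 by (intro norm1_pos_not_AE_zero) auto
    ultimately have "AE \<zeta> in circle_m. J \<zeta> - cnj b = 0" using Hinf_mult_H1_eq_0[OF K1_H1[OF h]] by blast
    then have "AE \<zeta> in circle_m. J \<zeta> = cnj b" by eventually_elim simp
    then show False using J(2) unfolding ae_constant_def by blast
  qed
  then have "h = (\<lambda>\<zeta>. (1 / (1 - b * cnj b)) * ((1 - b * cnj b) * h \<zeta>))" by auto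
  then have "h \<in> mult_H1 \<psi>" using mult_H1_cmult[OF A3] by metis
  then show ?thesis using h by (simp add: E_sub_def)
qed

text \<open>Convexity gives norm at most 1, the quotient norm of \<open>f\<close> gives at least 1.
  Only the midpoint has to lie in the coset of \<open>f\<close>; \<open>u\<close> and
  \<open>v\<close> may represent other cosets.\<close>

lemma Mset_midpoint:
  assumes f: "f \<in> K1 \<phi>" "qnorm (E_sub \<phi> \<psi>) f = 1"
    and u: "u \<in> K1 \<phi>" "norm1 u \<le> 1" and v: "v \<in> K1 \<phi>" "norm1 v \<le> 1"
    and E: "(\<lambda>\<zeta>. (u \<zeta> + v \<zeta>) / 2 - f \<zeta>) \<in> E_sub \<phi> \<psi>"
  shows "(\<lambda>\<zeta>. (u \<zeta> + v \<zeta>) / 2) \<in> Mset (K1 \<phi>) (E_sub \<phi> \<psi>) f"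
proof -
  have e: "(\<lambda>\<zeta>. (u \<zeta> + v \<zeta>) / 2) = (\<lambda>\<zeta>. (1/2) * (u \<zeta> + v \<zeta>))" by simp
  have e2: "(\<lambda>\<zeta>. (u \<zeta> + v \<zeta>) / 2) = (\<lambda>\<zeta>. f \<zeta> + ((u \<zeta> + v \<zeta>) / 2 - f \<zeta>))" by simp
  have K: "(\<lambda>\<zeta>. (u \<zeta> + v \<zeta>) / 2) \<in> K1 \<phi>" unfolding e by (intro K1_cmult K1_add u v)
  have "norm1 (\<lambda>\<zeta>. (u \<zeta> + v \<zeta>) / 2) = (1/2) * norm1 (\<lambda>\<zeta>. u \<zeta> + v \<zeta>)" unfolding e norm1_cmult by simp
  also have "\<dots> \<le> 1"
    using norm1_add_le[OF H1_integrable[OF K1_H1[OF u(1)]] H1_integrable[OF K1_H1[OF v(1)]]] u(2) v(2) by simp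
  finally have "norm1 (\<lambda>\<zeta>. (u \<zeta> + v \<zeta>) / 2) \<le> 1" .
  moreover have "1 \<le> norm1 (\<lambda>\<zeta>. (u \<zeta> + v \<zeta>) / 2)"
    using qnorm_le[OF E, of f] f(2) by simp
  ultimately have "norm1 (\<lambda>\<zeta>. (u \<zeta> + v \<zeta>) / 2) = qnorm (E_sub \<phi> \<psi>) f" using f(2) by simp
  moreover have "\<exists>y\<in>E_sub \<phi> \<psi>. (\<lambda>\<zeta>. (u \<zeta> + v \<zeta>) / 2) = (\<lambda>\<zeta>. f \<zeta> + y \<zeta>)"
    by (rule bexI[OF _ E]) (rule e2)
  ultimately show ?thesis unfolding Mset_def using K by simp
qed

theorem theorem1p2:
  fixes \<phi> \<psi> f :: "complex \<Rightarrow> complex"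
  assumes "\<phi> \<in> Linf"
    and "\<exists>g\<in>K1 \<phi>. \<not> ae_zero g"
    and "inner_fun \<psi>" and "\<not> ae_constant \<psi>"
    and "proximinal (K1 \<phi>) (E_sub \<phi> \<psi>)"
    and "f \<in> K1 \<phi>"
    and "qnorm (E_sub \<phi> \<psi>) f = 1"
  shows "quotient_extreme (K1 \<phi>) (E_sub \<phi> \<psi>) f \<longleftrightarrow>
    (\<exists>h\<in>K1 \<phi>. ae_singleton (Mset (K1 \<phi>) (E_sub \<phi> \<psi>) f) h \<and>
               rel_prime_inner h (\<lambda>\<zeta>. cnj (\<zeta> * \<phi> \<zeta> * h \<zeta>)))"
proof
  let ?K = "K1 \<phi>" and ?E = "E_sub \<phi> \<psi>"
  note f = assms(6) and q = assms(7)
  {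
    assume ext: "quotient_extreme ?K ?E f"
    have M: "h \<in> ?K" "norm1 h = 1" "(\<lambda>\<zeta>. h \<zeta> - f \<zeta>) \<in> ?E" if h: "h \<in> Mset ?K ?E f" for h
    proof -
      obtain y where y: "y \<in> ?E" "h = (\<lambda>\<zeta>. f \<zeta> + y \<zeta>)" using h by (auto simp: Mset_def)
      show "h \<in> ?K" "norm1 h = 1" using h q by (auto simp: Mset_def)
      show "(\<lambda>\<zeta>. h \<zeta> - f \<zeta>) \<in> ?E" using y by simp
    qed
    \<comment> \<open>Shown for every minimizer, because uniqueness will use it at the midpoint of
      two minimizers.\<close>
    have rp: "rel_prime_inner h (\<lambda>\<zeta>. cnj (\<zeta> * \<phi> \<zeta> * h \<zeta>))" if h: "h \<in> Mset ?K ?E f" for h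
    proof (rule ccontr)
      have fh: "(\<lambda>\<zeta>. f \<zeta> - h \<zeta>) \<in> ?E" using E_sub_cmult[OF M(3)[OF h], of "-1"] by simp
      assume "\<not> ?thesis"
      then obtain J where J: "inner_fun J" "\<not> ae_constant J" "(\<lambda>\<zeta>. h \<zeta> / J \<zeta>) \<in> H1"
        "(\<lambda>\<zeta>. cnj (\<zeta> * \<phi> \<zeta> * h \<zeta>) / J \<zeta>) \<in> H1"
        unfolding rel_prime_inner_def by blast
      have "h \<in> ?E" by (rule extreme_common_divisor_imp_E_sub[OF M(1,2)[OF h] fh ext J])
      \<comment> \<open>With \<open>h\<close> also \<open>f\<close> would lie in the subspace, and
        adding -f to f would bound the quotient norm 1 by 0.\<close>
      then have "(\<lambda>\<zeta>. (-1) * ((f \<zeta> - h \<zeta>) + h \<zeta>)) \<in> ?E" by (intro E_sub_cmult E_sub_add fh)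
      from qnorm_le[OF this, of f] show False using q by (simp add: norm1_def)
    qed
    obtain h where h: "h \<in> Mset ?K ?E f" using assms(5) f unfolding proximinal_def by blast
    have "AE \<zeta> in circle_m. \<xi> \<zeta> = h \<zeta>" if \<xi>: "\<xi> \<in> Mset ?K ?E f" for \<xi>
    proof -
      have "(\<lambda>\<zeta>. (1/2) * ((\<xi> \<zeta> - f \<zeta>) + (h \<zeta> - f \<zeta>))) \<in> ?E"
        by (intro E_sub_cmult E_sub_add M(3) h \<xi>)
      moreover have "(1/2) * ((\<xi> \<zeta> - f \<zeta>) + (h \<zeta> - f \<zeta>)) = (\<xi> \<zeta> + h \<zeta>) / 2 - f \<zeta>" for \<zeta>
        by (simp add: field_simps)
      ultimately have "(\<lambda>\<zeta>. (\<xi> \<zeta> + h \<zeta>) / 2 - f \<zeta>) \<in> ?E" by (simp only:)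
      then have mid: "(\<lambda>\<zeta>. (\<xi> \<zeta> + h \<zeta>) / 2) \<in> Mset ?K ?E f"
        using M[OF h] M[OF \<xi>] by (intro Mset_midpoint f q) simp_all
      \<comment> \<open>The midpoint plays the role of \<open>h\<close>, and the two minimizers
        those of \<open>u\<close> and \<open>v\<close>.\<close>
      show ?thesis
        by (rule rel_prime_imp_extreme[OF M(1)[OF mid] rp[OF mid] M(2)[OF mid] M(1)[OF \<xi>] _ M(1)[OF h]])
           (use M(2)[OF h] M(2)[OF \<xi>] in simp_all)
    qed
    then show "\<exists>h\<in>?K. ae_singleton (Mset ?K ?E f) h \<and> rel_prime_inner h (\<lambda>\<zeta>. cnj (\<zeta> * \<phi> \<zeta> * h \<zeta>))"
      using M(1)[OF h] rp[OF h] h unfolding ae_singleton_def by blast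
  }
  {
    assume "\<exists>h\<in>?K. ae_singleton (Mset ?K ?E f) h \<and> rel_prime_inner h (\<lambda>\<zeta>. cnj (\<zeta> * \<phi> \<zeta> * h \<zeta>))"
    then obtain h where h: "h \<in> ?K" "h \<in> Mset ?K ?E f" "\<And>\<xi>. \<xi> \<in> Mset ?K ?E f \<Longrightarrow> AE \<zeta> in circle_m. \<xi> \<zeta> = h \<zeta>"
      and rp: "rel_prime_inner h (\<lambda>\<zeta>. cnj (\<zeta> * \<phi> \<zeta> * h \<zeta>))"
      unfolding ae_singleton_def by blast
    have n1: "norm1 h = 1" using h(2) q by (simp add: Mset_def)
    have mid: "(\<lambda>\<zeta>. u \<zeta> - v \<zeta>) \<in> ?E"
      if u: "u \<in> ?K" "qnorm ?E u \<le> 1" and v: "v \<in> ?K" "qnorm ?E v \<le> 1"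
        and uv: "(\<lambda>\<zeta>. f \<zeta> - (u \<zeta> + v \<zeta>) / 2) \<in> ?E" for u v
    proof -
      \<comment> \<open>Proximinality supplies representatives of norm at most 1 in the same cosets,
        so that quotient norms become norms of functions.\<close>
      obtain u' where "u' \<in> Mset ?K ?E u" using assms(5) u(1) unfolding proximinal_def by blast
      then obtain y where u': "u' \<in> ?K" "norm1 u' \<le> 1" and y: "y \<in> ?E" "u' = (\<lambda>\<zeta>. u \<zeta> + y \<zeta>)"
        using u(2) by (auto simp: Mset_def)
      obtain v' where "v' \<in> Mset ?K ?E v" using assms(5) v(1) unfolding proximinal_def by blast
      then obtain z where v': "v' \<in> ?K" "norm1 v' \<le> 1" and z: "z \<in> ?E" "v' = (\<lambda>\<zeta>. v \<zeta> + z \<zeta>)"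
        using v(2) by (auto simp: Mset_def)
      \<comment> \<open>The midpoint of the new representatives is still in the coset of
        \<open>f\<close>; hence it is a minimizer, and by uniqueness it equals \<open>h\<close>
        a.e.\<close>
      have "(\<lambda>\<zeta>. (1/2) * (y \<zeta> + z \<zeta>) - (f \<zeta> - (u \<zeta> + v \<zeta>) / 2)) \<in> ?E"
        by (intro E_sub_diff E_sub_cmult E_sub_add y(1) z(1) uv)
      moreover have "(1/2) * (y \<zeta> + z \<zeta>) - (f \<zeta> - (u \<zeta> + v \<zeta>) / 2) = (u' \<zeta> + v' \<zeta>) / 2 - f \<zeta>" for \<zeta>
        by (simp add: y(2) z(2) field_simps)
      ultimately have "(\<lambda>\<zeta>. (u' \<zeta> + v' \<zeta>) / 2 - f \<zeta>) \<in> ?E" by (simp only:)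
      then have "(\<lambda>\<zeta>. (u' \<zeta> + v' \<zeta>) / 2) \<in> Mset ?K ?E f" by (rule Mset_midpoint[OF f q u' v'])
      from h(3)[OF this] have "AE \<zeta> in circle_m. u' \<zeta> + v' \<zeta> = 2 * h \<zeta>"
        by eventually_elim (simp add: field_simps)
      then have "AE \<zeta> in circle_m. u' \<zeta> = v' \<zeta>"
        by (rule rel_prime_imp_extreme[OF h(1) rp n1 u' v'])
      then have "AE \<zeta> in circle_m. u' \<zeta> - v' \<zeta> = 0" by eventually_elim simp
      \<comment> \<open>Agreement a.e. of the representatives puts their difference into the
        subspace; undoing the corrections \<open>y\<close> and \<open>z\<close> gives the same for
        \<open>u\<close> and \<open>v\<close>.\<close>
      then have "(\<lambda>\<zeta>. u' \<zeta> - v' \<zeta>) \<in> ?E" by (intro E_sub_AE_zero K1_diff u' v')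
      from E_sub_add[OF this E_sub_diff[OF z(1) y(1)]]
      have "(\<lambda>\<zeta>. (u' \<zeta> - v' \<zeta>) + (z \<zeta> - y \<zeta>)) \<in> ?E" .
      then show ?thesis by (simp add: y(2) z(2))
    qed
    show "quotient_extreme ?K ?E f" unfolding quotient_extreme_def
      by (intro conjI ballI impI) (use q in simp, rule mid)
  }
qed

end
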